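(* Let the random autoregressive coefficient satisfy the mixing density condition with parameter $\beta>3/2$ and assume $\mathrm E|\varepsilon(0)|^{2p}<\infty$ for some $p>1$. Let $(t,s)\in\mathbb Z^2$ with $s\ne0$ be fixed, and let $$S^{t,s}_{N,n}(\tau):=\sum_{i=1}^N\sum_{u=1}^{\lfloor n\tau\rfloor}X_i(u)X_{i+s}(u+t),\qquad\tau\ge0.$$ Then, as $N,n\to\infty$ in an arbitrary way, $$n^{-1/2}N^{-1/2}S^{t,s}_{N,n}(\tau)\to_{\rm fdd}\sigma B(\tau),\qquad \sigma^2:=\mathrm E A_{12},\qquad A_{12}:=\frac{1+a_1a_2}{(1-a_1^2)(1-a_2^2)(1-a_1a_2)},$$ where $\{B(\tau),\tau\ge0\}$ is a standard Brownian motion.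
   Context: Panel model. For $i\in\mathbb Z$, let $\{\varepsilon_i(t),t\in\mathbb Z\}$ be i.i.d. random variables with mean $0$ and variance $1$ (common law that of $\varepsilon(0)$), independent over $i$, and let $a_i\in[0,1)$, $i\in\mathbb Z$, be i.i.d. copies of a random variable $a$, independent of all innovations. $X_i$ is the stationary solution of $X_i(t)=a_iX_i(t-1)+\varepsilon_i(t)$, i.e. $X_i(t)=\sum_{u\le t}a_i^{t-u}\varepsilon_i(u)$, $t\in\mathbb Z$; the processes $X_i$, $i\in\mathbb Z$, are i.i.d. Mixing density condition with parameter $\beta>0$: $a$ has a density $\phi(x)=\psi(x)(1-x)^{\beta-1}$, $x\in[0,1)$, where $\psi$ is bounded on $[0,1)$ and $\psi(1):=\lim_{x\uparrow1}\psi(x)>0$ exists. $\to_{\rm fdd}$ denotes weak convergence of finite-dimensional distributions (of processes indexed by $\tau\ge0$). *)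

theory Defs
  imports "HOL-Probability.Probability"
begin

text \<open>
  Indexing all innovations and all coefficients by one sum type lets a single statement of mutual
  independence cover independence over \<open>t\<close>, over \<open>i\<close>, and of the coefficients from the innovations.
  Integrability is listed explicitly because \<open>expectation\<close> and \<open>variance\<close> are total.
\<close>

locale panel_model = prob_space M for M :: "'w measure" +
  fixes \<epsilon> :: "int \<Rightarrow> int \<Rightarrow> 'w \<Rightarrow> real" and a :: "int \<Rightarrow> 'w \<Rightarrow> real"
  assumes indep: "indep_vars (\<lambda>_. borel)
      (\<lambda>j :: (int \<times> int) + int. case j of Inl (i, t) \<Rightarrow> \<epsilon> i t | Inr i \<Rightarrow> a i) UNIV"
    and innovation_law: "distr M borel (\<epsilon> i t) = distr M borel (\<epsilon> 0 0)"
    and coefficient_law: "distr M borel (a i) = distr M borel (a 0)"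
    and coefficient_range: "AE \<omega> in M. a i \<omega> \<in> {0..<1}"
    and innovation_integrable: "integrable M (\<epsilon> 0 0)" "integrable M (\<lambda>\<omega>. (\<epsilon> 0 0 \<omega>)\<^sup>2)"
    and innovation_mean: "expectation (\<epsilon> 0 0) = 0"
    and innovation_variance: "variance (\<epsilon> 0 0) = 1"

text \<open>The sum over \<open>u \<le> t\<close> with \<open>u = t - k\<close>; it converges absolutely almost surely.\<close>

definition panel_X ::
    "(int \<Rightarrow> int \<Rightarrow> 'w \<Rightarrow> real) \<Rightarrow> (int \<Rightarrow> 'w \<Rightarrow> real) \<Rightarrow> int \<Rightarrow> int \<Rightarrow> 'w \<Rightarrow> real" where
  "panel_X \<epsilon> a i t \<omega> = (\<Sum>k. a i \<omega> ^ k * \<epsilon> i (t - int k) \<omega>)"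

definition panel_S ::
    "(int \<Rightarrow> int \<Rightarrow> 'w \<Rightarrow> real) \<Rightarrow> (int \<Rightarrow> 'w \<Rightarrow> real) \<Rightarrow> int \<Rightarrow> int \<Rightarrow> nat \<Rightarrow> nat \<Rightarrow> real \<Rightarrow> 'w \<Rightarrow> real" where
  "panel_S \<epsilon> a t s N n \<tau> \<omega> =
     (\<Sum>i\<in>{1..int N}. \<Sum>u\<in>{1..\<lfloor>real n * \<tau>\<rfloor>}.
        panel_X \<epsilon> a i u \<omega> * panel_X \<epsilon> a (i + s) (u + t) \<omega>)"

definition mixing_density :: "'w measure \<Rightarrow> ('w \<Rightarrow> real) \<Rightarrow> real \<Rightarrow> bool" where
  "mixing_density M a \<beta> \<longleftrightarrow>
     (\<exists>\<psi> l. (\<forall>x\<in>{0..<1}. 0 \<le> \<psi> x) \<and> bounded (\<psi> ` {0..<1}) \<and>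
        (\<psi> \<longlongrightarrow> l) (at_left 1) \<and> 0 < l \<and>
        distributed M lborel a
          (\<lambda>x. ennreal (indicator {0..<1} x * (\<psi> x * (1 - x) powr (\<beta> - 1)))))"

definition A_coeff :: "real \<Rightarrow> real \<Rightarrow> real" where
  "A_coeff x y = (1 + x * y) / ((1 - x\<^sup>2) * (1 - y\<^sup>2) * (1 - x * y))"

definition standard_brownian_motion :: "'b measure \<Rightarrow> (real \<Rightarrow> 'b \<Rightarrow> real) \<Rightarrow> bool" where
  "standard_brownian_motion M B \<longleftrightarrow>
     prob_space M \<and>
     (\<forall>\<tau>\<ge>0. B \<tau> \<in> borel_measurable M) \<and>
     (AE \<omega> in M. B 0 \<omega> = 0) \<and>
     (\<forall>(m :: nat) r. 0 \<le> r 0 \<and> mono_on {..m} r \<longrightarrow>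
        prob_space.indep_vars M (\<lambda>_. borel) (\<lambda>k \<omega>. B (r (Suc k)) \<omega> - B (r k) \<omega>) {..<m}) \<and>
     (\<forall>\<tau>\<^sub>1 \<tau>\<^sub>2. 0 \<le> \<tau>\<^sub>1 \<and> \<tau>\<^sub>1 < \<tau>\<^sub>2 \<longrightarrow>
        distributed M lborel (\<lambda>\<omega>. B \<tau>\<^sub>2 \<omega> - B \<tau>\<^sub>1 \<omega>)
          (\<lambda>x. ennreal (normal_density 0 (sqrt (\<tau>\<^sub>2 - \<tau>\<^sub>1)) x))) \<and>
     (AE \<omega> in M. continuous_on {0..} (\<lambda>\<tau>. B \<tau> \<omega>))"

definition weak_conv_in :: "'a topology \<Rightarrow> 'j filter \<Rightarrow> ('j \<Rightarrow> 'a measure) \<Rightarrow> 'a measure \<Rightarrow> bool" where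
  "weak_conv_in X F \<mu> \<nu> \<longleftrightarrow>
     (\<forall>f :: 'a \<Rightarrow> real. continuous_map X euclideanreal f \<and> bounded (f ` topspace X) \<longrightarrow>
        ((\<lambda>j. \<integral>x. f x \<partial>\<mu> j) \<longlongrightarrow> (\<integral>x. f x \<partial>\<nu>)) F)"

text \<open>
  For a finite set \<open>T\<close> of time points, \<open>\<real>\<^sup>T\<close> is the space of functions in \<open>extensional T\<close>, with
  topology \<open>powertop_real T\<close> and \<open>\<sigma>\<close>-algebra \<open>\<Pi>\<^sub>M \<tau>\<in>T. borel\<close>.
\<close>

definition fdd_law :: "'w measure \<Rightarrow> (real \<Rightarrow> 'w \<Rightarrow> real) \<Rightarrow> real set \<Rightarrow> (real \<Rightarrow> real) measure" where
  "fdd_law M Z T = distr M (\<Pi>\<^sub>M \<tau>\<in>T. borel) (\<lambda>\<omega>. \<lambda>\<tau>\<in>T. Z \<tau> \<omega>)"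

definition fdd_conv ::
    "'j filter \<Rightarrow> 'w measure \<Rightarrow> ('j \<Rightarrow> real \<Rightarrow> 'w \<Rightarrow> real) \<Rightarrow> 'b measure \<Rightarrow> (real \<Rightarrow> 'b \<Rightarrow> real) \<Rightarrow> bool" where
  "fdd_conv F M Z M' Y \<longleftrightarrow>
     (\<forall>T. finite T \<and> T \<subseteq> {0..} \<longrightarrow>
        weak_conv_in (powertop_real T) F (\<lambda>j. fdd_law M (Z j) T) (fdd_law M' Y T))"

end

theory Submission imports Defs begin

text \<open>
  A sum over \<open>i\<close> of functionals of the rows \<open>X i\<close> and \<open>X (i + s)\<close> is a \<open>\<bar>s\<bar>\<close>-dependent sequence, so no
  limit theorem in time is needed: the Gaussian limit comes from \<open>N \<rightarrow> \<infinity>\<close> alone, provided the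
  estimates are uniform in \<open>n\<close>. Fix a linear combination of the finite-dimensional marginals, i.e.
  weights \<open>c\<close> on the time points. The products of one innovation from row \<open>i\<close> and one from row \<open>i + s\<close>
  are orthogonal, so second moments are quadratic forms in the moments of the coefficient whose
  terms are bounded by the nonnegative ones that sum up to \<open>E A\<^sub>1\<^sub>2\<close>. Hence, in mean square and
  uniformly in \<open>n\<close>, the \<open>X i\<close> may be replaced by finite moving averages of bounded innovations. These
  have bounded fourth moments, and independent blocks of rows satisfy Lyapunov's condition. The
  autocorrelations of \<open>c\<close> converge to \<open>\<Sum>\<theta>\<^sub>j \<theta>\<^sub>k min \<tau>\<^sub>j \<tau>\<^sub>k\<close>, the covariance form of Brownian
  motion. Pointwise convergence of the characteristic functions on \<open>\<real>\<^sup>T\<close> and tightness (from second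
  moments) give weak convergence, trigonometric sums being dense on cubes.
\<close>

section \<open>Weak convergence from characteristic functions\<close>

text \<open>Lyapunov's condition is out of reach for the rows themselves. \<open>A_coeff\<close> can
  have an infinite second moment when \<beta> is close to 3/2, and the innovations need not have
  fourth moments. Hence the lags are cut at \<open>m\<close> and the innovations truncated at
  \<open>R\<close> before any limit theorem is applied. The bound \<beta> > 3/2 enters because 1 -
  xy dominates sqrt ((1 - x)(1 - y)). This gives \<open>A_coeff x y\<close> a majorant that is a
  product of two powers with exponent -3/2, integrable against the density. For s different from 0,
  a pair of innovations determines i, u - k and u - l. Two lag terms therefore correlate only if
  they share i and satisfy k - k' = l - l' = u - u'. The shift t cancels, and geometric series over
  such lags sum to \<open>A_coeff\<close>. Arbitrary joint growth dictates the order of choices: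
  first \<open>m\<close> and \<open>R\<close>, then the block length \<open>L\<close>, and only then
  the lower bounds on N and n. The requirement on n concerns finitely many autocorrelations and does
  not involve N, so the two requirements separate and hold along the product filter.\<close>

abbreviation borel_on :: "'i set \<Rightarrow> ('i \<Rightarrow> real) measure" where
  "borel_on T \<equiv> \<Pi>\<^sub>M i\<in>T. borel"

abbreviation cube :: "'i set \<Rightarrow> real \<Rightarrow> ('i \<Rightarrow> real) set" where
  "cube T r \<equiv> PiE T (\<lambda>_. {-r..r})"

abbreviation dot :: "'i set \<Rightarrow> ('i \<Rightarrow> real) \<Rightarrow> ('i \<Rightarrow> real) \<Rightarrow> real" where
  "dot T \<theta> x \<equiv> \<Sum>i\<in>T. \<theta> i * x i"

text \<open>Trigonometric polynomials in real form, with arbitrary real frequencies. The phase makes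
  sines and constants instances of the one wave constructor, and the product-to-sum formula then
  closes the span under multiplication.\<close>

inductive_set trig_sums :: "'i set \<Rightarrow> (('i \<Rightarrow> real) \<Rightarrow> real) set" for T where
  wave: "(\<lambda>x. c * cos ((dot T \<theta> x) + \<phi>)) \<in> trig_sums T"
| add: "f \<in> trig_sums T \<Longrightarrow> g \<in> trig_sums T \<Longrightarrow> (\<lambda>x. f x + g x) \<in> trig_sums T"

lemma trig_sums_const: "(\<lambda>x. c) \<in> trig_sums T"
  using trig_sums.wave[of c "\<lambda>_. 0" T 0] by simp

lemma trig_sums_mult:
  assumes "f \<in> trig_sums T" "g \<in> trig_sums T"
  shows "(\<lambda>x. f x * g x) \<in> trig_sums T"
  using assms
proof (induction arbitrary: g)
  case (wave c \<theta> \<phi>)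
  from wave.prems show ?case
  proof (induction)
    case (wave c' \<theta>' \<phi>')
    have "c * cos ((dot T \<theta> x) + \<phi>) * (c' * cos ((dot T \<theta>' x) + \<phi>'))
       = (c * c' / 2) * cos ((\<Sum>i\<in>T. (\<theta> i - \<theta>' i) * x i) + (\<phi> - \<phi>'))
         + (c * c' / 2) * cos ((\<Sum>i\<in>T. (\<theta> i + \<theta>' i) * x i) + (\<phi> + \<phi>'))" for x
    proof -
      define u v where "u = (dot T \<theta> x) + \<phi>" and "v = (dot T \<theta>' x) + \<phi>'"
      have "(\<Sum>i\<in>T. (\<theta> i - \<theta>' i) * x i) + (\<phi> - \<phi>') = u - v"
        "(\<Sum>i\<in>T. (\<theta> i + \<theta>' i) * x i) + (\<phi> + \<phi>') = u + v"
        by (simp_all add: u_def v_def algebra_simps sum.distrib sum_subtractf)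
      moreover have "c * cos u * (c' * cos v) = (c * c' / 2) * cos (u - v) + (c * c' / 2) * cos (u + v)"
        by (simp add: cos_diff cos_add field_simps)
      ultimately show ?thesis by (simp only: u_def v_def)
    qed
    then show ?case
      by (simp only:) (intro trig_sums.intros)
  next
    case (add f g)
    then show ?case by (simp add: distrib_left trig_sums.add)
  qed
next
  case (add f g')
  then show ?case by (simp add: distrib_right trig_sums.add)
qed

lemma trig_sums_polynomial:
  assumes "real_polynomial_function p" "f \<in> trig_sums T"
  shows "(\<lambda>x. p (f x)) \<in> trig_sums T"
  using assms(1)
proof induction
  case (linear q)
  have "q y = q 1 * y" for y
    using linear_simps(5)[OF linear, of y 1] by simp
  then show ?case
    using trig_sums_mult[OF trig_sums_const[of "q 1"] assms(2)] by (subst \<open>\<And>y. q y = q 1 * y\<close>)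
qed (auto intro: trig_sums_const trig_sums_mult trig_sums.add)

lemma trig_sums_bounded:
  assumes "f \<in> trig_sums T" shows "\<exists>b. \<forall>x. \<bar>f x\<bar> \<le> b"
  using assms
proof induction
  case (wave c \<theta> \<phi>)
  have "\<bar>c * cos y\<bar> \<le> \<bar>c\<bar>" for y
    using abs_cos_le_one[of y] by (simp add: abs_mult mult_left_le)
  then show ?case by blast
next
  case (add f g)
  then show ?case by (metis abs_triangle_ineq add_mono order_trans)
qed

lemma trig_sums_measurable:
  assumes "f \<in> trig_sums T" shows "f \<in> borel_measurable (borel_on T)"
  using assms by induction simp_all

lemma trig_sums_continuous:
  fixes T :: "nat set"
  assumes "f \<in> trig_sums T" shows "continuous_on S f"
  using assms
proof induction
  case (wave c \<theta> \<phi>)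
  show ?case
    by (intro continuous_intros continuous_on_subset[OF continuous_on_product_coordinates subset_UNIV])
qed (auto intro: continuous_intros)

lemma trig_sums_separate:
  assumes "finite T" "i \<in> T" "x i \<noteq> y i"
  shows "\<exists>f\<in>trig_sums T. f x \<noteq> f y"
proof -
  \<comment> \<open>The frequency is chosen so that the phase advances by exactly pi between
    \<open>x\<close> and \<open>y\<close>. A cosine with phase 0 at \<open>x\<close> then takes the
    values 1 and -1.\<close>
  define d where "d = 1 / (y i - x i)"
  define \<theta> where "\<theta> j = (if j = i then d * pi else 0)" for j
  have *: "(\<Sum>j\<in>T. \<theta> j * z j) = d * pi * z i" for z
  proof -
    have "(\<Sum>j\<in>T. \<theta> j * z j) = (\<Sum>j\<in>T. if j = i then d * pi * z i else 0)"
      by (intro sum.cong) (auto simp: \<theta>_def)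
    then show ?thesis using assms by simp
  qed
  have "d * pi * y i - d * pi * x i = pi * (d * (y i - x i))" by (simp add: algebra_simps)
  also have "d * (y i - x i) = 1" using assms by (simp add: d_def)
  finally have "d * pi * y i - d * pi * x i = pi" by simp
  then have y: "d * pi * y i + (- d * pi * x i) = pi" by simp
  have "(\<lambda>z. 1 * cos ((\<Sum>j\<in>T. \<theta> j * z j) + (- d * pi * x i))) \<in> trig_sums T"
    by (rule trig_sums.wave)
  moreover have "1 * cos ((\<Sum>j\<in>T. \<theta> j * x j) + (- d * pi * x i)) = 1" unfolding * by simp
  moreover have "1 * cos ((\<Sum>j\<in>T. \<theta> j * y j) + (- d * pi * x i)) = -1" unfolding * y by simp
  ultimately show ?thesis by (metis (no_types, lifting) one_neq_neg_one)
qed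

section \<open>Approximation by trigonometric sums on cubes\<close>

lemma compact_PiE_real:
  "compact (PiE T (\<lambda>_. {-r..r::real}) :: (nat \<Rightarrow> real) set)"
proof -
  \<comment> \<open>Extensional functions have the single value \<open>undefined\<close> outside
    \<open>T\<close>. The cube is therefore a full product in which the remaining factors are
    singletons, and Tychonoff's theorem applies.\<close>
  have "compactin (product_topology (\<lambda>i. euclidean) UNIV)
     (PiE UNIV (\<lambda>i. if i \<in> T then {-r..r} else {undefined::real}))"
    by (subst compactin_PiE) auto
  moreover have "PiE UNIV (\<lambda>i. if i \<in> T then {-r..r} else {undefined::real}) = cube T r"
    by (auto simp: PiE_iff extensional_def split: if_splits)
  ultimately show ?thesis by (simp add: euclidean_product_topology)
qed

text \<open>Renaming the coordinates by naturals moves the problem from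
  \<open>powertop_real T\<close> to the type \<open>nat => real\<close> with its product topology,
  where Stone-Weierstrass is applied.\<close>

lemma continuous_on_reindex_powertop:
  fixes d :: "'i \<Rightarrow> nat"
  assumes "continuous_map (powertop_real T) euclideanreal f"
  shows "continuous_on S (\<lambda>y. f (\<lambda>i\<in>T. y (d i)))"
proof -
  have "continuous_map euclidean (powertop_real T) (\<lambda>y. \<lambda>i\<in>T. y (d i))"
    unfolding continuous_map_componentwise
    by auto
  from continuous_map_compose[OF this assms] show ?thesis
    by (auto simp: o_def intro: continuous_on_subset)
qed

lemma trig_sums_reindex:
  assumes "g \<in> trig_sums K" and d: "bij_betw d T K"
  shows "(\<lambda>x. g (\<lambda>k\<in>K. x (inv_into T d k))) \<in> trig_sums T"
  using assms(1)
proof induction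
  case (wave c \<theta> \<phi>)
  have "(\<Sum>k\<in>K. \<theta> k * (\<lambda>k\<in>K. x (inv_into T d k)) k) = (\<Sum>i\<in>T. \<theta> (d i) * x i)" for x
    by (subst sum.reindex_bij_betw[OF d, symmetric], intro sum.cong)
       (use d in \<open>auto simp: bij_betw_def\<close>)
  then show ?case by (simp add: trig_sums.wave)
qed (rule trig_sums.add)

text \<open>Stone--Weierstrass controls an approximant only on the cube; composing it with a polynomial that
  is close to a clipping function on its range keeps it bounded everywhere.\<close>

lemma trig_sums_approx_on_box:
  assumes T: "finite T" and f: "continuous_map (powertop_real T) euclideanreal f"
    and C: "\<And>x. x \<in> extensional T \<Longrightarrow> \<bar>f x\<bar> \<le> C" and e: "e > 0"
  obtains h where "h \<in> trig_sums T" "\<And>x. x \<in> cube T r \<Longrightarrow> \<bar>h x - f x\<bar> \<le> e"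
    "\<And>x. \<bar>h x\<bar> \<le> C + e"
proof -
  let ?S = "cube T r"
  obtain d where d: "bij_betw d T {..<card T}"
    using ex_bij_betw_finite_nat[OF T] by (auto simp: atLeast0LessThan)
  let ?K = "{..<card T}"
  let ?S' = "PiE ?K (\<lambda>_. {-r..r})"
  have "\<exists>g. g \<in> trig_sums ?K \<and> (\<forall>y\<in>?S'. \<bar>f (\<lambda>i\<in>T. y (d i)) - g y\<bar> < e/2)"
  proof (rule Stone_Weierstrass_HOL[where P = "\<lambda>g. g \<in> trig_sums ?K"])
    show "\<exists>f. f \<in> trig_sums ?K \<and> f x \<noteq> f y" if "x \<in> ?S' \<and> y \<in> ?S' \<and> x \<noteq> y" for x y
    proof -
      have "x \<in> ?S'" "y \<in> ?S'" "x \<noteq> y" using that by auto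
      then obtain i where "i \<in> ?K" "x i \<noteq> y i" using PiE_ext[of x ?K _ y] by blast
      then show ?thesis using trig_sums_separate[of ?K i x y] by blast
    qed
  qed (use e in \<open>simp_all add: compact_PiE_real trig_sums_const trig_sums_continuous trig_sums.add trig_sums_mult
        continuous_on_reindex_powertop[OF f]\<close>)
  then obtain g0 where g0: "g0 \<in> trig_sums ?K" "\<And>y. y \<in> ?S' \<Longrightarrow> \<bar>f (\<lambda>i\<in>T. y (d i)) - g0 y\<bar> < e/2"
    by blast
  define g where "g x = g0 (\<lambda>k\<in>?K. x (inv_into T d k))" for x
  have g: "g \<in> trig_sums T" "\<And>x. x \<in> ?S \<Longrightarrow> \<bar>f (restrict x T) - g x\<bar> < e/2"
  proof -
    show "g \<in> trig_sums T" unfolding g_def by (rule trig_sums_reindex[OF g0(1) d])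
    fix x assume x: "x \<in> ?S"
    have inv: "inv_into T d k \<in> T" if "k < card T" for k
      using bij_betw_apply[OF bij_betw_inv_into[OF d], of k] that by simp
    have "(\<lambda>k\<in>?K. x (inv_into T d k)) \<in> ?S'" using x inv by (auto simp: PiE_iff)
    moreover have "(\<lambda>i\<in>T. (\<lambda>k\<in>?K. x (inv_into T d k)) (d i)) = restrict x T"
      using d bij_betw_apply[OF d] by (intro restrict_ext) (simp add: bij_betw_def)
    ultimately show "\<bar>f (restrict x T) - g x\<bar> < e/2"
      using g0(2) by (metis g_def)
  qed
  \<comment> \<open>The function that is \<open>undefined\<close> everywhere is extensional, so the
    bound applies to at least one point.\<close>
  have C0: "C \<ge> 0" using C[of "\<lambda>_. undefined"] by (force simp: extensional_def)
  obtain b where b: "\<And>x. \<bar>g x\<bar> \<le> b" using trig_sums_bounded[OF g(1)] by blast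
  define clip where "clip y = max (-C) (min C y)" for y :: real
  obtain p where p: "real_polynomial_function p" "\<And>y. y \<in> {-b..b} \<Longrightarrow> \<bar>clip y - p y\<bar> < e/2"
    by (rule Stone_Weierstrass_real_polynomial_function[of "{-b..b}" clip "e/2"])
       (use e in \<open>auto simp: clip_def intro!: continuous_intros\<close>)
  have pg: "\<bar>clip (g x) - p (g x)\<bar> < e/2" for x
    using b[of x] by (intro p) (auto simp: abs_le_iff)
  show ?thesis
  proof
    show "(\<lambda>x. p (g x)) \<in> trig_sums T" by (rule trig_sums_polynomial[OF p(1) g(1)])
    show "\<bar>p (g x) - f x\<bar> \<le> e" if x: "x \<in> ?S" for x
    proof -
      have "restrict x T = x" "x \<in> extensional T" using x by (auto simp: PiE_iff extensional_restrict)
      with g(2)[OF x] C[of x] have "\<bar>f x - g x\<bar> < e/2" "\<bar>f x\<bar> \<le> C" by auto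
      then have "\<bar>clip (g x) - f x\<bar> < e/2" unfolding clip_def by (auto simp: max_def min_def abs_if split: if_splits)
      with pg[of x] show ?thesis by linarith
    qed
    show "\<bar>p (g x)\<bar> \<le> C + e" for x
      using pg[of x] C0 e unfolding clip_def by (auto simp: max_def min_def abs_if split: if_splits)
  qed
qed

text \<open>On the cube of radius n the function is approximated within 1 / (n + 1) by a
  trigonometric sum. Every point lies in all large cubes, so \<open>f\<close> is a pointwise limit
  of functions measurable for the product \<sigma>-algebra.\<close>

lemma powertop_real_continuous_measurable:
  assumes T: "finite T" and f: "continuous_map (powertop_real T) euclideanreal f"
    and C: "\<And>x. x \<in> extensional T \<Longrightarrow> \<bar>f x\<bar> \<le> C"
  shows "f \<in> borel_measurable (borel_on T)"
proof -
  have "\<exists>h. h \<in> trig_sums T \<and> (\<forall>x\<in>cube T (real n). \<bar>h x - f x\<bar> \<le> 1 / Suc n)" for n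
    by (rule trig_sums_approx_on_box[OF T f C, of "1 / Suc n" "real n"]) auto
  then obtain h where h: "\<And>n. h n \<in> trig_sums T"
    "\<And>n x. x\<in>cube T (real n) \<Longrightarrow> \<bar>h n x - f x\<bar> \<le> 1 / Suc n" by metis
  show ?thesis
  proof (rule borel_measurable_LIMSEQ_real)
    show "h n \<in> borel_measurable (borel_on T)" for n by (rule trig_sums_measurable[OF h(1)])
    fix x assume "x \<in> space (\<Pi>\<^sub>M i\<in>T. borel :: real measure)"
    then have x: "x \<in> extensional T" by (simp add: space_PiM PiE_def)
    obtain n0 :: nat where n0: "(\<Sum>i\<in>T. \<bar>x i\<bar>) \<le> n0" using real_arch_simple by blast
    have "\<bar>x i\<bar> \<le> n" if "i \<in> T" "n \<ge> n0" for i n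
    proof -
      have "\<bar>x i\<bar> \<le> (\<Sum>i\<in>T. \<bar>x i\<bar>)" using T that by (intro member_le_sum) auto
      with n0 that show ?thesis by linarith
    qed
    then have "x \<in> cube T (real n)" if "n \<ge> n0" for n
      using x that abs_le_iff by (intro PiE_I) (fastforce, simp add: extensional_def)
    then have *: "eventually (\<lambda>n. norm (h n x - f x) \<le> 1 / Suc n) sequentially"
      by (intro eventually_sequentiallyI[of n0]) (use h(2) in auto)
    have "(\<lambda>n. h n x - f x) \<longlonglongrightarrow> 0"
      by (rule Lim_null_comparison[OF *]) (rule LIMSEQ_Suc, rule lim_1_over_n)
    then show "(\<lambda>n. h n x) \<longlonglongrightarrow> f x" by (simp add: LIM_zero_iff)
  qed
qed

text \<open>Convergence of characteristic functions gives convergence of the integrals of all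
  trigonometric sums. A bounded continuous \<open>f\<close> is replaced by such a sum, which is
  uniformly close on a large cube and bounded by nearly the same constant elsewhere, so the mass
  outside the cube controls the rest.\<close>

lemma weak_conv_in_powertop_real:
  fixes \<mu> :: "'j \<Rightarrow> ('i \<Rightarrow> real) measure"
  assumes T: "finite T"
    and \<mu>: "\<And>j. prob_space (\<mu> j)" "\<And>j. sets (\<mu> j) = sets (borel_on T)"
    and \<nu>: "prob_space \<nu>" "sets \<nu> = sets (borel_on T)"
    and char: "\<And>\<theta>. ((\<lambda>j. \<integral>x. iexp (dot T \<theta> x) \<partial>\<mu> j) \<longlongrightarrow> (\<integral>x. iexp (dot T \<theta> x) \<partial>\<nu>)) F"
    and tight: "\<And>e. e > 0 \<Longrightarrow> \<exists>r. (\<forall>\<^sub>F j in F. measure (\<mu> j) (space (\<mu> j) - cube T r) \<le> e)"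
  shows "weak_conv_in (powertop_real T) F \<mu> \<nu>"
  unfolding weak_conv_in_def
proof (intro allI impI, elim conjE)
  fix f :: "('i \<Rightarrow> real) \<Rightarrow> real"
  assume f: "continuous_map (powertop_real T) euclideanreal f"
    and bd: "bounded (f ` topspace (powertop_real T))"
  obtain C where C: "\<And>x. x \<in> extensional T \<Longrightarrow> \<bar>f x\<bar> \<le> C"
    using bd by (auto simp: bounded_iff PiE_def)
  have C0: "C \<ge> 0" using C[of "\<lambda>_. undefined"] by (force simp: extensional_def)
  have fm: "f \<in> borel_measurable (borel_on T)"
    by (rule powertop_real_continuous_measurable[OF T f C])
  let ?box = "\<lambda>r. PiE T (\<lambda>_. {-r..r::real})"
  have box_sets: "?box r \<in> sets (borel_on T)" for r
    by (rule sets_PiM_I_finite[OF T]) simp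
  have trig_conv: "((\<lambda>j. \<integral>x. h x \<partial>\<mu> j) \<longlongrightarrow> (\<integral>x. h x \<partial>\<nu>)) F" if "h \<in> trig_sums T" for h
    using that
  proof induction
    case (wave c \<theta> \<phi>)
    \<comment> \<open>A wave is the real part of the exponential times the constant
      \<open>iexp \<phi>\<close>, which reduces its integral to the characteristic function.\<close>
    have eq: "(\<integral>x. c * cos ((dot T \<theta> x) + \<phi>) \<partial>K) = c * Re (iexp \<phi> * (\<integral>x. iexp (dot T \<theta> x) \<partial>K))"
      if K: "prob_space K" "sets K = sets (borel_on T)" for K :: "('i \<Rightarrow> real) measure"
    proof -
      interpret K: prob_space K by fact
      have m: "(\<lambda>x. dot T \<theta> x) \<in> borel_measurable K"
        unfolding measurable_cong_sets[OF K(2) refl]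
        by (intro borel_measurable_sum borel_measurable_times borel_measurable_const measurable_component_singleton)
      have int: "integrable K (\<lambda>x. iexp (dot T \<theta> x))"
        by (rule K.integrable_iexp[OF measurable_compose[OF m borel_measurable_of_real]]) simp
      have "iexp \<phi> * (\<integral>x. iexp (dot T \<theta> x) \<partial>K) = (\<integral>x. iexp \<phi> * iexp (dot T \<theta> x) \<partial>K)"
        by (rule integral_mult_right_zero[symmetric])
      also have "Re \<dots> = (\<integral>x. Re (iexp \<phi> * iexp (dot T \<theta> x)) \<partial>K)"
        using int by (intro integral_Re[symmetric]) simp
      also have "\<dots> = (\<integral>x. cos ((dot T \<theta> x) + \<phi>) \<partial>K)"
      proof (intro Bochner_Integration.integral_cong refl)
        fix x
        have "iexp \<phi> * iexp (dot T \<theta> x) = iexp ((dot T \<theta> x) + \<phi>)"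
          by (simp add: exp_add[symmetric] algebra_simps)
        also have "Re \<dots> = cos ((dot T \<theta> x) + \<phi>)"
          unfolding cis_conv_exp[symmetric] by simp
        finally show "Re (iexp \<phi> * iexp (dot T \<theta> x)) = cos ((dot T \<theta> x) + \<phi>)" .
      qed
      finally show ?thesis by simp
    qed
    show ?case
      unfolding eq[OF \<mu>] eq[OF \<nu>] by (intro tendsto_intros char)
  next
    case (add f g)
    have int: "integrable K f" "integrable K g" if K: "prob_space K" "sets K = sets (borel_on T)"
      for K :: "('i \<Rightarrow> real) measure"
    proof -
      interpret K: prob_space K by fact
      have "integrable K f" if f: "f \<in> trig_sums T" for f
      proof -
        obtain b where b: "\<And>x. \<bar>f x\<bar> \<le> b" using trig_sums_bounded[OF f] by blast
        show ?thesis
          using trig_sums_measurable[OF f] b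
          by (intro K.integrable_const_bound[of _ b]) (auto simp: measurable_cong_sets[OF K(2) refl])
      qed
      then show "integrable K f" "integrable K g" using add by auto
    qed
    show ?case
      using tendsto_add[OF add.IH] by (simp add: int[OF \<mu>] int[OF \<nu>])
  qed
  show "((\<lambda>j. \<integral>x. f x \<partial>\<mu> j) \<longlongrightarrow> (\<integral>x. f x \<partial>\<nu>)) F"
  proof (rule tendstoI)
    fix e :: real assume e: "e > 0"
    \<comment> \<open>The total error will be d1 + 2 (d1 + (2 C + d1) d1). Once d1 <= 1 absorbs the
      quadratic term, this is at most (5 + 4 C) d1.\<close>
    define d where "d = e / (6 + 4 * C)"
    define d1 where "d1 = min d 1"
    have d: "0 < d1" "d1 \<le> 1" "d1 * (6 + 4 * C) \<le> e"
    proof -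
      have "0 < 6 + 4 * C" using C0 by simp
      then have "0 < d" "d * (6 + 4 * C) = e" using e by (simp_all add: d_def)
      moreover have "d1 * (6 + 4 * C) \<le> d * (6 + 4 * C)" using C0 by (intro mult_right_mono) (auto simp: d1_def)
      ultimately show "0 < d1" "d1 \<le> 1" "d1 * (6 + 4 * C) \<le> e" by (auto simp: d1_def)
    qed
    obtain r1 where r1: "\<forall>\<^sub>F j in F. measure (\<mu> j) (space (\<mu> j) - ?box r1) \<le> d1"
      using tight[OF d(1)] by blast
    interpret N: prob_space \<nu> by fact
    have spN: "space \<nu> = extensional T" using sets_eq_imp_space_eq[OF \<nu>(2)] by (simp add: space_PiM PiE_def)
    have sp: "space (\<mu> j) = extensional T" for j using sets_eq_imp_space_eq[OF \<mu>(2)] by (simp add: space_PiM PiE_def)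
    have "(\<lambda>n. measure \<nu> (space \<nu> - ?box (real n))) \<longlonglongrightarrow> measure \<nu> (\<Inter>n. space \<nu> - ?box (real n))"
    proof (rule N.finite_Lim_measure_decseq)
      show "range (\<lambda>n. space \<nu> - ?box (real n)) \<subseteq> sets \<nu>" using box_sets \<nu>(2) by auto
      have "?box (real m) \<subseteq> ?box (real n)" if "m \<le> n" for m n
        by (rule PiE_mono) (use that in auto)
      then show "decseq (\<lambda>n. space \<nu> - ?box (real n))" unfolding decseq_def by blast
    qed
    also have "(\<Inter>n. space \<nu> - ?box (real n)) = {}"
    proof (rule ccontr)
      assume "(\<Inter>n. space \<nu> - ?box (real n)) \<noteq> {}"
      then obtain x where x: "x \<in> extensional T" "\<And>n. x \<notin> ?box (real n)" unfolding spN by blast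
      obtain n0 :: nat where n0: "(\<Sum>i\<in>T. \<bar>x i\<bar>) \<le> n0" using real_arch_simple by blast
      have "\<bar>x i\<bar> \<le> n0" if "i \<in> T" for i
        using member_le_sum[of i T "\<lambda>i. \<bar>x i\<bar>"] T that n0 by force
      then have "x \<in> ?box (real n0)" using x(1) abs_le_iff
        by (intro PiE_I) (fastforce, simp add: extensional_def)
      with x(2) show False by blast
    qed
    finally have "\<forall>\<^sub>F n in sequentially. measure \<nu> (space \<nu> - ?box (real n)) < d1"
      using d(1) by (intro order_tendstoD) auto
    then obtain r2 :: nat where r2: "measure \<nu> (space \<nu> - ?box (real r2)) < d1"
      by (auto simp: eventually_sequentially)
    define r where "r = max r1 (real r2)"
    obtain h where h: "h \<in> trig_sums T" "\<And>x. x \<in> ?box r \<Longrightarrow> \<bar>h x - f x\<bar> \<le> d1" "\<And>x. \<bar>h x\<bar> \<le> C + d1"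
      using trig_sums_approx_on_box[OF T f C d(1), of r] by blast
    \<comment> \<open>The tail is measured outside a cube of radius \<open>r'\<close>, which is
      \<open>r1\<close> for the sequence and \<open>r2\<close> for the limit. The approximation
      holds on the larger common cube of radius \<open>r\<close>.\<close>
    have key: "\<bar>(\<integral>x. f x \<partial>K) - (\<integral>x. h x \<partial>K)\<bar> \<le> d1 + (2 * C + d1) * d1"
      if K: "prob_space K" "sets K = sets (borel_on T)"
        and out: "measure K (space K - ?box r') \<le> d1" and r': "r' \<le> r" for K :: "('i \<Rightarrow> real) measure" and r'
    proof -
      interpret K: prob_space K by fact
      have spK: "space K = extensional T" using sets_eq_imp_space_eq[OF K(2)] by (simp add: space_PiM PiE_def)
      have bK: "?box r' \<in> sets K" using box_sets K(2) by auto
      have fm': "f \<in> borel_measurable K" using fm by (simp add: measurable_cong_sets[OF K(2) refl])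
      have hm': "h \<in> borel_measurable K" using trig_sums_measurable[OF h(1)] by (simp add: measurable_cong_sets[OF K(2) refl])
      have fi: "integrable K f" using C fm' by (intro K.integrable_const_bound[of _ C]) (auto simp: spK intro!: AE_I2)
      have hi: "integrable K h" using h(3) hm' by (intro K.integrable_const_bound[of _ "C + d1"]) auto
      have bi: "integrable K (\<lambda>x. d1 + (2 * C + d1) * indicator (space K - ?box r') x :: real)"
      proof -
        have "integrable K (indicator (space K - ?box r') :: _ \<Rightarrow> real)"
          using bK by (intro integrable_real_indicator) (auto simp: K.emeasure_eq_measure)
        then show ?thesis by simp
      qed
      have "\<bar>(\<integral>x. f x \<partial>K) - (\<integral>x. h x \<partial>K)\<bar> = \<bar>\<integral>x. f x - h x \<partial>K\<bar>" using fi hi by simp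
      also have "\<dots> \<le> (\<integral>x. \<bar>f x - h x\<bar> \<partial>K)" by (rule integral_abs_bound)
      also have "\<dots> \<le> (\<integral>x. d1 + (2 * C + d1) * indicator (space K - ?box r') x \<partial>K)"
      proof (rule integral_mono)
        fix x assume x: "x \<in> space K"
        show "\<bar>f x - h x\<bar> \<le> d1 + (2 * C + d1) * indicator (space K - ?box r') x"
        proof (cases "x \<in> ?box r'")
          case True
          then have "x \<in> ?box r" using PiE_mono[of T "\<lambda>_. {-r'..r'}" "\<lambda>_. {-r..r}"] r' by auto
          then show ?thesis using h(2)[of x] True by (simp add: abs_minus_commute)
        next
          case False
          have "\<bar>f x - h x\<bar> \<le> \<bar>f x\<bar> + \<bar>h x\<bar>" by simp
          also have "\<dots> \<le> C + (C + d1)" using x by (intro add_mono C h) (simp add: spK)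
          finally show ?thesis using False x d(1) by simp
        qed
      qed (use fi hi bi in auto)
      also have "\<dots> = d1 + (2 * C + d1) * measure K (space K - ?box r')"
        using bK by (subst Bochner_Integration.integral_add) (auto simp: K.emeasure_eq_measure K.prob_space)
      also have "\<dots> \<le> d1 + (2 * C + d1) * d1"
        using out C0 d(1) by (intro add_left_mono mult_left_mono) auto
      finally show ?thesis .
    qed
    have "\<forall>\<^sub>F j in F. \<bar>(\<integral>x. h x \<partial>\<mu> j) - (\<integral>x. h x \<partial>\<nu>)\<bar> < d1"
      using tendstoD[OF trig_conv[OF h(1)] d(1)] by (simp add: dist_real_def)
    with r1 show "\<forall>\<^sub>F j in F. dist (\<integral>x. f x \<partial>\<mu> j) (\<integral>x. f x \<partial>\<nu>) < e"
    proof eventually_elim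
      case (elim j)
      have 1: "\<bar>(\<integral>x. f x \<partial>\<mu> j) - (\<integral>x. h x \<partial>\<mu> j)\<bar> \<le> d1 + (2 * C + d1) * d1"
        by (rule key[OF \<mu> elim(1)]) (simp add: r_def)
      have 2: "\<bar>(\<integral>x. f x \<partial>\<nu>) - (\<integral>x. h x \<partial>\<nu>)\<bar> \<le> d1 + (2 * C + d1) * d1"
        by (rule key[OF \<nu> less_imp_le[OF r2]]) (simp add: r_def)
      have "dist (\<integral>x. f x \<partial>\<mu> j) (\<integral>x. f x \<partial>\<nu>) < d1 + 2 * (d1 + (2 * C + d1) * d1)"
      proof -
        have "\<bar>w - z\<bar> < b + 2 * c" if "\<bar>w - u\<bar> \<le> c" "\<bar>z - v\<bar> \<le> c" "\<bar>u - v\<bar> < b" for w z u v b c :: real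
          using that by linarith
        from this[OF 1 2 elim(2)] show ?thesis unfolding dist_real_def .
      qed
      also have "\<dots> \<le> d1 + 2 * (d1 + (2 * C + 1) * d1)"
        using d C0 by (intro add_left_mono mult_left_mono mult_right_mono) auto
      also have "\<dots> \<le> d1 * (6 + 4 * C)" using d(1) by (simp add: algebra_simps)
      finally show ?case using d(3) by linarith
    qed
  qed
qed

section \<open>Characteristic functions of Brownian motion\<close>

lemma iexp_sum_indep:
  assumes "prob_space M" "prob_space.indep_vars M (\<lambda>_. borel) X I"
  shows "(\<integral>\<omega>. iexp (\<Sum>i\<in>I. X i \<omega>) \<partial>M) = (\<Prod>i\<in>I. \<integral>\<omega>. iexp (X i \<omega> :: real) \<partial>M)"
proof -
  interpret prob_space M by fact
  have rv: "random_variable borel (X i)" if "i \<in> I" for i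
    using assms(2) that by (simp add: indep_vars_def)
  have "(\<integral>\<omega>. iexp (\<Sum>i\<in>I. X i \<omega>) \<partial>M) = char (distr M borel (\<lambda>\<omega>. \<Sum>i\<in>I. X i \<omega>)) 1"
    unfolding char_def using rv by (subst integral_distr) auto
  also have "\<dots> = (\<Prod>i\<in>I. char (distr M borel (X i)) 1)"
    by (rule char_distr_sum[OF assms(2)])
  also have "\<dots> = (\<Prod>i\<in>I. \<integral>\<omega>. iexp (X i \<omega>) \<partial>M)"
    unfolding char_def using rv by (intro prod.cong refl) (subst integral_distr, auto)
  finally show ?thesis .
qed

lemma iexp_normal:
  assumes "prob_space M" "distributed M lborel X (\<lambda>x. ennreal (normal_density 0 \<sigma> x))" "\<sigma> > 0"
  shows "(\<integral>\<omega>. iexp (c * X \<omega>) \<partial>M) = exp (- (c\<^sup>2 * \<sigma>\<^sup>2 / 2) :: real)"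
proof -
  interpret prob_space M by fact
  have d: "distributed M lborel (\<lambda>x. (X x - 0) / \<sigma>) (\<lambda>x. ennreal (std_normal_density x))"
    using normal_standard_normal_convert[OF assms(3), of X 0] assms(2) by blast
  have X: "(\<lambda>x. X x / \<sigma>) \<in> borel_measurable M"
    using distributed_measurable[OF d] by simp
  have "distr M borel (\<lambda>x. X x / \<sigma>) = std_normal_distribution"
    using distributed_distr_eq_density[OF d] by (simp cong: distr_cong)
  moreover have "char (distr M borel (\<lambda>x. X x / \<sigma>)) (c * \<sigma>) = (\<integral>\<omega>. iexp (c * \<sigma> * (X \<omega> / \<sigma>)) \<partial>M)"
    unfolding char_def using X by (subst integral_distr) auto
  ultimately have "char std_normal_distribution (c * \<sigma>) = (\<integral>\<omega>. iexp (c * \<sigma> * (X \<omega> / \<sigma>)) \<partial>M)"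
    by simp
  then show ?thesis
    using assms(3) by (simp add: char_std_normal_distribution power_mult_distrib)
qed

text \<open>Summation by parts turns the linear combination into a combination of independent normal
  increments; the weight of an increment is the sum of \<theta> over the time points after
  it.\<close>

lemma brownian_char:
  assumes B: "standard_brownian_motion M B" and T: "finite T" "T \<subseteq> {0..}"
  shows "(\<integral>\<omega>. iexp (\<Sum>\<tau>\<in>T. \<theta> \<tau> * B \<tau> \<omega>) \<partial>M)
    = exp (- ((\<Sum>\<tau>\<in>T. \<Sum>\<tau>'\<in>T. \<theta> \<tau> * \<theta> \<tau>' * min \<tau> \<tau>') / 2) :: real)"
proof -
  interpret prob_space M using B by (simp add: standard_brownian_motion_def)
  define xs where "xs = sorted_list_of_set T"
  define m where "m = length xs"
  \<comment> \<open>The points of \<open>T\<close> in increasing order, preceded by the time 0 at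
    which the path starts. If 0 is in \<open>T\<close>, it occurs twice.\<close>
  define r where "r k = (if k = 0 then 0 else xs ! (k - 1))" for k
  have xs: "sorted_wrt (<) xs" "set xs = T"
    using T(1) by (simp_all add: xs_def)
  have r0: "r 0 = 0" by (simp add: r_def)
  have r_in: "r k \<in> T" if "0 < k" "k \<le> m" for k
    using that xs(2) nth_mem[of "k - 1" xs] by (auto simp: r_def m_def)
  have r_less: "r j < r k" if "0 < j" "j < k" "k \<le> m" for j k
    using that sorted_wrt_nth_less[OF xs(1), of "j - 1" "k - 1"] by (auto simp: r_def m_def)
  have r_mono: "r j \<le> r k" if "j \<le> k" "k \<le> m" for j k
    using that r_less[of j k] r_in[of k] T(2) by (cases "j = 0"; cases "j = k"; force simp: r0)
  have T_r: "\<exists>j. 0 < j \<and> j \<le> m \<and> r j = \<tau>" if \<tau>: "\<tau> \<in> T" for \<tau>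
  proof -
    obtain j where "j < length xs" "xs ! j = \<tau>" using \<tau> xs(2) by (auto simp: in_set_conv_nth)
    then show ?thesis by (intro exI[of _ "Suc j"]) (auto simp: r_def m_def)
  qed
  \<comment> \<open>Used twice: with \<open>f\<close> the values of the path, to decompose
    \<open>B \<tau>\<close>, and with \<open>f = r\<close>, to decompose
    \<open>min \<tau> \<tau>'\<close>.\<close>
  have telescope: "(\<Sum>k<m. of_bool (r (Suc k) \<le> r j) * (f (Suc k) - f k)) = f j - (f 0 :: real)"
    if j: "0 < j" "j \<le> m" for j f
  proof -
    have "r (Suc k) \<le> r j \<longleftrightarrow> k < j" if "k < m" for k
      using r_less[of j "Suc k"] r_mono[of "Suc k" j] j that by force
    then have "(\<Sum>k<m. of_bool (r (Suc k) \<le> r j) * (f (Suc k) - f k)) = (\<Sum>k<m. if k < j then f (Suc k) - f k else 0)"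
      by (intro sum.cong) auto
    also have "\<dots> = (\<Sum>k<j. f (Suc k) - f k)"
      using j by (intro sum.mono_neutral_cong_right) auto
    finally show ?thesis by (simp add: sum_lessThan_telescope)
  qed
  define D where "D k \<omega> = B (r (Suc k)) \<omega> - B (r k) \<omega>" for k \<omega>
  define l where "l k = (\<Sum>\<tau>\<in>T. \<theta> \<tau> * of_bool (r (Suc k) \<le> \<tau>))" for k
  have indep_D: "indep_vars (\<lambda>_. borel) D {..<m}"
  proof -
    have "mono_on {..m} r" by (intro mono_onI) (auto intro: r_mono)
    then show ?thesis using B r0 unfolding standard_brownian_motion_def D_def by simp
  qed
  have Bm[measurable]: "B \<tau> \<in> borel_measurable M" if "0 \<le> \<tau>" for \<tau>
    using B that by (simp add: standard_brownian_motion_def)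
  have r_nonneg: "0 \<le> r k" if "k \<le> m" for k using r_mono[of 0 k] that r0 by simp
  have AE0: "AE \<omega> in M. B 0 \<omega> = 0" using B by (simp add: standard_brownian_motion_def)
  have decomp: "(\<Sum>\<tau>\<in>T. \<theta> \<tau> * B \<tau> \<omega>) = (\<Sum>k<m. l k * D k \<omega>)" if "B 0 \<omega> = 0" for \<omega>
  proof -
    have "B \<tau> \<omega> = (\<Sum>k<m. of_bool (r (Suc k) \<le> \<tau>) * D k \<omega>)" if \<tau>: "\<tau> \<in> T" for \<tau>
    proof -
      obtain j where j: "0 < j" "j \<le> m" "r j = \<tau>" using T_r[OF \<tau>] by blast
      show ?thesis using telescope[OF j(1,2), of "\<lambda>k. B (r k) \<omega>"] \<open>B 0 \<omega> = 0\<close> j(3) by (simp add: D_def r0)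
    qed
    then have "(\<Sum>\<tau>\<in>T. \<theta> \<tau> * B \<tau> \<omega>) = (\<Sum>\<tau>\<in>T. \<Sum>k<m. \<theta> \<tau> * of_bool (r (Suc k) \<le> \<tau>) * D k \<omega>)"
      by (intro sum.cong refl) (simp only: sum_distrib_left mult.assoc)
    also have "\<dots> = (\<Sum>k<m. l k * D k \<omega>)"
      by (subst sum.swap) (simp add: l_def sum_distrib_right)
    finally show ?thesis .
  qed
  have Dm: "D k \<in> borel_measurable M" if "k < m" for k
    unfolding D_def using that by (intro borel_measurable_diff Bm r_nonneg) auto
  have normal: "(\<integral>\<omega>. iexp (l k * D k \<omega>) \<partial>M) = exp (- ((l k)\<^sup>2 * (r (Suc k) - r k) / 2))" if k: "k < m" for k
  proof (cases "r k = r (Suc k)")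
    \<comment> \<open>This occurs only for k = 0 with 0 in \<open>T\<close>. The increment vanishes,
      and the normal law is available for strictly increasing times only.\<close>
    case True
    then show ?thesis by (simp add: D_def prob_space)
  next
    case False
    then have less: "r k < r (Suc k)" using r_mono[of k "Suc k"] k by force
    then have "distributed M lborel (D k) (\<lambda>x. ennreal (normal_density 0 (sqrt (r (Suc k) - r k)) x))"
      using B r_nonneg[of k] k unfolding standard_brownian_motion_def D_def by simp
    from iexp_normal[OF prob_space_axioms this, of "l k"] less show ?thesis by simp
  qed
  have "(\<integral>\<omega>. iexp (\<Sum>\<tau>\<in>T. \<theta> \<tau> * B \<tau> \<omega>) \<partial>M) = (\<integral>\<omega>. iexp (\<Sum>k<m. l k * D k \<omega>) \<partial>M)"
  proof (rule integral_cong_AE)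
    show "AE \<omega> in M. iexp (\<Sum>\<tau>\<in>T. \<theta> \<tau> * B \<tau> \<omega>) = iexp (\<Sum>k<m. l k * D k \<omega>)"
      using AE0 by eventually_elim (simp only: decomp)
    show "(\<lambda>\<omega>. iexp (\<Sum>\<tau>\<in>T. \<theta> \<tau> * B \<tau> \<omega>)) \<in> borel_measurable M"
    proof -
      have "(\<lambda>\<omega>. \<Sum>\<tau>\<in>T. \<theta> \<tau> * B \<tau> \<omega>) \<in> borel_measurable M" using T(2) by (intro borel_measurable_sum borel_measurable_times Bm) auto
      then show ?thesis by measurable
    qed
    show "(\<lambda>\<omega>. iexp (\<Sum>k<m. l k * D k \<omega>)) \<in> borel_measurable M"
    proof -
      have "(\<lambda>\<omega>. \<Sum>k<m. l k * D k \<omega>) \<in> borel_measurable M" by (intro borel_measurable_sum borel_measurable_times Dm) auto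
      then show ?thesis by measurable
    qed
  qed
  also have "\<dots> = (\<Prod>k<m. \<integral>\<omega>. iexp (l k * D k \<omega>) \<partial>M)"
    using indep_vars_compose2[OF indep_D, of "\<lambda>k x. l k * x" "\<lambda>_. borel"]
    by (intro iexp_sum_indep[OF prob_space_axioms]) simp
  also have "\<dots> = (\<Prod>k<m. complex_of_real (exp (- ((l k)\<^sup>2 * (r (Suc k) - r k) / 2))))"
    by (intro prod.cong refl normal) simp
  also have "\<dots> = exp (- ((\<Sum>k<m. (l k)\<^sup>2 * (r (Suc k) - r k)) / 2) :: real)"
    by (simp only: of_real_prod[symmetric] exp_sum[OF finite_lessThan, symmetric] sum_negf sum_divide_distrib)
  also have "(\<Sum>k<m. (l k)\<^sup>2 * (r (Suc k) - r k)) = (\<Sum>\<tau>\<in>T. \<Sum>\<tau>'\<in>T. \<theta> \<tau> * \<theta> \<tau>' * min \<tau> \<tau>')"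
  proof -
    \<comment> \<open>The minimum is the total length of the intervals that precede both points, so
      the covariance form becomes a sum of squares over the intervals.\<close>
    have "min \<tau> \<tau>' = (\<Sum>k<m. of_bool (r (Suc k) \<le> \<tau>) * of_bool (r (Suc k) \<le> \<tau>') * (r (Suc k) - r k))"
      if "\<tau> \<in> T" "\<tau>' \<in> T" for \<tau> \<tau>'
    proof -
      have "min \<tau> \<tau>' \<in> T" using that by (simp add: min_def)
      then obtain j where j: "0 < j" "j \<le> m" "r j = min \<tau> \<tau>'" using T_r by blast
      show ?thesis using telescope[OF j(1,2), of r] j(3) by (simp add: r0 of_bool_conj mult.assoc)
    qed
    then have "(\<Sum>\<tau>\<in>T. \<Sum>\<tau>'\<in>T. \<theta> \<tau> * \<theta> \<tau>' * min \<tau> \<tau>')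
      = (\<Sum>\<tau>\<in>T. \<Sum>\<tau>'\<in>T. \<Sum>k<m. \<theta> \<tau> * \<theta> \<tau>' * (of_bool (r (Suc k) \<le> \<tau>) * of_bool (r (Suc k) \<le> \<tau>') * (r (Suc k) - r k)))"
      by (intro sum.cong) (auto simp: sum_distrib_left)
    also have "\<dots> = (\<Sum>k<m. \<Sum>\<tau>\<in>T. \<Sum>\<tau>'\<in>T. \<theta> \<tau> * \<theta> \<tau>' * (of_bool (r (Suc k) \<le> \<tau>) * of_bool (r (Suc k) \<le> \<tau>') * (r (Suc k) - r k)))"
      by (subst (2) sum.swap, subst sum.swap) simp
    also have "\<dots> = (\<Sum>k<m. (l k)\<^sup>2 * (r (Suc k) - r k))"
      by (intro sum.cong refl)
         (simp add: l_def power2_eq_square sum_product, simp add: sum_distrib_right mult.assoc mult.left_commute)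
    finally show ?thesis by simp
  qed
  finally show ?thesis .
qed

section \<open>Independence of functions of disjoint groups of variables\<close>

text \<open>A group of variables is represented by a \<sigma>-algebra on the sample space instead of
  a random vector. Independence of functionals of disjoint groups then reduces to proving their
  measurability with the usual rules.\<close>

definition generated_by :: "'w measure \<Rightarrow> ('j \<Rightarrow> 'w \<Rightarrow> real) \<Rightarrow> 'j set \<Rightarrow> 'w measure" where
  "generated_by M V A = sigma (space M) (\<Union>j\<in>A. {V j -` S \<inter> space M | S. S \<in> sets borel})"

lemma space_generated_by: "space (generated_by M V A) = space M"
  by (simp add: generated_by_def space_measure_of_conv)

lemma sets_generated_by:
  "sets (generated_by M V A) = sigma_sets (space M) (\<Union>j\<in>A. {V j -` S \<inter> space M | S. S \<in> sets borel})"
  unfolding generated_by_def by (rule sets_measure_of) auto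

lemma measurable_generated_by:
  assumes "j \<in> A" shows "V j \<in> borel_measurable (generated_by M V A)"
proof (rule measurableI)
  fix S :: "real set" assume "S \<in> sets borel"
  then show "V j -` S \<inter> space (generated_by M V A) \<in> sets (generated_by M V A)"
    unfolding space_generated_by sets_generated_by using assms by (intro sigma_sets.Basic) blast
qed simp

context prob_space
begin

text \<open>The preimages under a single variable are stable under intersection, so independence
  passes from these generators to the \<sigma>-algebras generated by disjoint groups, and from there
  to anything measurable for them.\<close>

lemma indep_vars_generated_by:
  assumes V: "indep_vars (\<lambda>_. borel) V UNIV"
    and disj: "disjoint_family_on A K"
    and X: "\<And>k. k \<in> K \<Longrightarrow> X k \<in> measurable (generated_by M V (A k)) (N k)"
  shows "indep_vars N X K"
proof -
  let ?E = "\<lambda>j. {V j -` S \<inter> space M | S. S \<in> sets borel}"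
  have V_rv: "random_variable borel (V j)" for j
    using V by (simp add: indep_vars_def2)
  have "indep_sets ?E UNIV"
    using V by (simp add: indep_vars_def2)
  then have "indep_sets ?E (\<Union>k\<in>K. A k)"
    by (rule indep_sets_mono_index[rotated]) simp
  then have indep: "indep_sets (\<lambda>k. sigma_sets (space M) (\<Union>j\<in>A k. ?E j)) K"
  proof (rule indep_sets_collect_sigma)
    show "Int_stable (?E j)" for j
    proof (rule Int_stableI)
      fix C D assume "C \<in> ?E j" "D \<in> ?E j"
      then obtain S S' where "C = V j -` S \<inter> space M" "D = V j -` S' \<inter> space M" "S \<in> sets borel" "S' \<in> sets borel"
        by blast
      then show "C \<inter> D \<in> ?E j"
        by (auto intro!: exI[of _ "S \<inter> S'"])
    qed
  qed (fact disj)
  have sub: "{X k -` S \<inter> space M | S. S \<in> sets (N k)} \<subseteq> sigma_sets (space M) (\<Union>j\<in>A k. ?E j)" if "k \<in> K" for k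
    using measurable_sets[OF X[OF that]] by (auto simp: sets_generated_by space_generated_by)
  have rv: "random_variable (N k) (X k)" if k: "k \<in> K" for k
  proof (rule measurableI)
    show "X k \<omega> \<in> space (N k)" if "\<omega> \<in> space M" for \<omega>
      using measurable_space[OF X[OF k]] that by (simp add: space_generated_by)
    have "sigma_sets (space M) (\<Union>j\<in>A k. ?E j) \<subseteq> sets M"
      using V_rv by (intro sets.sigma_sets_subset) (auto intro: measurable_sets)
    then show "X k -` S \<inter> space M \<in> sets M" if "S \<in> sets (N k)" for S
      using sub[OF k] that by blast
  qed
  show ?thesis
    unfolding indep_vars_def2 using rv indep_sets_mono_sets[OF indep sub] by blast
qed

lemma indep_var_generated_by:
  assumes V: "indep_vars (\<lambda>_. borel) V UNIV" and "A \<inter> B = {}"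
    and X: "X \<in> measurable (generated_by M V A) N" and Y: "Y \<in> measurable (generated_by M V B) N'"
  shows "indep_var N X N' Y"
  unfolding indep_var_def
proof (rule indep_vars_generated_by[OF V])
  show "disjoint_family_on (case_bool A B) UNIV"
    using assms(2) by (auto simp: disjoint_family_on_def split: bool.splits)
  show "case_bool X Y k \<in> measurable (generated_by M V (case_bool A B k)) (case_bool N N' k)" for k
    using X Y by (cases k) auto
qed

abbreviation mean_sq :: "('a \<Rightarrow> real) \<Rightarrow> real" where
  "mean_sq X \<equiv> expectation (\<lambda>\<omega>. (X \<omega>)\<^sup>2)"

abbreviation sq_integrable :: "('a \<Rightarrow> real) \<Rightarrow> bool" where
  "sq_integrable X \<equiv> integrable M (\<lambda>\<omega>. (X \<omega>)\<^sup>2)"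

abbreviation cf :: "('a \<Rightarrow> real) \<Rightarrow> real \<Rightarrow> complex" where
  "cf X x \<equiv> \<integral>\<omega>. iexp (x * X \<omega>) \<partial>M"

lemma integrable_mult_of_squares:
  fixes X Y :: "'a \<Rightarrow> real"
  assumes "X \<in> borel_measurable M" "Y \<in> borel_measurable M"
    and "sq_integrable X" "sq_integrable Y"
  shows "integrable M (\<lambda>\<omega>. X \<omega> * Y \<omega>)"
proof (rule Bochner_Integration.integrable_bound)
  show "integrable M (\<lambda>\<omega>. (X \<omega>)\<^sup>2 + (Y \<omega>)\<^sup>2)" using assms by simp
  have "\<bar>x * y\<bar> \<le> \<bar>x\<^sup>2 + y\<^sup>2\<bar>" for x y :: real
  proof -
    have "0 \<le> (\<bar>x\<bar> - \<bar>y\<bar>)\<^sup>2" "0 \<le> \<bar>x\<bar> * \<bar>y\<bar>" by simp_all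
    then have "\<bar>x\<bar> * \<bar>y\<bar> \<le> x\<^sup>2 + y\<^sup>2" unfolding power2_diff power2_abs by linarith
    then show ?thesis by (simp add: abs_mult)
  qed
  then show "AE \<omega> in M. norm (X \<omega> * Y \<omega>) \<le> norm ((X \<omega>)\<^sup>2 + (Y \<omega>)\<^sup>2)" by simp
qed (use assms in simp)

lemma integrable_of_square:
  fixes X :: "'a \<Rightarrow> real"
  assumes "X \<in> borel_measurable M" "sq_integrable X"
  shows "integrable M X"
  using integrable_mult_of_squares[OF assms(1) _ assms(2), of "\<lambda>_. 1"] by simp

lemma abs_expectation_le_root_square:
  fixes X :: "'a \<Rightarrow> real"
  assumes "X \<in> borel_measurable M" "sq_integrable X"
  shows "expectation (\<lambda>\<omega>. \<bar>X \<omega>\<bar>) \<le> sqrt (mean_sq X)"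
proof (rule real_le_rsqrt)
  have i: "integrable M (\<lambda>\<omega>. \<bar>X \<omega>\<bar>)" using integrable_of_square[OF assms] by simp
  have "0 \<le> variance (\<lambda>\<omega>. \<bar>X \<omega>\<bar>)" by (rule variance_positive)
  also have "\<dots> = mean_sq X - (expectation (\<lambda>\<omega>. \<bar>X \<omega>\<bar>))\<^sup>2"
    using i assms(2) by (subst variance_eq) auto
  finally show "(expectation (\<lambda>\<omega>. \<bar>X \<omega>\<bar>))\<^sup>2 \<le> mean_sq X" by simp
qed

end

section \<open>Second moments of weighted sums of products of two rows\<close>

definition autocorr :: "int set \<Rightarrow> (int \<Rightarrow> real) \<Rightarrow> int \<Rightarrow> real" where
  "autocorr U c d = (\<Sum>u\<in>U. c u * c (u + d))"

abbreviation energy :: "int set \<Rightarrow> (int \<Rightarrow> real) \<Rightarrow> real" where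
  "energy U c \<equiv> \<Sum>u\<in>U. (c u)\<^sup>2"

text \<open>The arithmetic-geometric mean inequality, and the fact that shifting a weight that
  vanishes outside \<open>U\<close> cannot increase its energy over \<open>U\<close>. The bound is
  the same for every lag; through it the later moment bounds depend on \<open>c\<close> only via the
  energy, and this makes them uniform in n.\<close>

lemma abs_autocorr_le:
  fixes c :: "int \<Rightarrow> real"
  assumes "finite U" "\<And>u. u \<notin> U \<Longrightarrow> c u = 0"
  shows "\<bar>autocorr U c d\<bar> \<le> energy U c"
proof -
  have "\<bar>autocorr U c d\<bar> \<le> (\<Sum>u\<in>U. \<bar>c u * c (u + d)\<bar>)"
    unfolding autocorr_def by (rule sum_abs)
  also have "\<dots> \<le> (\<Sum>u\<in>U. ((c u)\<^sup>2 + (c (u + d))\<^sup>2) / 2)"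
  proof (rule sum_mono)
    fix u
    have "0 \<le> (\<bar>c u\<bar> - \<bar>c (u + d)\<bar>)\<^sup>2" by simp
    then show "\<bar>c u * c (u + d)\<bar> \<le> ((c u)\<^sup>2 + (c (u + d))\<^sup>2) / 2"
      by (simp add: power2_diff abs_mult)
  qed
  also have "\<dots> = (energy U c + (\<Sum>u\<in>U. (c (u + d))\<^sup>2)) / 2"
    by (simp add: sum_divide_distrib[symmetric] sum.distrib)
  also have "(\<Sum>u\<in>U. (c (u + d))\<^sup>2) \<le> energy U c"
  proof -
    have "(\<Sum>u\<in>U. (c (u + d))\<^sup>2) = (\<Sum>u\<in>(\<lambda>u. u + d) ` U. (c u)\<^sup>2)"
      by (subst sum.reindex) (auto simp: inj_on_def)
    also have "\<dots> = (\<Sum>u\<in>(\<lambda>u. u + d) ` U \<inter> U. (c u)\<^sup>2)"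
      using assms by (intro sum.mono_neutral_right) auto
    also have "\<dots> \<le> energy U c"
      using assms by (intro sum_mono2) auto
    finally show ?thesis .
  qed
  finally show ?thesis by simp
qed

section \<open>Products of innovations from two different rows\<close>

locale panel_pair = panel_model +
  fixes s t :: int
  assumes s_nonzero: "s \<noteq> 0"
begin

definition V :: "(int \<times> int) + int \<Rightarrow> 'a \<Rightarrow> real" where
  "V j = (case j of Inl (i, u) \<Rightarrow> \<epsilon> i u | Inr i \<Rightarrow> a i)"

lemma V_simps: "V (Inl (i, u)) = \<epsilon> i u" "V (Inr i) = a i"
  by (simp_all add: V_def)

lemma indep_V: "indep_vars (\<lambda>_. borel) V UNIV"
  using indep unfolding V_def .

lemma V_measurable [measurable]: "V j \<in> borel_measurable M"
  using indep_V by (simp add: indep_vars_def2)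

lemma \<epsilon>_measurable [measurable]: "\<epsilon> i u \<in> borel_measurable M"
  using V_measurable[of "Inl (i, u)"] by (simp add: V_simps)

lemma a_measurable [measurable]: "a i \<in> borel_measurable M"
  using V_measurable[of "Inr i"] by (simp add: V_simps)

abbreviation "Gen \<equiv> generated_by M V"

lemmas indep_var_Gen = indep_var_generated_by[OF indep_V]

lemma \<epsilon>_Gen: "Inl (i, u) \<in> A \<Longrightarrow> \<epsilon> i u \<in> borel_measurable (Gen A)"
  using measurable_generated_by[of "Inl (i, u)" A V M] by (simp add: V_simps)

lemma a_Gen: "Inr i \<in> A \<Longrightarrow> a i \<in> borel_measurable (Gen A)"
  using measurable_generated_by[of "Inr i" A V M] by (simp add: V_simps)

lemma expectation_\<epsilon>:
  assumes "F \<in> borel_measurable borel"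
  shows "expectation (\<lambda>\<omega>. F (\<epsilon> i u \<omega>) :: real) = expectation (\<lambda>\<omega>. F (\<epsilon> 0 0 \<omega>))"
  using assms integral_distr[of "\<epsilon> i u" M borel F] integral_distr[of "\<epsilon> 0 0" M borel F] innovation_law[of i u] by simp

lemma integrable_\<epsilon>:
  assumes "F \<in> borel_measurable borel" "integrable M (\<lambda>\<omega>. F (\<epsilon> 0 0 \<omega>) :: real)"
  shows "integrable M (\<lambda>\<omega>. F (\<epsilon> i u \<omega>))"
  using assms integrable_distr_eq[of "\<epsilon> i u" M borel F] integrable_distr_eq[of "\<epsilon> 0 0" M borel F] innovation_law[of i u] by simp

lemma expectation_a:
  assumes "F \<in> borel_measurable borel"
  shows "expectation (\<lambda>\<omega>. F (a i \<omega>) :: real) = expectation (\<lambda>\<omega>. F (a 0 \<omega>))"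
  using assms integral_distr[of "a i" M borel F] integral_distr[of "a 0" M borel F] coefficient_law[of i] by simp

lemma integrable_a:
  assumes "F \<in> borel_measurable borel" "integrable M (\<lambda>\<omega>. F (a 0 \<omega>) :: real)"
  shows "integrable M (\<lambda>\<omega>. F (a i \<omega>))"
  using assms integrable_distr_eq[of "a i" M borel F] integrable_distr_eq[of "a 0" M borel F] coefficient_law[of i] by simp

lemma AE_a_range: "AE \<omega> in M. \<forall>i. a i \<omega> \<in> {0..<1}"
  unfolding AE_all_countable using coefficient_range by simp

definition \<mu> :: "nat \<Rightarrow> real" where "\<mu> k = expectation (\<lambda>\<omega>. a 0 \<omega> ^ k)"

lemma \<mu>_nonneg: "0 \<le> \<mu> k"
  unfolding \<mu>_def using AE_a_range by (intro integral_nonneg_AE) (auto elim!: eventually_mono)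

lemma integrable_a_power: "integrable M (\<lambda>\<omega>. a i \<omega> ^ k)"
proof (rule integrable_const_bound[of _ 1])
  show "AE \<omega> in M. norm (a i \<omega> ^ k) \<le> 1"
    using AE_a_range
    by eventually_elim (metis abs_of_nonneg atLeastLessThan_iff less_imp_le power_le_one real_norm_def zero_le_power)
qed simp

lemma expectation_a_power: "expectation (\<lambda>\<omega>. a i \<omega> ^ k) = \<mu> k"
  unfolding \<mu>_def by (rule expectation_a) simp

lemma indep_var_a:
  assumes "i \<noteq> j" "f \<in> borel_measurable borel" "g \<in> borel_measurable borel"
  shows "indep_var borel (\<lambda>\<omega>. f (a i \<omega>) :: real) borel (\<lambda>\<omega>. g (a j \<omega>) :: real)"
proof (rule indep_var_Gen[of "{Inr i}" "{Inr j}"])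
  show "(\<lambda>\<omega>. f (a i \<omega>)) \<in> borel_measurable (Gen {Inr i})"
    by (rule measurable_compose[OF a_Gen assms(2)]) simp
  show "(\<lambda>\<omega>. g (a j \<omega>)) \<in> borel_measurable (Gen {Inr j})"
    by (rule measurable_compose[OF a_Gen assms(3)]) simp
qed (use assms in auto)

text \<open>The second-moment calculus is done for transformed innovations, since it is later
  applied to the identity, to a recentred truncation and to the remainder of that
  truncation.\<close>

definition centred :: "(real \<Rightarrow> real) \<Rightarrow> bool" where
  "centred F \<longleftrightarrow> F \<in> borel_measurable borel \<and> sq_integrable (\<lambda>\<omega>. F (\<epsilon> 0 0 \<omega>)) \<and> expectation (\<lambda>\<omega>. F (\<epsilon> 0 0 \<omega>)) = 0"

definition second_moment :: "(real \<Rightarrow> real) \<Rightarrow> real" where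
  "second_moment F = mean_sq (\<lambda>\<omega>. F (\<epsilon> 0 0 \<omega>))"

lemma second_moment_nonneg: "0 \<le> second_moment F"
  unfolding second_moment_def by simp

lemma centred_measurable: "centred F \<Longrightarrow> F \<in> borel_measurable borel"
  by (simp add: centred_def)

definition f\<epsilon> :: "(real \<Rightarrow> real) \<Rightarrow> int \<times> int \<Rightarrow> 'a \<Rightarrow> real" where
  "f\<epsilon> F p \<omega> = F (\<epsilon> (fst p) (snd p) \<omega>)"

lemma f\<epsilon>_Gen: "centred F \<Longrightarrow> Inl p \<in> A \<Longrightarrow> f\<epsilon> F p \<in> borel_measurable (Gen A)"
  unfolding f\<epsilon>_def by (rule measurable_compose[OF \<epsilon>_Gen centred_measurable]) auto

lemma f\<epsilon>_measurable: "centred F \<Longrightarrow> f\<epsilon> F p \<in> borel_measurable M"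
  unfolding f\<epsilon>_def by (rule measurable_compose[OF \<epsilon>_measurable centred_measurable])

lemma f\<epsilon>_square_integrable: "centred F \<Longrightarrow> sq_integrable (f\<epsilon> F p)"
  unfolding f\<epsilon>_def centred_def
  using integrable_\<epsilon>[of "\<lambda>x. (F x)\<^sup>2", OF borel_measurable_power[of F borel 2]] by blast

lemma f\<epsilon>_integrable: "centred F \<Longrightarrow> integrable M (f\<epsilon> F p)"
  using integrable_of_square f\<epsilon>_measurable f\<epsilon>_square_integrable by blast

lemma f\<epsilon>_mult_integrable: "centred F \<Longrightarrow> centred G \<Longrightarrow> integrable M (\<lambda>\<omega>. f\<epsilon> F p \<omega> * f\<epsilon> G q \<omega>)"
  by (intro integrable_mult_of_squares f\<epsilon>_measurable f\<epsilon>_square_integrable)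

lemma f\<epsilon>_expectation: "centred F \<Longrightarrow> expectation (f\<epsilon> F p) = 0"
  unfolding f\<epsilon>_def using expectation_\<epsilon>[of F] by (simp add: centred_def)

lemma f\<epsilon>_second_moment: "centred F \<Longrightarrow> mean_sq (f\<epsilon> F p) = second_moment F"
  unfolding f\<epsilon>_def second_moment_def centred_def
  using expectation_\<epsilon>[of "\<lambda>x. (F x)\<^sup>2", OF borel_measurable_power[of F borel 2]] by blast

text \<open>Only second moments are available, but for distinct \<open>q\<close> and
  \<open>r\<close> at most two of the three factors share an innovation. The product therefore
  splits into an integrable product of two factors and an independent third one.\<close>

lemma f\<epsilon>_triple_integrable:
  assumes c: "centred F" "centred G" "centred H" and q: "q \<noteq> r"
  shows "integrable M (\<lambda>\<omega>. f\<epsilon> F p \<omega> * (f\<epsilon> G q \<omega> * f\<epsilon> H r \<omega>))"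
proof (cases "p = q")
  case False
  have "indep_var borel (\<lambda>\<omega>. f\<epsilon> F p \<omega> * f\<epsilon> H r \<omega>) borel (f\<epsilon> G q)"
    by (rule indep_var_Gen[of "{Inl p, Inl r}" "{Inl q}"])
       (use False q c in \<open>auto intro!: borel_measurable_times f\<epsilon>_Gen\<close>)
  from indep_var_integrable[OF this] show ?thesis
    by (simp add: c f\<epsilon>_integrable f\<epsilon>_mult_integrable mult_ac)
next
  case True
  have "indep_var borel (\<lambda>\<omega>. f\<epsilon> F p \<omega> * f\<epsilon> G q \<omega>) borel (f\<epsilon> H r)"
    by (rule indep_var_Gen[of "{Inl p, Inl q}" "{Inl r}"])
       (use True q c in \<open>auto intro!: borel_measurable_times f\<epsilon>_Gen\<close>)
  from indep_var_integrable[OF this] show ?thesis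
    by (simp add: c f\<epsilon>_integrable f\<epsilon>_mult_integrable mult_ac)
qed

text \<open>The innovation at \<open>p\<close> occurs only once, so it is independent of the other
  three factors and contributes its mean 0. Distinctness of \<open>q\<close> and \<open>r\<close>
  serves the integrability of the triple.\<close>

lemma f\<epsilon>_product_zero:
  assumes c: "centred F" "centred G" "centred H" "centred K"
    and p: "p \<notin> {p', q, r}" and q: "q \<noteq> r"
  shows "expectation (\<lambda>\<omega>. f\<epsilon> F p \<omega> * (f\<epsilon> G p' \<omega> * (f\<epsilon> H q \<omega> * f\<epsilon> K r \<omega>))) = 0"
proof -
  have "indep_var borel (f\<epsilon> F p) borel (\<lambda>\<omega>. f\<epsilon> G p' \<omega> * (f\<epsilon> H q \<omega> * f\<epsilon> K r \<omega>))"
    by (rule indep_var_Gen[of "{Inl p}" "{Inl p', Inl q, Inl r}"])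
       (use p c in \<open>auto intro!: borel_measurable_times f\<epsilon>_Gen\<close>)
  from indep_var_lebesgue_integral[OF this] show ?thesis
    by (simp add: c f\<epsilon>_integrable f\<epsilon>_triple_integrable[OF c(2-4) q] f\<epsilon>_expectation)
qed

definition \<zeta> :: "(real \<Rightarrow> real) \<Rightarrow> (real \<Rightarrow> real) \<Rightarrow> int \<times> int \<Rightarrow> int \<times> int \<Rightarrow> 'a \<Rightarrow> real" where
  "\<zeta> F G p q \<omega> = f\<epsilon> F p \<omega> * f\<epsilon> G q \<omega>"

lemma \<zeta>_measurable: "centred F \<Longrightarrow> centred G \<Longrightarrow> \<zeta> F G p q \<in> borel_measurable M"
  unfolding \<zeta>_def by (intro borel_measurable_times f\<epsilon>_measurable)

lemma \<zeta>_Gen: "centred F \<Longrightarrow> centred G \<Longrightarrow> Inl p \<in> A \<Longrightarrow> Inl q \<in> A \<Longrightarrow> \<zeta> F G p q \<in> borel_measurable (Gen A)"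
  unfolding \<zeta>_def by (intro borel_measurable_times f\<epsilon>_Gen)

lemma \<zeta>_square:
  assumes c: "centred F" "centred G" and pq: "p \<noteq> q"
  shows "sq_integrable (\<zeta> F G p q)"
    and "mean_sq (\<zeta> F G p q) = second_moment F * second_moment G"
proof -
  have ind: "indep_var borel (\<lambda>\<omega>. (f\<epsilon> F p \<omega>)\<^sup>2) borel (\<lambda>\<omega>. (f\<epsilon> G q \<omega>)\<^sup>2)"
    by (rule indep_var_Gen[of "{Inl p}" "{Inl q}"])
       (use c pq in \<open>auto intro!: borel_measurable_power f\<epsilon>_Gen\<close>)
  show "sq_integrable (\<zeta> F G p q)"
    using indep_var_integrable[OF ind] c by (simp add: \<zeta>_def power_mult_distrib f\<epsilon>_square_integrable)
  show "mean_sq (\<zeta> F G p q) = second_moment F * second_moment G"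
    using indep_var_lebesgue_integral[OF ind] c by (simp add: \<zeta>_def power_mult_distrib f\<epsilon>_square_integrable f\<epsilon>_second_moment)
qed

text \<open>Two different unordered pairs leave \<open>p\<close> or \<open>q\<close> outside
  \<open>{p', q'}\<close>, and that innovation then occurs once in the product.\<close>

lemma \<zeta>_orthogonal:
  assumes c: "centred F" "centred G" and pq: "p \<noteq> q" "p' \<noteq> q'" and ne: "{p, q} \<noteq> {p', q'}"
  shows "expectation (\<lambda>\<omega>. \<zeta> F G p q \<omega> * \<zeta> F G p' q' \<omega>) = 0"
proof (cases "p \<in> {p', q'}")
  case False
  then show ?thesis
    using f\<epsilon>_product_zero[OF c c, of p q p' q'] pq unfolding \<zeta>_def by (simp add: mult.assoc)
next
  case True
  then have "q \<notin> {p', q'}" using ne pq by auto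
  then show ?thesis
    using f\<epsilon>_product_zero[OF c(2,1) c, of q p p' q'] pq unfolding \<zeta>_def by (simp add: mult.assoc mult.left_commute)
qed

lemma \<zeta>_mult_integrable:
  assumes c: "centred F" "centred G" and pq: "p \<noteq> q" "p' \<noteq> q'"
  shows "integrable M (\<lambda>\<omega>. \<zeta> F G p q \<omega> * \<zeta> F G p' q' \<omega>)"
  by (intro integrable_mult_of_squares \<zeta>_measurable \<zeta>_square c pq)

text \<open>The contribution of \<open>a i ^ k * \<epsilon> i (u - k)\<close> and \<open>a (i + s) ^ l * \<epsilon> (i + s) (u + t - l)\<close>
  to \<open>X i u * X (i + s) (u + t)\<close>, with the innovations transformed by \<open>F\<close> and \<open>G\<close>.\<close>

definition lag_term :: "(real \<Rightarrow> real) \<Rightarrow> (real \<Rightarrow> real) \<Rightarrow> int \<Rightarrow> nat \<times> nat \<Rightarrow> int \<Rightarrow> 'a \<Rightarrow> real" where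
  "lag_term F G i kl u \<omega> =
    a i \<omega> ^ fst kl * a (i + s) \<omega> ^ snd kl * \<zeta> F G (i, u - int (fst kl)) (i + s, u + t - int (snd kl)) \<omega>"

lemma lag_term_measurable: "centred F \<Longrightarrow> centred G \<Longrightarrow> lag_term F G i kl u \<in> borel_measurable M"
  unfolding lag_term_def by (intro borel_measurable_times borel_measurable_power \<zeta>_measurable a_measurable)

text \<open>The coefficients are independent of all innovations, so the expectation factors. The
  innovation factor survives only for equal pairs, and then the coefficient factor is a product of
  moments of two independent coefficients. Equality in the second row cancels
  \<open>t\<close>.\<close>

lemma lag_term_mult:
  assumes c: "centred F" "centred G"
  shows "integrable M (\<lambda>\<omega>. lag_term F G i (k, l) u \<omega> * lag_term F G j (k', l') u' \<omega>)"
    and "expectation (\<lambda>\<omega>. lag_term F G i (k, l) u \<omega> * lag_term F G j (k', l') u' \<omega>)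
      = (if i = j \<and> u - int k = u' - int k' \<and> u - int l = u' - int l'
         then \<mu> (k + k') * \<mu> (l + l') * (second_moment F * second_moment G) else 0)"
proof -
  let ?p = "(i, u - int k)" and ?q = "(i + s, u + t - int l)" and ?p' = "(j, u' - int k')" and ?q' = "(j + s, u' + t - int l')"
  let ?\<alpha> = "\<lambda>\<omega>. a i \<omega> ^ k * a (i + s) \<omega> ^ l * (a j \<omega> ^ k' * a (j + s) \<omega> ^ l')"
  let ?z = "\<lambda>\<omega>. \<zeta> F G ?p ?q \<omega> * \<zeta> F G ?p' ?q' \<omega>"
  have pq: "?p \<noteq> ?q" "?p' \<noteq> ?q'" using s_nonzero by auto
  have ind: "indep_var borel ?\<alpha> borel ?z"
  proof (rule indep_var_Gen[of "range Inr" "range Inl"])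
    show "?\<alpha> \<in> borel_measurable (Gen (range Inr))"
      by (intro borel_measurable_times borel_measurable_power a_Gen) auto
    show "?z \<in> borel_measurable (Gen (range Inl))"
      using c by (intro borel_measurable_times \<zeta>_Gen) auto
  qed auto
  have \<alpha>: "integrable M ?\<alpha>"
  proof (rule integrable_const_bound[of _ 1])
    show "AE \<omega> in M. norm (?\<alpha> \<omega>) \<le> 1"
      using AE_a_range
    proof eventually_elim
      case (elim \<omega>)
      have "0 \<le> a i \<omega> ^ n \<and> a i \<omega> ^ n \<le> 1" for i n
        using elim[rule_format, of i] by (auto intro: power_le_one)
      then show ?case
        by (simp add: abs_mult mult_le_one)
    qed
  qed measurable
  have z: "integrable M ?z" by (rule \<zeta>_mult_integrable[OF c pq])
  have eq: "lag_term F G i (k, l) u \<omega> * lag_term F G j (k', l') u' \<omega> = ?\<alpha> \<omega> * ?z \<omega>" for \<omega>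
    by (simp add: lag_term_def mult_ac)
  show "integrable M (\<lambda>\<omega>. lag_term F G i (k, l) u \<omega> * lag_term F G j (k', l') u' \<omega>)"
    unfolding eq by (rule indep_var_integrable[OF ind \<alpha> z])
  have E: "expectation (\<lambda>\<omega>. lag_term F G i (k, l) u \<omega> * lag_term F G j (k', l') u' \<omega>) = expectation ?\<alpha> * expectation ?z"
    unfolding eq by (rule indep_var_lebesgue_integral[OF ind \<alpha> z])
  show "expectation (\<lambda>\<omega>. lag_term F G i (k, l) u \<omega> * lag_term F G j (k', l') u' \<omega>)
      = (if i = j \<and> u - int k = u' - int k' \<and> u - int l = u' - int l'
         then \<mu> (k + k') * \<mu> (l + l') * (second_moment F * second_moment G) else 0)"
  proof (cases "i = j \<and> u - int k = u' - int k' \<and> u - int l = u' - int l'")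
    case True
    then have eqs: "?p' = ?p" "?q' = ?q" by auto
    have "expectation ?z = second_moment F * second_moment G"
      unfolding eqs using \<zeta>_square(2)[OF c pq(1)] by (simp add: power2_eq_square)
    moreover have "expectation ?\<alpha> = \<mu> (k + k') * \<mu> (l + l')"
    proof -
      have ind2: "indep_var borel (\<lambda>\<omega>. a i \<omega> ^ (k + k')) borel (\<lambda>\<omega>. a (i + s) \<omega> ^ (l + l'))"
        using s_nonzero by (intro indep_var_a) auto
      have "?\<alpha> = (\<lambda>\<omega>. a i \<omega> ^ (k + k') * a (i + s) \<omega> ^ (l + l'))"
        using True by (simp add: power_add mult_ac)
      then show ?thesis
        using indep_var_lebesgue_integral[OF ind2 integrable_a_power integrable_a_power]
        by (simp only: expectation_a_power)
    qed
    ultimately show ?thesis using E True by simp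
  next
    case False
    \<comment> \<open>A crosswise match would give i = j + s and i + s = j, hence 2 s = 0. So only
      the direct match needs to be excluded.\<close>
    have "{?p, ?q} \<noteq> {?p', ?q'}"
      using False s_nonzero by (auto simp: doubleton_eq_iff)
    from \<zeta>_orthogonal[OF c pq this] E False show ?thesis by auto
  qed
qed

section \<open>Lag sums and the quadratic form of their second moments\<close>

definition lag_sum :: "(real \<Rightarrow> real) \<Rightarrow> (real \<Rightarrow> real) \<Rightarrow> int set \<Rightarrow> (nat \<times> nat) set \<Rightarrow> int set \<Rightarrow> (int \<Rightarrow> real) \<Rightarrow> 'a \<Rightarrow> real" where
  "lag_sum F G I P U c \<omega> = (\<Sum>i\<in>I. \<Sum>kl\<in>P. \<Sum>u\<in>U. c u * lag_term F G i kl u \<omega>)"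

lemma lag_sum_measurable: "centred F \<Longrightarrow> centred G \<Longrightarrow> lag_sum F G I P U c \<in> borel_measurable M"
  unfolding lag_sum_def by (intro borel_measurable_sum borel_measurable_times lag_term_measurable borel_measurable_const)

text \<open>The indicator expresses k - k' = l - l' without subtraction of naturals. The argument of
  \<open>h\<close> is the time shift u' - u forced by two correlated lag terms, so \<open>h\<close>
  will be an autocorrelation of the time weights.\<close>

definition lag_form :: "(nat \<times> nat) set \<Rightarrow> (int \<Rightarrow> real) \<Rightarrow> real" where
  "lag_form P h = (\<Sum>(k, l)\<in>P. \<Sum>(k', l')\<in>P. of_bool (k + l' = k' + l) * (\<mu> (k + k') * \<mu> (l + l')) * h (int k' - int k))"

abbreviation "lag_mass P \<equiv> lag_form P (\<lambda>_. 1)"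

lemma lag_sum_second_moment:
  fixes c :: "int \<Rightarrow> real"
  assumes FG: "centred F" "centred G" and fin: "finite U" and supp: "\<And>u. u \<notin> U \<Longrightarrow> c u = 0"
  shows "sq_integrable (lag_sum F G I P U c)"
    and "mean_sq (lag_sum F G I P U c)
      = card I * (second_moment F * second_moment G) * lag_form P (autocorr U c)"
proof -
  let ?s = "second_moment F * second_moment G"
  let ?T = "lag_term F G"
  have sq: "(lag_sum F G I P U c \<omega>)\<^sup>2 =
    (\<Sum>i\<in>I. \<Sum>j\<in>I. \<Sum>kl\<in>P. \<Sum>kl'\<in>P. \<Sum>u\<in>U. \<Sum>u'\<in>U. c u * c u' * (?T i kl u \<omega> * ?T j kl' u' \<omega>))" for \<omega>
    unfolding lag_sum_def power2_eq_square by (simp add: sum_product mult_ac)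
  have int: "integrable M (\<lambda>\<omega>. c u * c u' * (?T i kl u \<omega> * ?T j kl' u' \<omega>))" for i j kl kl' u u'
    using lag_term_mult(1)[OF FG, of i "fst kl" "snd kl" u j "fst kl'" "snd kl'" u'] by simp
  show "sq_integrable (lag_sum F G I P U c)"
    unfolding sq by (intro Bochner_Integration.integrable_sum int)
  have inner: "(\<Sum>u\<in>U. \<Sum>u'\<in>U. c u * c u' * expectation (\<lambda>\<omega>. ?T i kl u \<omega> * ?T j kl' u' \<omega>))
     = (if i = j then of_bool (fst kl + snd kl' = fst kl' + snd kl) * (\<mu> (fst kl + fst kl') * \<mu> (snd kl + snd kl'))
          * autocorr U c (int (fst kl') - int (fst kl)) * ?s else 0)" for i j kl kl'
  proof -
    obtain k l k' l' where kl: "kl = (k, l)" "kl' = (k', l')" by (cases kl, cases kl')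
    let ?m = "\<mu> (k + k') * \<mu> (l + l') * ?s"
    have "(\<Sum>u'\<in>U. c u * c u' * expectation (\<lambda>\<omega>. ?T i kl u \<omega> * ?T j kl' u' \<omega>))
       = (if i = j \<and> k + l' = k' + l then c u * c (u + (int k' - int k)) * ?m else 0)" for u
    proof -
      \<comment> \<open>The time \<open>u'\<close> is determined by \<open>u\<close>. If it falls
        outside \<open>U\<close>, then \<open>c\<close> vanishes there, so the sum over
        \<open>u'\<close> may still be evaluated at that point.\<close>
      have "c u * c u' * expectation (\<lambda>\<omega>. ?T i kl u \<omega> * ?T j kl' u' \<omega>)
        = (if u' = u + (int k' - int k) then (if i = j \<and> k + l' = k' + l then c u * c u' * ?m else 0) else 0)" for u'
        unfolding kl lag_term_mult(2)[OF FG] by auto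
      then show ?thesis using fin supp by (simp add: sum.delta)
    qed
    then show ?thesis
      unfolding kl autocorr_def by (auto simp: sum_distrib_right sum_distrib_left mult_ac)
  qed
  have "mean_sq (lag_sum F G I P U c)
    = (\<Sum>i\<in>I. \<Sum>j\<in>I. \<Sum>kl\<in>P. \<Sum>kl'\<in>P. \<Sum>u\<in>U. \<Sum>u'\<in>U. c u * c u' * expectation (\<lambda>\<omega>. ?T i kl u \<omega> * ?T j kl' u' \<omega>))"
    unfolding sq by (simp only: Bochner_Integration.integral_sum Bochner_Integration.integrable_sum int integral_mult_right_zero)
  also have "\<dots> = (\<Sum>i\<in>I. \<Sum>j\<in>I. if i = j then lag_form P (autocorr U c) * ?s else 0)"
    unfolding inner by (intro sum.cong refl) (auto simp: lag_form_def sum_distrib_right split_beta)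
  \<comment> \<open>For infinite \<open>I\<close> both sides are 0, because both
    \<open>card I\<close> and sums over \<open>I\<close> are then 0.\<close>
  also have "\<dots> = card I * ?s * lag_form P (autocorr U c)"
    by (cases "finite I") simp_all
  finally show "mean_sq (lag_sum F G I P U c)
      = card I * ?s * lag_form P (autocorr U c)" .
qed

lemma lag_form_bound:
  assumes "\<And>d. \<bar>h d\<bar> \<le> D"
  shows "\<bar>lag_form P h\<bar> \<le> D * lag_mass P"
proof -
  have "\<bar>lag_form P h\<bar> \<le> (\<Sum>kl\<in>P. \<Sum>kl'\<in>P. \<bar>of_bool (fst kl + snd kl' = fst kl' + snd kl) * (\<mu> (fst kl + fst kl') * \<mu> (snd kl + snd kl'))
          * h (int (fst kl') - int (fst kl))\<bar>)"
    unfolding lag_form_def split_beta by (intro order_trans[OF sum_abs] sum_mono sum_abs)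
  also have "\<dots> \<le> (\<Sum>kl\<in>P. \<Sum>kl'\<in>P. D * (of_bool (fst kl + snd kl' = fst kl' + snd kl) * (\<mu> (fst kl + fst kl') * \<mu> (snd kl + snd kl'))))"
    by (intro sum_mono) (auto simp: abs_mult \<mu>_nonneg mult.commute intro!: mult_right_mono assms)
  also have "\<dots> = D * lag_mass P"
    unfolding lag_form_def split_beta by (simp add: sum_distrib_left)
  finally show ?thesis .
qed

text \<open>All entries of the form are nonnegative, so dropping the cross terms between
  \<open>P\<close> and the new lags can only decrease it. The mass of discarded lags is thus bounded
  by a difference of masses, which is small for a convergent sequence.\<close>

lemma lag_form_diff:
  assumes "P \<subseteq> P'" "finite P'"
  shows "lag_mass (P' - P) \<le> lag_form P' (\<lambda>_. 1) - lag_mass P"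
proof -
  define b where "b kl kl' = of_bool (fst kl + snd kl' = fst kl' + snd kl) * (\<mu> (fst kl + fst kl') * \<mu> (snd kl + snd kl'))"
    for kl kl' :: "nat \<times> nat"
  have b0: "0 \<le> b x y" for x y unfolding b_def by (simp add: \<mu>_nonneg)
  have form: "lag_mass Q = (\<Sum>x\<in>Q. \<Sum>y\<in>Q. b x y)" for Q
    by (simp add: lag_form_def b_def split_beta)
  have "(\<Sum>x\<in>P'-P. \<Sum>y\<in>P'-P. b x y) + (\<Sum>x\<in>P. \<Sum>y\<in>P. b x y) \<le> (\<Sum>x\<in>P'-P. \<Sum>y\<in>P'. b x y) + (\<Sum>x\<in>P. \<Sum>y\<in>P'. b x y)"
    using assms b0 by (intro add_mono sum_mono sum_mono2) auto
  also have "\<dots> = (\<Sum>x\<in>P'. \<Sum>y\<in>P'. b x y)"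
    using sum.subset_diff[OF assms, of "\<lambda>x. \<Sum>y\<in>P'. b x y"] by simp
  finally show ?thesis unfolding form by linarith
qed

lemma lag_form_nonneg: "0 \<le> lag_mass P"
  unfolding lag_form_def split_beta by (intro sum_nonneg) (auto simp: \<mu>_nonneg)

lemma lag_sum_second_moment_le:
  fixes c :: "int \<Rightarrow> real"
  assumes FG: "centred F" "centred G" and fin: "finite U" and supp: "\<And>u. u \<notin> U \<Longrightarrow> c u = 0"
  shows "mean_sq (lag_sum F G I P U c)
      \<le> card I * (second_moment F * second_moment G) * (energy U c * lag_mass P)"
proof -
  have "\<bar>autocorr U c d\<bar> \<le> energy U c" for d
    by (rule abs_autocorr_le[OF fin supp])
  then have "lag_form P (autocorr U c) \<le> energy U c * lag_mass P"
    using lag_form_bound by (meson abs_le_D1)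
  moreover have "mean_sq (lag_sum F G I P U c)
      = card I * (second_moment F * second_moment G) * lag_form P (autocorr U c)"
    by (rule lag_sum_second_moment(2)[OF FG fin supp])
  ultimately show ?thesis
    by (simp add: mult_left_mono second_moment_nonneg)
qed

end

section \<open>The variance constant as a limit of lag sums\<close>

text \<open>The \<open>lag_mass\<close> of a square of lags with the moments replaced by powers of
  two numbers. Inserting two independent coefficients and taking expectations gives the mass
  back.\<close>

definition coeff_form :: "nat \<Rightarrow> real \<Rightarrow> real \<Rightarrow> real" where
  "coeff_form m x y = (\<Sum>(k, l)\<in>{..<m} \<times> {..<m}. \<Sum>(k', l')\<in>{..<m} \<times> {..<m}.
     of_bool (k + l' = k' + l) * (x ^ (k + k') * y ^ (l + l')))"

definition balanced :: "nat \<Rightarrow> ((nat \<times> nat) \<times> (nat \<times> nat)) set" where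
  "balanced m = {((k, l), (k', l')) |k l k' l'. k < m \<and> l < m \<and> k' < m \<and> l' < m \<and> k + l' = k' + l}"

lemma finite_balanced: "finite (balanced m)"
  by (rule finite_subset[of _ "({..<m} \<times> {..<m}) \<times> ({..<m} \<times> {..<m})"]) (auto simp: balanced_def)

lemma coeff_form_balanced: "coeff_form m x y = (\<Sum>((k, l), (k', l'))\<in>balanced m. x ^ (k + k') * y ^ (l + l'))"
proof -
  have "coeff_form m x y = (\<Sum>(kl, kl')\<in>({..<m} \<times> {..<m}) \<times> ({..<m} \<times> {..<m}).
     of_bool (fst kl + snd kl' = fst kl' + snd kl) * (x ^ (fst kl + fst kl') * y ^ (snd kl + snd kl')))"
    by (subst sum.cartesian_product[symmetric]) (simp add: coeff_form_def split_beta)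
  also have "\<dots> = (\<Sum>((k, l), (k', l'))\<in>balanced m. x ^ (k + k') * y ^ (l + l'))"
    by (rule sum.mono_neutral_cong_right) (auto simp: balanced_def)
  finally show ?thesis .
qed

lemma coeff_form_mono:
  assumes "0 \<le> x" "0 \<le> y" "m \<le> n"
  shows "coeff_form m x y \<le> coeff_form n x y"
  unfolding coeff_form_balanced using assms
  by (intro sum_mono2 finite_balanced) (auto simp: balanced_def)

text \<open>Solutions of \<open>k - k' = l - l'\<close> are enumerated by the common difference \<open>\<plusminus>d\<close> and the smaller pair.\<close>

definition enum_balanced :: "bool \<times> nat \<times> nat \<times> nat \<Rightarrow> (nat \<times> nat) \<times> (nat \<times> nat)" where
  "enum_balanced = (\<lambda>(b, p, q, d). if b then ((p + d, q + d), (p, q)) else ((p, q), (p + d, q + d)))"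

text \<open>The second copy starts at d = 1, so that quadruples with zero difference are enumerated
  once.\<close>

definition enum_domain :: "nat \<Rightarrow> (bool \<times> nat \<times> nat \<times> nat) set" where
  "enum_domain m = ({True} \<times> {..<m} \<times> {..<m} \<times> {..<m}) \<union> ({False} \<times> {..<m} \<times> {..<m} \<times> {1..<m})"

lemma inj_enum_balanced: "inj_on enum_balanced (enum_domain m)"
  by (auto simp: inj_on_def enum_balanced_def enum_domain_def)

lemma enum_balanced_subset: "enum_balanced ` enum_domain m \<subseteq> balanced (2 * m)"
  by (auto simp: enum_balanced_def enum_domain_def balanced_def)

lemma balanced_subset: "balanced m \<subseteq> enum_balanced ` enum_domain m"
proof
  fix z assume "z \<in> balanced m"
  then obtain k l k' l' where z: "z = ((k, l), (k', l'))" "k < m" "l < m" "k' < m" "l' < m" "k + l' = k' + l"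
    by (auto simp: balanced_def)
  show "z \<in> enum_balanced ` enum_domain m"
  proof (cases "k' \<le> k")
    case True
    then have "z = enum_balanced (True, k', l', k - k')" "(True, k', l', k - k') \<in> enum_domain m"
      using z by (auto simp: enum_balanced_def enum_domain_def)
    then show ?thesis by blast
  next
    case False
    then have "z = enum_balanced (False, k, l, k' - k)" "(False, k, l, k' - k) \<in> enum_domain m"
      using z by (auto simp: enum_balanced_def enum_domain_def)
    then show ?thesis by blast
  qed
qed

text \<open>A quadruple with smaller pair (p, q) and difference d carries the weight x^(2p+d)
  y^(2q+d), which factors. Summing over a box of (p, q, d) for both signs of the difference gives a
  product of geometric sums.\<close>

definition box_form :: "nat \<Rightarrow> real \<Rightarrow> real \<Rightarrow> real" where
  "box_form m x y = (\<Sum>p<m. (x\<^sup>2) ^ p) * (\<Sum>q<m. (y\<^sup>2) ^ q) * ((\<Sum>d<m. (x * y) ^ d) + (\<Sum>d=1..<m. (x * y) ^ d))"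

lemma box_form_enum:
  "box_form m x y = (\<Sum>z\<in>enum_domain m. (\<lambda>((k, l), (k', l')). x ^ (k + k') * y ^ (l + l')) (enum_balanced z))"
proof -
  let ?w = "\<lambda>((k, l), (k', l')). x ^ (k + k') * y ^ (l + l')"
  have "(\<Sum>z\<in>enum_domain m. ?w (enum_balanced z))
    = (\<Sum>z\<in>{True} \<times> {..<m} \<times> {..<m} \<times> {..<m}. ?w (enum_balanced z))
      + (\<Sum>z\<in>{False} \<times> {..<m} \<times> {..<m} \<times> {1..<m}. ?w (enum_balanced z))"
    unfolding enum_domain_def by (rule sum.union_disjoint) auto
  also have "(\<Sum>z\<in>{True} \<times> {..<m} \<times> {..<m} \<times> {..<m}. ?w (enum_balanced z))
     = (\<Sum>p<m. \<Sum>q<m. \<Sum>d<m. (x\<^sup>2) ^ p * ((y\<^sup>2) ^ q * (x * y) ^ d))"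
    by (simp add: sum.cartesian_product' enum_balanced_def power_add power_mult_distrib
          power2_eq_square mult_ac)
  also have "\<dots> = (\<Sum>p<m. (x\<^sup>2) ^ p) * (\<Sum>q<m. (y\<^sup>2) ^ q) * (\<Sum>d<m. (x * y) ^ d)"
    by (simp only: sum_distrib_left[symmetric] sum_distrib_right[symmetric] mult.assoc)
  also have "(\<Sum>z\<in>{False} \<times> {..<m} \<times> {..<m} \<times> {1..<m}. ?w (enum_balanced z))
     = (\<Sum>p<m. \<Sum>q<m. \<Sum>d=1..<m. (x\<^sup>2) ^ p * ((y\<^sup>2) ^ q * (x * y) ^ d))"
    by (simp add: sum.cartesian_product' enum_balanced_def power_add power_mult_distrib
          power2_eq_square mult_ac)
  also have "\<dots> = (\<Sum>p<m. (x\<^sup>2) ^ p) * (\<Sum>q<m. (y\<^sup>2) ^ q) * (\<Sum>d=1..<m. (x * y) ^ d)"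
    by (simp only: sum_distrib_left[symmetric] sum_distrib_right[symmetric] mult.assoc)
  finally show ?thesis by (simp add: box_form_def distrib_left)
qed

text \<open>Bounding the four lags and bounding (p, q, d) are different cut-offs. Since p + d and q
  + d stay below 2 m, each is contained in the other up to a factor 2, which is harmless in the
  limit.\<close>

lemma coeff_form_le_box:
  assumes "0 \<le> x" "0 \<le> y"
  shows "coeff_form m x y \<le> box_form m x y" and "box_form m x y \<le> coeff_form (2 * m) x y"
proof -
  let ?w = "\<lambda>((k, l), (k', l')). x ^ (k + k') * y ^ (l + l')"
  have box: "box_form m x y = sum ?w (enum_balanced ` enum_domain m)"
    unfolding box_form_enum by (simp add: sum.reindex[OF inj_enum_balanced])
  show "coeff_form m x y \<le> box_form m x y"
    unfolding box coeff_form_balanced using assms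
    by (intro sum_mono2 balanced_subset finite_imageI) (auto simp: enum_domain_def)
  show "box_form m x y \<le> coeff_form (2 * m) x y"
    unfolding box coeff_form_balanced using assms
    by (intro sum_mono2 enum_balanced_subset finite_balanced) auto
qed

lemma box_form_tendsto:
  assumes "0 \<le> x" "x < 1" "0 \<le> y" "y < 1"
  shows "(\<lambda>m. box_form m x y) \<longlonglongrightarrow> A_coeff x y"
proof -
  have geo: "(\<lambda>m. \<Sum>p<m. z ^ p) \<longlonglongrightarrow> 1 / (1 - z)" if "0 \<le> z" "z < 1" for z :: real
    using geometric_sums[of z] that by (simp add: sums_def)
  have xy: "0 \<le> x * y" "x * y < 1" "x\<^sup>2 < 1" "y\<^sup>2 < 1"
    using assms mult_strict_mono[of x 1 y 1] by (auto simp: power_less_one_iff mult_le_one abs_square_less_1)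
  have tail: "(\<lambda>m. \<Sum>d=1..<m. (x * y) ^ d) \<longlonglongrightarrow> 1 / (1 - x * y) - 1"
  proof (rule Lim_transform_eventually[OF tendsto_diff[OF geo[OF xy(1,2)] tendsto_const]])
    show "\<forall>\<^sub>F m in sequentially. (\<Sum>p<m. (x * y) ^ p) - 1 = (\<Sum>d=1..<m. (x * y) ^ d)"
    proof (rule eventually_sequentiallyI[of 1])
      fix m :: nat assume "1 \<le> m"
      then have "{..<m} = insert 0 {1..<m}" by auto
      then show "(\<Sum>p<m. (x * y) ^ p) - 1 = (\<Sum>d=1..<m. (x * y) ^ d)" by simp
    qed
  qed
  have "(\<lambda>m. box_form m x y) \<longlonglongrightarrow>
     1 / (1 - x\<^sup>2) * (1 / (1 - y\<^sup>2)) * (1 / (1 - x * y) + (1 / (1 - x * y) - 1))"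
    unfolding box_form_def using xy by (intro tendsto_intros geo tail) auto
  also have "1 / (1 - x\<^sup>2) * (1 / (1 - y\<^sup>2)) * (1 / (1 - x * y) + (1 / (1 - x * y) - 1)) = A_coeff x y"
  proof -
    have "1 / (1 - x * y) + (1 / (1 - x * y) - 1) = (1 + x * y) / (1 - x * y)"
      using xy by (simp add: field_simps)
    then show ?thesis by (simp add: A_coeff_def)
  qed
  finally show ?thesis .
qed

lemma coeff_form_tendsto:
  assumes "0 \<le> x" "x < 1" "0 \<le> y" "y < 1"
  shows "(\<lambda>m. coeff_form m x y) \<longlonglongrightarrow> A_coeff x y"
proof (rule tendsto_sandwich[where f = "\<lambda>m. box_form (m div 2) x y" and h = "\<lambda>m. box_form m x y"])
  show "(\<lambda>m. box_form m x y) \<longlonglongrightarrow> A_coeff x y" by (rule box_form_tendsto[OF assms])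
  have "filterlim (\<lambda>m. m div 2) sequentially sequentially"
    by (rule filterlim_at_top_div_const_nat) simp
  from filterlim_compose[OF box_form_tendsto[OF assms] this]
  show "(\<lambda>m. box_form (m div 2) x y) \<longlonglongrightarrow> A_coeff x y" .
  show "\<forall>\<^sub>F m in sequentially. coeff_form m x y \<le> box_form m x y"
    using coeff_form_le_box assms by (intro always_eventually) auto
  show "\<forall>\<^sub>F m in sequentially. box_form (m div 2) x y \<le> coeff_form m x y"
    using coeff_form_le_box(2)[of x y] coeff_form_mono[of x y] assms
    by (intro always_eventually allI) (metis order_trans times_div_less_eq_dividend)
qed

lemma coeff_form_le:
  assumes "0 \<le> x" "x < 1" "0 \<le> y" "y < 1"
  shows "coeff_form m x y \<le> A_coeff x y"
  using coeff_form_mono[of x y m] assms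
  by (intro LIMSEQ_le_const[OF coeff_form_tendsto[OF assms]] exI[of _ m]) auto

lemma coeff_form_nonneg: "0 \<le> x \<Longrightarrow> 0 \<le> y \<Longrightarrow> 0 \<le> coeff_form m x y"
  unfolding coeff_form_def by (intro sum_nonneg) (auto intro!: sum_nonneg)

lemma A_coeff_nonneg:
  assumes "0 \<le> x" "x < 1" "0 \<le> y" "y < 1"
  shows "0 \<le> A_coeff x y"
  using coeff_form_le[OF assms, of 0] by (simp add: coeff_form_def)

text \<open>1 - xy exceeds both 1 - x and 1 - y, hence also their geometric mean. Splitting this
  factor evenly makes the bound a product with exponent -3/2 in each variable, whose expectation
  factors for independent coefficients. The constant 2 bounds 1 + xy.\<close>

lemma A_coeff_le:
  assumes x: "0 \<le> x" "x < 1" and y: "0 \<le> y" "y < 1"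
  shows "A_coeff x y \<le> 2 * ((1 - x) powr (-3/2) * (1 - y) powr (-3/2))"
proof -
  define X Y where "X = 1 - x" and "Y = 1 - y"
  have XY: "0 < X" "X \<le> 1" "0 < Y" "Y \<le> 1" using assms by (auto simp: X_def Y_def)
  have 1: "X \<le> 1 - x\<^sup>2" "Y \<le> 1 - y\<^sup>2"
    using assms by (auto simp: X_def Y_def power2_eq_square mult_left_le)
  have "x * y \<le> x" "x * y \<le> y" using assms by (auto simp: mult_left_le mult_left_le_one_le)
  then have 2: "X \<le> 1 - x * y" "Y \<le> 1 - x * y" by (auto simp: X_def Y_def)
  have 3: "X powr (1/2) * Y powr (1/2) \<le> 1 - x * y"
  proof -
    have "X powr (1/2) * Y powr (1/2) \<le> (1 - x * y) powr (1/2) * (1 - x * y) powr (1/2)"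
      using 2 XY by (intro mult_mono powr_mono2) auto
    also have "\<dots> = 1 - x * y" using 2 XY by (simp add: powr_add[symmetric])
    finally show ?thesis .
  qed
  have "A_coeff x y \<le> 2 / (X * Y * (X powr (1/2) * Y powr (1/2)))"
    unfolding A_coeff_def using 1 2 3 XY x y
    by (intro frac_le mult_mono mult_pos_pos) (auto simp: mult_le_one)
  also have "\<dots> = 2 * (X powr (-3/2) * Y powr (-3/2))"
  proof -
    have "X powr (-3/2) = 1 / (X * X powr (1/2))" "Y powr (-3/2) = 1 / (Y * Y powr (1/2))"
      using XY powr_minus_divide[of X "3/2"] powr_minus_divide[of Y "3/2"]
        powr_add[of X 1 "1/2"] powr_add[of Y 1 "1/2"] by auto
    then show ?thesis by (simp add: mult_ac)
  qed
  finally show ?thesis by (simp add: X_def Y_def)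
qed

text \<open>Against the density, the weight becomes a bounded function times (1 - x)^(\<beta> -
  5/2), and \<beta> > 3/2 says precisely that this exponent exceeds -1.\<close>

lemma mixing_density_integrable:
  assumes "prob_space M" "mixing_density M X \<beta>" "\<beta> > 3 / 2"
  shows "integrable M (\<lambda>\<omega>. (1 - X \<omega>) powr (-3/2))"
proof -
  obtain \<psi> l where \<psi>: "\<forall>x\<in>{0..<1}. 0 \<le> \<psi> x" "bounded (\<psi> ` {0..<1})"
    and d: "distributed M lborel X (\<lambda>x. ennreal (indicator {0..<1} x * (\<psi> x * (1 - x) powr (\<beta> - 1))))"
    using assms(2) unfolding mixing_density_def by blast
  define f where "f x = indicator {0..<1} x * (\<psi> x * (1 - x) powr (\<beta> - 1))" for x
  have f0: "0 \<le> f x" for x using \<psi>(1) by (auto simp: f_def indicator_def)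
  obtain C where "\<forall>x\<in>{0..<1}. \<bar>\<psi> x\<bar> \<le> C" using \<psi>(2) by (auto simp: bounded_iff)
  then have C: "\<bar>\<psi> x\<bar> \<le> C" if "x \<in> {0..<1}" for x using that by blast
  \<comment> \<open>\<open>mixing_density\<close> makes no measurability statement about
    \<open>\<psi>\<close> itself; the measurability of \<open>f\<close> is recovered from its
    extended nonnegative version.\<close>
  have "(\<lambda>x. ennreal (f x)) \<in> borel_measurable lborel"
    using distributed_borel_measurable[OF d] unfolding f_def .
  then have "(\<lambda>x. enn2real (ennreal (f x))) \<in> borel_measurable lborel" by measurable
  then have fm[measurable]: "f \<in> borel_measurable borel" using f0 by simp
  define h where "h x = indicator {0..1} x * x powr (\<beta> - 5/2)" for x :: real
  have h_eq: "h = (\<lambda>x. if x \<in> {0..1} then x powr (\<beta> - 5/2) else 0)"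
    by (auto simp: h_def)
  have h0: "0 \<le> h x" for x by (simp add: h_def)
  have hm: "h \<in> borel_measurable borel" unfolding h_def by measurable
  have hi: "integrable lborel h"
  proof -
    have "((\<lambda>x. x powr (\<beta> - 5/2)) has_integral (1 powr (\<beta> - 5/2 + 1) / (\<beta> - 5/2 + 1))) {0..1}"
      using assms(3) by (intro has_integral_powr_from_0) auto
    then have "(h has_integral (1 powr (\<beta> - 5/2 + 1) / (\<beta> - 5/2 + 1))) UNIV"
      by (subst (asm) has_integral_restrict_UNIV[symmetric], subst (asm) h_eq[symmetric])
    then have "integral\<^sup>N lborel h = ennreal (1 powr (\<beta> - 5/2 + 1) / (\<beta> - 5/2 + 1))"
      by (rule nn_integral_has_integral_lborel[OF hm h0])
    then show ?thesis using hm h0 by (intro integrableI_nonneg) auto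
  qed
  \<comment> \<open>The substitution of 1 - x for x moves the singularity from 0 to 1.\<close>
  have "integrable lborel (\<lambda>x. C * h (1 + (-1) * x))"
    using lborel_integrable_real_affine[OF hi, of "-1" 1] by simp
  then have "integrable lborel (\<lambda>x. f x * (1 - x) powr (-3/2))"
  proof (rule Bochner_Integration.integrable_bound)
    show "AE x in lborel. norm (f x * (1 - x) powr (-3/2)) \<le> norm (C * h (1 + (-1) * x))"
    proof (rule AE_I2)
      fix x :: real
      show "norm (f x * (1 - x) powr (-3/2)) \<le> norm (C * h (1 + (-1) * x))"
      proof (cases "x \<in> {0..<1}")
        case True
        have "f x * (1 - x) powr (-3/2) = \<psi> x * (1 - x) powr (\<beta> - 5/2)"
          using True by (simp add: f_def mult.assoc powr_add[symmetric])
        moreover have "h (1 + (-1) * x) = (1 - x) powr (\<beta> - 5/2)" using True by (simp add: h_def)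
        moreover have "\<bar>\<psi> x\<bar> \<le> \<bar>C\<bar>" using C[OF True] by simp
        ultimately show ?thesis by (simp add: abs_mult mult_right_mono)
      qed (simp add: f_def)
    qed
  qed measurable
  then show ?thesis
    using distributed_integrable[of M lborel X f "\<lambda>x. (1 - x) powr (-3/2)"] d f0 unfolding f_def by simp
qed

section \<open>Approximation by finitely many lags and bounded innovations\<close>

locale panel_mixing = panel_pair +
  fixes \<beta> :: real
  assumes mixing: "mixing_density M (a 0) \<beta>" and \<beta>_gt: "\<beta> > 3 / 2"
begin

definition EA :: real where "EA = expectation (\<lambda>\<omega>. A_coeff (a 1 \<omega>) (a 2 \<omega>))"

lemma A_coeff_measurable: "(\<lambda>\<omega>. A_coeff (a i \<omega>) (a j \<omega>)) \<in> borel_measurable M"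
  unfolding A_coeff_def by measurable

lemma integrable_root_weight: "integrable M (\<lambda>\<omega>. (1 - a i \<omega>) powr (-3/2))"
  by (rule integrable_a[of "\<lambda>x. (1 - x) powr (-3/2)"])
     (use mixing_density_integrable[OF prob_space_axioms mixing \<beta>_gt] in auto)

lemma integrable_A_coeff: "integrable M (\<lambda>\<omega>. A_coeff (a 1 \<omega>) (a 2 \<omega>))"
proof (rule Bochner_Integration.integrable_bound)
  have "indep_var borel (\<lambda>\<omega>. (1 - a 1 \<omega>) powr (-3/2)) borel (\<lambda>\<omega>. (1 - a 2 \<omega>) powr (-3/2))"
    by (rule indep_var_a) auto
  from indep_var_integrable[OF this integrable_root_weight integrable_root_weight]
  show "integrable M (\<lambda>\<omega>. 2 * ((1 - a 1 \<omega>) powr (-3/2) * (1 - a 2 \<omega>) powr (-3/2)))" by simp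
  show "AE \<omega> in M. norm (A_coeff (a 1 \<omega>) (a 2 \<omega>)) \<le> norm (2 * ((1 - a 1 \<omega>) powr (-3/2) * (1 - a 2 \<omega>) powr (-3/2)))"
    using AE_a_range
  proof eventually_elim
    case (elim \<omega>)
    then have "0 \<le> a 1 \<omega>" "a 1 \<omega> < 1" "0 \<le> a 2 \<omega>" "a 2 \<omega> < 1" by auto
    from A_coeff_le[OF this] A_coeff_nonneg[OF this] show ?case by simp
  qed
qed (rule A_coeff_measurable)

lemma EA_nonneg: "0 \<le> EA"
  unfolding EA_def using AE_a_range
  by (intro integral_nonneg_AE) (auto elim!: eventually_mono intro!: A_coeff_nonneg)

text \<open>A square, because multiplying two rows that are cut at the same lag produces exactly
  these index pairs.\<close>

definition lags :: "nat \<Rightarrow> (nat \<times> nat) set" where "lags m = {..<m} \<times> {..<m}"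

lemma finite_lags: "finite (lags m)" by (simp add: lags_def)

lemma lag_form_coeff_form:
  "lag_mass (lags m) = expectation (\<lambda>\<omega>. coeff_form m (a 1 \<omega>) (a 2 \<omega>))"
proof -
  have ind: "indep_var borel (\<lambda>\<omega>. a 1 \<omega> ^ k) borel (\<lambda>\<omega>. a 2 \<omega> ^ l)" for k l
    by (rule indep_var_a) auto
  have int: "integrable M (\<lambda>\<omega>. a 1 \<omega> ^ k * a 2 \<omega> ^ l)" for k l
    by (rule indep_var_integrable[OF ind integrable_a_power integrable_a_power])
  have E: "expectation (\<lambda>\<omega>. a 1 \<omega> ^ k * a 2 \<omega> ^ l) = \<mu> k * \<mu> l" for k l
    using indep_var_lebesgue_integral[OF ind integrable_a_power integrable_a_power] by (simp add: expectation_a_power)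
  show ?thesis
    unfolding coeff_form_def lag_form_def lags_def split_beta
    by (simp only: Bochner_Integration.integral_sum Bochner_Integration.integrable_sum int integrable_mult_right
        integral_mult_right_zero E mult_1_right)
qed

text \<open>The forms in the coefficients are nonnegative and lie below \<open>A_coeff\<close>,
  which is integrable and also their pointwise limit. So it serves as the dominating function for
  both claims.\<close>

lemma lag_form_le_EA: "lag_mass (lags m) \<le> EA"
  and lag_form_tendsto_EA: "(\<lambda>m. lag_mass (lags m)) \<longlonglongrightarrow> EA"
proof -
  have meas: "(\<lambda>\<omega>. coeff_form m (a 1 \<omega>) (a 2 \<omega>)) \<in> borel_measurable M" for m
    unfolding coeff_form_def split_beta by measurable
  have bound: "AE \<omega> in M. \<forall>m. norm (coeff_form m (a 1 \<omega>) (a 2 \<omega>)) \<le> A_coeff (a 1 \<omega>) (a 2 \<omega>)"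
    using AE_a_range
  proof eventually_elim
    case (elim \<omega>)
    then have "0 \<le> a 1 \<omega>" "a 1 \<omega> < 1" "0 \<le> a 2 \<omega>" "a 2 \<omega> < 1" by auto
    then show ?case using coeff_form_le coeff_form_nonneg by simp
  qed
  show tends: "(\<lambda>m. lag_mass (lags m)) \<longlonglongrightarrow> EA"
    unfolding lag_form_coeff_form EA_def
  proof (rule integral_dominated_convergence[OF A_coeff_measurable meas integrable_A_coeff])
    show "AE \<omega> in M. (\<lambda>m. coeff_form m (a 1 \<omega>) (a 2 \<omega>)) \<longlonglongrightarrow> A_coeff (a 1 \<omega>) (a 2 \<omega>)"
      using AE_a_range
      by eventually_elim (auto intro!: coeff_form_tendsto)
    show "AE \<omega> in M. norm (coeff_form m (a 1 \<omega>) (a 2 \<omega>)) \<le> A_coeff (a 1 \<omega>) (a 2 \<omega>)" for m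
      using bound by eventually_elim auto
  qed
  show "lag_mass (lags m) \<le> EA"
    unfolding lag_form_coeff_form EA_def
  proof (rule integral_mono_AE)
    show le: "AE \<omega> in M. coeff_form m (a 1 \<omega>) (a 2 \<omega>) \<le> A_coeff (a 1 \<omega>) (a 2 \<omega>)"
      using bound by eventually_elim (auto simp: abs_le_iff)
    show "integrable M (\<lambda>\<omega>. coeff_form m (a 1 \<omega>) (a 2 \<omega>))"
      by (rule Bochner_Integration.integrable_bound[OF integrable_A_coeff meas])
         (use bound in eventually_elim, auto intro: order_trans)
  qed (rule integrable_A_coeff)
qed

section \<open>Almost sure convergence of the rows and of the cut-off sums\<close>

lemma centred_id: "centred (\<lambda>x. x)" and second_moment_id: "second_moment (\<lambda>x. x) = 1"
  using innovation_integrable innovation_mean innovation_variance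
  by (simp_all add: centred_def second_moment_def)

text \<open>The partial sums are bounded by the expectation of 1 / (1 - a), which lies below the
  weight with exponent -3/2 that is already known to be integrable.\<close>

lemma summable_\<mu>: "summable \<mu>"
proof (rule bounded_imp_summable[OF \<mu>_nonneg])
  fix n
  have "(\<Sum>k\<le>n. \<mu> k) = expectation (\<lambda>\<omega>. \<Sum>k\<le>n. a 0 \<omega> ^ k)"
    by (simp add: \<mu>_def integrable_a_power)
  also have "\<dots> \<le> expectation (\<lambda>\<omega>. (1 - a 0 \<omega>) powr (-3/2))"
  proof (rule integral_mono_AE[OF _ integrable_root_weight])
    show "AE \<omega> in M. (\<Sum>k\<le>n. a 0 \<omega> ^ k) \<le> (1 - a 0 \<omega>) powr (-3/2)"
      using AE_a_range
    proof eventually_elim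
      case (elim \<omega>)
      define x where "x = a 0 \<omega>"
      have x: "0 \<le> x" "x < 1" using elim by (auto simp: x_def)
      have "(\<Sum>k\<le>n. x ^ k) \<le> (\<Sum>k. x ^ k)"
        using x by (intro sum_le_suminf summable_geometric) auto
      also have "\<dots> = (1 - x) powr (-1)"
        using x by (simp add: suminf_geometric powr_minus_divide)
      also have "\<dots> \<le> (1 - x) powr (-3/2)"
        using x by (intro powr_mono') auto
      finally show ?case by (simp add: x_def)
    qed
  qed (simp add: integrable_a_power)
  finally show "(\<Sum>k\<le>n. \<mu> k) \<le> expectation (\<lambda>\<omega>. (1 - a 0 \<omega>) powr (-3/2))" .
qed

text \<open>By independence the expected sum of absolute values is the first absolute moment of an
  innovation times the sum of the \<open>\<mu> k\<close>. It is finite, so the series converges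
  absolutely almost surely and the \<open>suminf\<close> in \<open>panel_X\<close> is a genuine
  sum.\<close>

lemma AE_summable_row: "AE \<omega> in M. summable (\<lambda>k. a i \<omega> ^ k * \<epsilon> i (u - int k) \<omega>)"
proof -
  let ?f = "\<lambda>k \<omega>. \<bar>a i \<omega> ^ k * \<epsilon> i (u - int k) \<omega>\<bar>"
  have E: "(\<integral>\<^sup>+\<omega>. ennreal (?f k \<omega>) \<partial>M) = ennreal (\<mu> k * expectation (\<lambda>\<omega>. \<bar>\<epsilon> 0 0 \<omega>\<bar>))" for k
  proof -
    have ind: "indep_var borel (\<lambda>\<omega>. \<bar>a i \<omega> ^ k\<bar>) borel (\<lambda>\<omega>. \<bar>\<epsilon> i (u - int k) \<omega>\<bar>)"
    proof (rule indep_var_Gen[of "{Inr i}" "{Inl (i, u - int k)}"])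
      show "(\<lambda>\<omega>. \<bar>a i \<omega> ^ k\<bar>) \<in> borel_measurable (Gen {Inr i})"
        by (intro borel_measurable_abs borel_measurable_power a_Gen) simp
      show "(\<lambda>\<omega>. \<bar>\<epsilon> i (u - int k) \<omega>\<bar>) \<in> borel_measurable (Gen {Inl (i, u - int k)})"
        by (intro borel_measurable_abs \<epsilon>_Gen) simp
    qed simp
    have ia: "integrable M (\<lambda>\<omega>. \<bar>a i \<omega> ^ k\<bar>)" using integrable_a_power by simp
    have ie: "integrable M (\<lambda>\<omega>. \<bar>\<epsilon> i (u - int k) \<omega>\<bar>)"
      by (rule integrable_\<epsilon>[of "\<lambda>x. \<bar>x\<bar>"]) (use innovation_integrable in auto)
    have "expectation (?f k) = expectation (\<lambda>\<omega>. \<bar>a i \<omega> ^ k\<bar>) * expectation (\<lambda>\<omega>. \<bar>\<epsilon> i (u - int k) \<omega>\<bar>)"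
      using indep_var_lebesgue_integral[OF ind ia ie] by (simp add: abs_mult)
    also have "expectation (\<lambda>\<omega>. \<bar>\<epsilon> i (u - int k) \<omega>\<bar>) = expectation (\<lambda>\<omega>. \<bar>\<epsilon> 0 0 \<omega>\<bar>)"
      by (rule expectation_\<epsilon>) simp
    also have "expectation (\<lambda>\<omega>. \<bar>a i \<omega> ^ k\<bar>) = \<mu> k"
      unfolding expectation_a_power[of i, symmetric]
      using AE_a_range by (intro integral_cong_AE) (auto elim!: eventually_mono)
    finally have "expectation (?f k) = \<mu> k * expectation (\<lambda>\<omega>. \<bar>\<epsilon> 0 0 \<omega>\<bar>)" .
    moreover have "integrable M (?f k)" using indep_var_integrable[OF ind ia ie] by (simp add: abs_mult)
    ultimately show ?thesis by (simp add: nn_integral_eq_integral)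
  qed
  have "(\<integral>\<^sup>+\<omega>. (\<Sum>k. ennreal (?f k \<omega>)) \<partial>M) = (\<Sum>k. ennreal (\<mu> k * expectation (\<lambda>\<omega>. \<bar>\<epsilon> 0 0 \<omega>\<bar>)))"
    by (subst nn_integral_suminf) (simp_all only: E, measurable)
  also have "\<dots> \<noteq> \<infinity>"
    using summable_mult2[OF summable_\<mu>, of "expectation (\<lambda>\<omega>. \<bar>\<epsilon> 0 0 \<omega>\<bar>)"] \<mu>_nonneg
    by (simp add: suminf_ennreal2)
  finally have "AE \<omega> in M. (\<Sum>k. ennreal (?f k \<omega>)) \<noteq> \<infinity>"
    by (intro nn_integral_PInf_AE) auto
  then show ?thesis
  proof eventually_elim
    case (elim \<omega>)
    then have "summable (\<lambda>k. ?f k \<omega>)"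
      by (intro summable_suminf_not_top) (auto simp: infinity_ennreal_def)
    then show ?case by (rule summable_rabs_cancel)
  qed
qed

lemma panel_X_measurable: "panel_X \<epsilon> a i u \<in> borel_measurable M"
  unfolding panel_X_def by measurable

definition row_cut :: "nat \<Rightarrow> int \<Rightarrow> int \<Rightarrow> 'a \<Rightarrow> real" where
  "row_cut m i u \<omega> = (\<Sum>k<m. a i \<omega> ^ k * \<epsilon> i (u - int k) \<omega>)"

lemma AE_row_cut: "AE \<omega> in M. \<forall>i u. (\<lambda>m. row_cut m i u \<omega>) \<longlonglongrightarrow> panel_X \<epsilon> a i u \<omega>"
proof -
  have "AE \<omega> in M. \<forall>i u. summable (\<lambda>k. a i \<omega> ^ k * \<epsilon> i (u - int k) \<omega>)"
    unfolding AE_all_countable using AE_summable_row by blast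
  then show ?thesis
    by eventually_elim (auto simp: row_cut_def panel_X_def intro!: summable_LIMSEQ)
qed

definition full_sum :: "int set \<Rightarrow> int set \<Rightarrow> (int \<Rightarrow> real) \<Rightarrow> 'a \<Rightarrow> real" where
  "full_sum I U c \<omega> = (\<Sum>i\<in>I. \<Sum>u\<in>U. c u * (panel_X \<epsilon> a i u \<omega> * panel_X \<epsilon> a (i + s) (u + t) \<omega>))"

lemma full_sum_measurable: "full_sum I U c \<in> borel_measurable M"
  unfolding full_sum_def using panel_X_measurable by measurable

abbreviation "id_sum \<equiv> lag_sum (\<lambda>x. x) (\<lambda>x. x)"

lemma lag_sum_row_cut:
  "id_sum I (lags m) U c \<omega> = (\<Sum>i\<in>I. \<Sum>u\<in>U. c u * (row_cut m i u \<omega> * row_cut m (i + s) (u + t) \<omega>))"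
proof -
  have "(\<Sum>kl\<in>lags m. lag_term (\<lambda>x. x) (\<lambda>x. x) i kl u \<omega>) = row_cut m i u \<omega> * row_cut m (i + s) (u + t) \<omega>" for i u
    unfolding row_cut_def sum_product lags_def
    by (simp add: sum.cartesian_product' lag_term_def \<zeta>_def f\<epsilon>_def mult_ac)
  then show ?thesis
    unfolding lag_sum_def sum.swap[of _ U "lags m"] sum_distrib_left[symmetric] by simp
qed

lemma AE_id_sum_tendsto: "AE \<omega> in M. (\<lambda>m. id_sum I (lags m) U c \<omega>) \<longlonglongrightarrow> full_sum I U c \<omega>"
  using AE_row_cut
  by eventually_elim (auto simp: lag_sum_row_cut full_sum_def intro!: tendsto_intros)

lemma lag_sum_diff:
  assumes "finite P'" "P \<subseteq> P'"
  shows "lag_sum F G I P' U c \<omega> - lag_sum F G I P U c \<omega> = lag_sum F G I (P' - P) U c \<omega>"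
  unfolding lag_sum_def sum_subtractf[symmetric] using assms by (simp add: sum_diff)

text \<open>All covariances of lag terms are nonnegative multiples of an autocorrelation of \<open>c\<close>; hence the
  lags beyond \<open>m\<close> contribute at most \<open>EA\<close> minus the form of the first \<open>m\<close> lags. Fatou's lemma lets
  the upper cut-off go to infinity.\<close>

lemma full_sum_approx:
  fixes c :: "int \<Rightarrow> real"
  assumes fin: "finite U" and supp: "\<And>u. u \<notin> U \<Longrightarrow> c u = 0"
  shows "sq_integrable (\<lambda>\<omega>. full_sum I U c \<omega> - id_sum I (lags m) U c \<omega>)" (is ?int)
    and "mean_sq (\<lambda>\<omega>. full_sum I U c \<omega> - id_sum I (lags m) U c \<omega>)
      \<le> card I * energy U c * (EA - lag_mass (lags m))" (is ?bound)
proof -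
  let ?L = "\<lambda>n. id_sum I (lags n) U c"
  let ?b = "card I * energy U c * (EA - lag_mass (lags m))"
  have b0: "0 \<le> ?b" using lag_form_le_EA[of m] by (intro mult_nonneg_nonneg sum_nonneg) auto
  have Lm: "?L n \<in> borel_measurable M" for n by (rule lag_sum_measurable[OF centred_id centred_id])
  have step: "(\<integral>\<^sup>+\<omega>. ennreal ((?L n \<omega> - ?L m \<omega>)\<^sup>2) \<partial>M) \<le> ennreal ?b" if "m \<le> n" for n
  proof -
    have sub: "lags m \<subseteq> lags n" using that by (auto simp: lags_def)
    have eq: "?L n \<omega> - ?L m \<omega> = id_sum I (lags n - lags m) U c \<omega>" for \<omega>
      by (rule lag_sum_diff[OF finite_lags sub])
    have int: "sq_integrable (id_sum I (lags n - lags m) U c)"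
      by (rule lag_sum_second_moment(1)[OF centred_id centred_id fin supp])
    have "mean_sq (id_sum I (lags n - lags m) U c)
        \<le> card I * (second_moment (\<lambda>x. x) * second_moment (\<lambda>x. x)) * (energy U c * lag_mass (lags n - lags m))"
      by (rule lag_sum_second_moment_le[OF centred_id centred_id fin supp])
    also have "\<dots> = card I * energy U c * lag_mass (lags n - lags m)"
      by (simp add: second_moment_id)
    also have "\<dots> \<le> ?b"
      using lag_form_diff[OF sub finite_lags] lag_form_le_EA[of n]
      by (intro mult_left_mono mult_nonneg_nonneg sum_nonneg) auto
    finally show ?thesis
      unfolding eq using int by (subst nn_integral_eq_integral) (auto intro: ennreal_leI)
  qed
  have "(\<integral>\<^sup>+\<omega>. ennreal ((full_sum I U c \<omega> - ?L m \<omega>)\<^sup>2) \<partial>M)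
    = (\<integral>\<^sup>+\<omega>. liminf (\<lambda>n. ennreal ((?L n \<omega> - ?L m \<omega>)\<^sup>2)) \<partial>M)"
  proof (rule nn_integral_cong_AE)
    show "AE \<omega> in M. ennreal ((full_sum I U c \<omega> - ?L m \<omega>)\<^sup>2) = liminf (\<lambda>n. ennreal ((?L n \<omega> - ?L m \<omega>)\<^sup>2))"
      using AE_id_sum_tendsto[of I U c]
    proof eventually_elim
      case (elim \<omega>)
      then have "(\<lambda>n. ennreal ((?L n \<omega> - ?L m \<omega>)\<^sup>2)) \<longlonglongrightarrow> ennreal ((full_sum I U c \<omega> - ?L m \<omega>)\<^sup>2)"
        by (intro tendsto_intros)
      from lim_imp_Liminf[OF sequentially_bot this] show ?case by simp
    qed
  qed
  also have "\<dots> \<le> liminf (\<lambda>n. \<integral>\<^sup>+\<omega>. ennreal ((?L n \<omega> - ?L m \<omega>)\<^sup>2) \<partial>M)"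
    by (rule nn_integral_liminf) (use Lm in measurable)
  also have "\<dots> \<le> ennreal ?b"
    by (rule order_trans[OF Liminf_le_Limsup[OF sequentially_bot] Limsup_bounded])
       (use step in \<open>auto intro: eventually_sequentiallyI\<close>)
  finally have le: "(\<integral>\<^sup>+\<omega>. ennreal ((full_sum I U c \<omega> - ?L m \<omega>)\<^sup>2) \<partial>M) \<le> ennreal ?b" .
  have meas: "(\<lambda>\<omega>. (full_sum I U c \<omega> - ?L m \<omega>)\<^sup>2) \<in> borel_measurable M"
    using Lm full_sum_measurable by (intro borel_measurable_power borel_measurable_diff)
  show int: ?int
    using le meas by (intro integrableI_nonneg) (auto simp: le_less_trans)
  show ?bound
    using le b0 by (simp add: nn_integral_eq_integral[OF int])
qed

section \<open>Truncation of the innovations\<close>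

definition clip :: "nat \<Rightarrow> real \<Rightarrow> real" where
  "clip R x = max (- real R) (min (real R) x)"

abbreviation "clip_mean R \<equiv> expectation (\<lambda>\<omega>. clip R (\<epsilon> 0 0 \<omega>))"

text \<open>Clipping may shift the mean; recentring restores the mean 0 on which all orthogonality
  relations rest.\<close>

definition trunc :: "nat \<Rightarrow> real \<Rightarrow> real" where
  "trunc R x = clip R x - clip_mean R"

lemma clip_measurable [measurable]: "clip R \<in> borel_measurable borel"
  unfolding clip_def[abs_def] by measurable

lemma abs_clip_le: "\<bar>clip R x\<bar> \<le> R" "\<bar>clip R x\<bar> \<le> \<bar>x\<bar>"
  by (auto simp: clip_def)

lemma clip_tendsto: "(\<lambda>R. clip R x) \<longlonglongrightarrow> x"
proof -
  obtain n :: nat where "\<bar>x\<bar> \<le> n" using real_arch_simple by blast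
  then have "clip R x = x" if "n \<le> R" for R using that by (auto simp: clip_def)
  then show ?thesis by (intro tendsto_eventually eventually_sequentiallyI[of n])
qed

lemma integrable_clip: "integrable M (\<lambda>\<omega>. clip R (\<epsilon> 0 0 \<omega>))"
  by (rule integrable_const_bound[of _ "real R"]) (auto simp: abs_clip_le)

lemma integrable_clip_square: "sq_integrable (\<lambda>\<omega>. clip R (\<epsilon> 0 0 \<omega>))"
  by (rule integrable_const_bound[of _ "(real R)\<^sup>2"]) (auto simp: abs_clip_le power2_le_iff_abs_le)

lemma centred_trunc: "centred (trunc R)"
proof -
  define e where "e = clip_mean R"
  have "integrable M (\<lambda>\<omega>. (clip R (\<epsilon> 0 0 \<omega>))\<^sup>2 - 2 * e * clip R (\<epsilon> 0 0 \<omega>) + e\<^sup>2)"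
    using integrable_clip integrable_clip_square by simp
  then have "sq_integrable (\<lambda>\<omega>. clip R (\<epsilon> 0 0 \<omega>) - e)"
    by (simp add: power2_diff algebra_simps)
  moreover have "expectation (\<lambda>\<omega>. clip R (\<epsilon> 0 0 \<omega>) - e) = 0"
    using integrable_clip by (simp add: e_def prob_space)
  moreover have "trunc R \<in> borel_measurable borel"
    unfolding trunc_def[abs_def] by measurable
  ultimately show ?thesis by (simp add: centred_def trunc_def e_def)
qed

lemma abs_trunc_le: "\<bar>trunc R x\<bar> \<le> 2 * R"
proof -
  have "\<bar>clip_mean R\<bar> \<le> expectation (\<lambda>\<omega>. \<bar>clip R (\<epsilon> 0 0 \<omega>)\<bar>)"
    by (rule integral_abs_bound)
  also have "\<dots> \<le> expectation (\<lambda>\<omega>. real R)"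
    using integrable_clip by (intro integral_mono) (auto simp: abs_clip_le)
  finally show ?thesis
    using abs_clip_le(1)[of R x] unfolding trunc_def by (simp add: prob_space)
qed

lemma expectation_clip_tendsto: "(\<lambda>R. clip_mean R) \<longlonglongrightarrow> 0"
proof -
  have "(\<lambda>R. clip_mean R) \<longlonglongrightarrow> expectation (\<epsilon> 0 0)"
    by (rule integral_dominated_convergence[where w = "\<lambda>\<omega>. \<bar>\<epsilon> 0 0 \<omega>\<bar>"])
       (use innovation_integrable abs_clip_le clip_tendsto in auto)
  then show ?thesis by (simp add: innovation_mean)
qed

lemma second_moment_trunc_tendsto: "(\<lambda>R. second_moment (trunc R)) \<longlonglongrightarrow> 1"
proof -
  have eq: "second_moment (trunc R) = mean_sq (\<lambda>\<omega>. clip R (\<epsilon> 0 0 \<omega>)) - (clip_mean R)\<^sup>2" for R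
    unfolding second_moment_def trunc_def
    by (rule variance_eq[OF integrable_clip integrable_clip_square])
  have "(\<lambda>R. mean_sq (\<lambda>\<omega>. clip R (\<epsilon> 0 0 \<omega>))) \<longlonglongrightarrow> mean_sq (\<epsilon> 0 0)"
    by (rule integral_dominated_convergence[where w = "\<lambda>\<omega>. (\<epsilon> 0 0 \<omega>)\<^sup>2"])
       (use innovation_integrable abs_clip_le(2) in \<open>auto intro!: clip_tendsto tendsto_intros simp: abs_le_square_iff[symmetric]\<close>)
  then have "(\<lambda>R. second_moment (trunc R)) \<longlonglongrightarrow> mean_sq (\<epsilon> 0 0) - 0\<^sup>2"
    unfolding eq by (intro tendsto_intros expectation_clip_tendsto)
  then show ?thesis using second_moment_id by (simp add: second_moment_def)
qed

lemma second_moment_trunc_le: "second_moment (trunc R) \<le> 1"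
proof -
  have "second_moment (trunc R) \<le> mean_sq (\<lambda>\<omega>. clip R (\<epsilon> 0 0 \<omega>))"
    unfolding second_moment_def trunc_def
    by (subst variance_eq[OF integrable_clip integrable_clip_square]) simp
  also have "\<dots> \<le> mean_sq (\<epsilon> 0 0)"
    using integrable_clip_square innovation_integrable abs_clip_le(2)
    by (intro integral_mono) (auto simp: abs_le_square_iff[symmetric])
  also have "\<dots> = 1" using second_moment_id by (simp add: second_moment_def)
  finally show ?thesis .
qed

abbreviation "trunc_sum R m I \<equiv> lag_sum (trunc R) (trunc R) I (lags m)"

abbreviation approx_error :: "nat \<Rightarrow> nat \<Rightarrow> int set \<Rightarrow> int set \<Rightarrow> (int \<Rightarrow> real) \<Rightarrow> 'a \<Rightarrow> real" where
  "approx_error R m I U c \<omega> \<equiv> full_sum I U c \<omega> - trunc_sum R m I U c \<omega>"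

abbreviation rest :: "nat \<Rightarrow> real \<Rightarrow> real" where "rest R x \<equiv> x - trunc R x"

lemma centred_rest: "centred (rest R)"
  and second_moment_rest_tendsto: "(\<lambda>R. second_moment (rest R)) \<longlonglongrightarrow> 0"
proof -
  have int: "integrable M (\<lambda>\<omega>. \<epsilon> 0 0 \<omega> * trunc R (\<epsilon> 0 0 \<omega>))" for R
    using f\<epsilon>_mult_integrable[OF centred_id centred_trunc, of "(0, 0)" R "(0, 0)"] by (simp add: f\<epsilon>_def)
  have i2: "sq_integrable (\<lambda>\<omega>. trunc R (\<epsilon> 0 0 \<omega>))" "trunc R \<in> borel_measurable borel"
    "expectation (\<lambda>\<omega>. trunc R (\<epsilon> 0 0 \<omega>)) = 0" for R
    using centred_trunc[of R] by (auto simp: centred_def)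
  have eq: "(rest R x)\<^sup>2 = x\<^sup>2 - 2 * (x * trunc R x) + (trunc R x)\<^sup>2" for R x
    by (simp add: power2_diff)
  have sq: "sq_integrable (\<lambda>\<omega>. rest R (\<epsilon> 0 0 \<omega>))" for R
    unfolding eq using int i2 innovation_integrable by simp
  have "integrable M (\<lambda>\<omega>. trunc R (\<epsilon> 0 0 \<omega>))" for R
    using f\<epsilon>_integrable[OF centred_trunc, of R "(0, 0)"] by (simp add: f\<epsilon>_def[abs_def])
  then show "centred (rest R)"
    using sq i2 innovation_integrable innovation_mean by (simp add: centred_def)
  let ?m = "\<lambda>R. expectation (\<lambda>\<omega>. \<epsilon> 0 0 \<omega> * clip R (\<epsilon> 0 0 \<omega>))"
  have clip: "integrable M (\<lambda>\<omega>. \<epsilon> 0 0 \<omega> * clip R (\<epsilon> 0 0 \<omega>))" for R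
    by (rule integrable_mult_of_squares) (use innovation_integrable integrable_clip_square in auto)
  have "second_moment (rest R) = 1 - 2 * ?m R + second_moment (trunc R)" for R
  proof -
    \<comment> \<open>The recentring constant drops out because the innovation has mean 0.\<close>
    have "expectation (\<lambda>\<omega>. \<epsilon> 0 0 \<omega> * trunc R (\<epsilon> 0 0 \<omega>)) = ?m R"
      unfolding trunc_def right_diff_distrib using clip innovation_integrable by (simp add: innovation_mean)
    then show ?thesis
      unfolding second_moment_def eq using int i2 innovation_integrable second_moment_id by (simp add: second_moment_def)
  qed
  moreover have "(\<lambda>R. ?m R) \<longlonglongrightarrow> expectation (\<lambda>\<omega>. \<epsilon> 0 0 \<omega> * \<epsilon> 0 0 \<omega>)"
  proof (rule integral_dominated_convergence[where w = "\<lambda>\<omega>. (\<epsilon> 0 0 \<omega>)\<^sup>2"])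
    have "\<bar>x * clip R x\<bar> \<le> x\<^sup>2" for R x
      using mult_left_mono[OF abs_clip_le(2)[of R x] abs_ge_zero[of x]] by (simp add: abs_mult power2_eq_square)
    then show "AE \<omega> in M. norm (\<epsilon> 0 0 \<omega> * clip R (\<epsilon> 0 0 \<omega>)) \<le> (\<epsilon> 0 0 \<omega>)\<^sup>2" for R by simp
    show "AE \<omega> in M. (\<lambda>R. \<epsilon> 0 0 \<omega> * clip R (\<epsilon> 0 0 \<omega>)) \<longlonglongrightarrow> \<epsilon> 0 0 \<omega> * \<epsilon> 0 0 \<omega>"
      by (intro AE_I2 tendsto_intros clip_tendsto)
  qed (use innovation_integrable in auto)
  then have "(\<lambda>R. ?m R) \<longlonglongrightarrow> 1"
    using second_moment_id by (simp add: second_moment_def power2_eq_square)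
  then have "(\<lambda>R. 1 - 2 * ?m R + second_moment (trunc R)) \<longlonglongrightarrow> 1 - 2 * 1 + 1"
    by (intro tendsto_intros second_moment_trunc_tendsto)
  ultimately show "(\<lambda>R. second_moment (rest R)) \<longlonglongrightarrow> 0" by simp
qed

text \<open>xy - Tx Ty = (x - Tx) y + Tx (y - Ty), applied to each product. This is the reason why
  lag sums carry two separate transformations.\<close>

lemma lag_sum_bilinear:
  "id_sum I P U c \<omega> - lag_sum (trunc R) (trunc R) I P U c \<omega>
    = lag_sum (rest R) (\<lambda>x. x) I P U c \<omega> + lag_sum (trunc R) (rest R) I P U c \<omega>"
  unfolding lag_sum_def sum_subtractf[symmetric] sum.distrib[symmetric]
  by (intro sum.cong refl) (simp add: lag_term_def \<zeta>_def f\<epsilon>_def algebra_simps)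

text \<open>Quantified over all sets of rows and all time weights, so that one choice of
  \<open>m\<close> and \<open>R\<close> serves every N and n. The error is relative to the natural
  size \<open>card I * energy U c\<close> of a second moment.\<close>

definition uniformly_close :: "nat \<Rightarrow> nat \<Rightarrow> real \<Rightarrow> bool" where
  "uniformly_close R m e \<longleftrightarrow> (\<forall>I U c. finite U \<longrightarrow> (\<forall>u. u \<notin> U \<longrightarrow> c u = 0) \<longrightarrow>
     sq_integrable (approx_error R m I U c) \<and> mean_sq (approx_error R m I U c) \<le> card I * energy U c * e)"

lemma exists_bounded_approximation:
  fixes e :: real
  assumes e: "e > 0"
  obtains m R where
    "\<bar>second_moment (trunc R) * second_moment (trunc R) * lag_mass (lags m) - EA\<bar> \<le> e"
    "uniformly_close R m e"
proof -
  let ?G = "\<lambda>m. lag_mass (lags m)"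
  \<comment> \<open>Relative to \<open>card I * energy U c\<close>, the lag cut-off costs at most d
    and each of the two truncation terms at most d EA. Squaring a sum of three terms costs a factor
    3, and d (3 + 6 EA) <= 12 d (EA + 1) = e.\<close>
  define d where "d = e / (12 * (EA + 1))"
  have EA1: "0 < EA + 1" using EA_nonneg by simp
  have "d * (12 * (EA + 1)) = e" using EA1 d_def nonzero_eq_divide_eq[of "12 * (EA + 1)" d e] by simp
  then have d: "d > 0" "12 * d * (EA + 1) = e" using e EA1 by (simp add: d_def, simp only: mult_ac)
  have "eventually (\<lambda>m. dist (?G m) EA < d) sequentially"
    by (rule tendstoD[OF lag_form_tendsto_EA d(1)])
  then obtain m where m: "\<bar>?G m - EA\<bar> < d" by (auto simp: eventually_sequentially dist_real_def)
  have "(\<lambda>R. second_moment (trunc R) * second_moment (trunc R) * ?G m) \<longlonglongrightarrow> 1 * 1 * ?G m"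
    by (intro tendsto_intros second_moment_trunc_tendsto)
  then have "eventually (\<lambda>R. dist (second_moment (trunc R) * second_moment (trunc R) * ?G m) (1 * 1 * ?G m) < d) sequentially"
    by (rule tendstoD) (rule d)
  moreover have "eventually (\<lambda>R. dist (second_moment (rest R)) 0 < d) sequentially"
    by (rule tendstoD[OF second_moment_rest_tendsto d(1)])
  ultimately have "eventually (\<lambda>R. dist (second_moment (trunc R) * second_moment (trunc R) * ?G m) (1 * 1 * ?G m) < d
      \<and> dist (second_moment (rest R)) 0 < d) sequentially"
    by (rule eventually_conj)
  then obtain R where R: "\<bar>second_moment (trunc R) * second_moment (trunc R) * ?G m - ?G m\<bar> < d" "second_moment (rest R) < d"
    by (auto simp: eventually_sequentially dist_real_def second_moment_nonneg)
  have dle: "2 * d \<le> e"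
  proof -
    have "2 * d * 1 \<le> 12 * d * (EA + 1)" using d(1) EA_nonneg by (intro mult_mono) auto
    then show ?thesis using d(2) by simp
  qed
  show ?thesis
  proof (rule that)
    show "\<bar>second_moment (trunc R) * second_moment (trunc R) * ?G m - EA\<bar> \<le> e"
      using R(1) m dle by linarith
    show "uniformly_close R m e"
      unfolding uniformly_close_def
    proof (intro allI impI)
      fix I :: "int set" and U and c :: "int \<Rightarrow> real" assume fin: "finite U" and "\<forall>u. u \<notin> U \<longrightarrow> c u = 0"
      then have supp: "c u = 0" if "u \<notin> U" for u using that by blast
      let ?c2 = "card I * energy U c"
      have c2: "0 \<le> ?c2" by (simp add: sum_nonneg)
      let ?X = "\<lambda>\<omega>. full_sum I U c \<omega> - id_sum I (lags m) U c \<omega>"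
      let ?Y = "lag_sum (rest R) (\<lambda>x. x) I (lags m) U c"
      let ?Z = "lag_sum (trunc R) (rest R) I (lags m) U c"
      let ?D = "\<lambda>\<omega>. full_sum I U c \<omega> - trunc_sum R m I U c \<omega>"
      have iX: "sq_integrable ?X" by (rule full_sum_approx(1)[OF fin supp])
      have iY: "sq_integrable ?Y" by (rule lag_sum_second_moment(1)[OF centred_rest centred_id fin supp])
      have iZ: "sq_integrable ?Z" by (rule lag_sum_second_moment(1)[OF centred_trunc centred_rest fin supp])
      have EX: "mean_sq ?X \<le> ?c2 * d"
      proof -
        have "mean_sq ?X \<le> ?c2 * (EA - ?G m)" by (rule full_sum_approx(2)[OF fin supp])
        also have "\<dots> \<le> ?c2 * d" using m c2 by (intro mult_left_mono) auto
        finally show ?thesis .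
      qed
      have G: "0 \<le> ?G m" "?G m \<le> EA" by (rule lag_form_nonneg, rule lag_form_le_EA)
      have EY: "mean_sq ?Y \<le> ?c2 * (d * EA)"
      proof -
        have "mean_sq ?Y \<le> card I * (second_moment (rest R) * second_moment (\<lambda>x. x)) * (energy U c * ?G m)"
          by (rule lag_sum_second_moment_le[OF centred_rest centred_id fin supp])
        also have "\<dots> = ?c2 * (second_moment (rest R) * ?G m)" by (simp add: second_moment_id)
        also have "\<dots> \<le> ?c2 * (d * EA)"
          using c2 G R(2) second_moment_nonneg d(1) by (intro mult_left_mono mult_mono) auto
        finally show ?thesis .
      qed
      have EZ: "mean_sq ?Z \<le> ?c2 * (d * EA)"
      proof -
        have "mean_sq ?Z \<le> card I * (second_moment (trunc R) * second_moment (rest R)) * (energy U c * ?G m)"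
          by (rule lag_sum_second_moment_le[OF centred_trunc centred_rest fin supp])
        also have "\<dots> = ?c2 * (second_moment (trunc R) * second_moment (rest R) * ?G m)" by simp
        also have "\<dots> \<le> ?c2 * (1 * d * EA)"
          using c2 G R(2) second_moment_nonneg second_moment_trunc_le d(1)
          by (intro mult_left_mono mult_mono mult_nonneg_nonneg sum_nonneg) auto
        finally show ?thesis by simp
      qed
      have D: "?D \<omega> = ?X \<omega> + (?Y \<omega> + ?Z \<omega>)" for \<omega>
        using lag_sum_bilinear[of I "lags m" U c \<omega> R] by linarith
      have ineq: "(x + (y + z))\<^sup>2 \<le> 3 * x\<^sup>2 + 3 * y\<^sup>2 + 3 * z\<^sup>2" for x y z :: real
      proof -
        have "0 \<le> (x - y)\<^sup>2 + (y - z)\<^sup>2 + (x - z)\<^sup>2" by simp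
        then show ?thesis by (simp add: power2_eq_square algebra_simps)
      qed
      have i3: "integrable M (\<lambda>\<omega>. 3 * (?X \<omega>)\<^sup>2 + 3 * (?Y \<omega>)\<^sup>2 + 3 * (?Z \<omega>)\<^sup>2)"
        using iX iY iZ by simp
      have meas: "?D \<in> borel_measurable M"
        by (intro borel_measurable_diff full_sum_measurable lag_sum_measurable centred_trunc)
      have iD: "sq_integrable ?D"
        by (rule Bochner_Integration.integrable_bound[OF i3])
           (use meas in \<open>auto simp only: D real_norm_def abs_power2 intro!: AE_I2 order_trans[OF ineq] borel_measurable_power\<close>)
      have "mean_sq ?D \<le> expectation (\<lambda>\<omega>. 3 * (?X \<omega>)\<^sup>2 + 3 * (?Y \<omega>)\<^sup>2 + 3 * (?Z \<omega>)\<^sup>2)"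
        by (rule integral_mono[OF iD i3]) (simp only: D ineq)
      also have "\<dots> = 3 * mean_sq ?X + 3 * mean_sq ?Y + 3 * mean_sq ?Z"
        using iX iY iZ by simp
      also have "\<dots> \<le> 3 * (?c2 * d) + 3 * (?c2 * (d * EA)) + 3 * (?c2 * (d * EA))"
        using EX EY EZ by linarith
      also have "\<dots> = ?c2 * (d * (3 + 6 * EA))" by (simp add: algebra_simps)
      also have "\<dots> \<le> ?c2 * e"
      proof (rule mult_left_mono[OF _ c2])
        have "d * (3 + 6 * EA) \<le> d * (12 * (EA + 1))" using d(1) EA_nonneg by (intro mult_left_mono) auto
        then show "d * (3 + 6 * EA) \<le> e" using d(2) by (simp add: mult_ac)
      qed
      finally show "sq_integrable ?D \<and> mean_sq ?D \<le> ?c2 * e"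
        using iD by blast
    qed
  qed
qed

end

section \<open>Fourth moments\<close>

text \<open>The Cauchy-Schwarz inequality, applied to the sum and then to the sum of
  squares.\<close>

lemma sum_power4_le:
  fixes f :: "'i \<Rightarrow> real"
  shows "(\<Sum>i\<in>I. f i) ^ 4 \<le> real (card I) ^ 3 * (\<Sum>i\<in>I. f i ^ 4)"
proof -
  have "(\<Sum>i\<in>I. f i) ^ 4 = ((\<Sum>i\<in>I. f i)\<^sup>2)\<^sup>2" by (simp add: power_mult[symmetric])
  also have "\<dots> \<le> ((\<Sum>i\<in>I. (f i)\<^sup>2) * card I)\<^sup>2"
    by (intro power_mono sum_squared_le_sum_of_squares) simp
  also have "\<dots> = (\<Sum>i\<in>I. (f i)\<^sup>2)\<^sup>2 * (real (card I))\<^sup>2" by (simp add: power_mult_distrib)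
  also have "\<dots> \<le> (\<Sum>i\<in>I. ((f i)\<^sup>2)\<^sup>2) * card I * (real (card I))\<^sup>2"
    by (intro mult_right_mono sum_squared_le_sum_of_squares) simp
  also have "\<dots> = real (card I) ^ 3 * (\<Sum>i\<in>I. f i ^ 4)"
    by (simp add: power4_eq_xxxx power3_eq_cube power2_eq_square mult_ac)
  finally show ?thesis .
qed

context prob_space
begin

text \<open>Adding one variable to the sum, the odd mixed terms vanish by independence and centring.
  What remains is bounded by b^4 + 6 b^2 B + 3 B^2, which is at most 3 (b^2 + B)^2. The second
  moment is carried along because the middle term uses it.\<close>

lemma indep_sum_moments:
  fixes X :: "'i \<Rightarrow> 'a \<Rightarrow> real"
  assumes "finite U" "indep_vars (\<lambda>_. borel) X U"
    and "\<And>u. u \<in> U \<Longrightarrow> expectation (X u) = 0" "\<And>u \<omega>. u \<in> U \<Longrightarrow> \<bar>X u \<omega>\<bar> \<le> b u"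
  shows "mean_sq (\<lambda>\<omega>. \<Sum>u\<in>U. X u \<omega>) \<le> (\<Sum>u\<in>U. (b u)\<^sup>2) \<and>
    expectation (\<lambda>\<omega>. (\<Sum>u\<in>U. X u \<omega>) ^ 4) \<le> 3 * (\<Sum>u\<in>U. (b u)\<^sup>2)\<^sup>2"
  using assms
proof (induction rule: finite_induct)
  case empty
  then show ?case by simp
next
  case (insert v U)
  let ?S = "\<lambda>\<omega>. \<Sum>u\<in>U. X u \<omega>" and ?B = "\<Sum>u\<in>U. (b u)\<^sup>2"
  have indU: "indep_vars (\<lambda>_. borel) X U" by (rule indep_vars_subset[OF insert.prems(1)]) auto
  have IH: "mean_sq ?S \<le> ?B" "expectation (\<lambda>\<omega>. ?S \<omega> ^ 4) \<le> 3 * ?B\<^sup>2"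
    using insert.IH[OF indU] insert.prems by auto
  have rv: "X u \<in> borel_measurable M" if "u \<in> insert v U" for u
    using insert.prems(1) that unfolding indep_vars_def2 by blast
  have Sm: "?S \<in> borel_measurable M" by (rule borel_measurable_sum) (use rv in auto)
  have ind: "indep_var borel (X v) borel ?S"
    by (rule indep_vars_sum[OF insert.hyps insert.prems(1)])
  have bS: "\<bar>?S \<omega>\<bar> \<le> (\<Sum>u\<in>U. b u)" for \<omega>
    by (rule order_trans[OF sum_abs sum_mono]) (use insert.prems in auto)
  have bv: "\<bar>X v \<omega>\<bar> \<le> b v" for \<omega> using insert.prems by auto
  have iS: "integrable M (\<lambda>\<omega>. ?S \<omega> ^ k)" for k
    by (rule integrable_const_bound[of _ "(\<Sum>u\<in>U. b u) ^ k"])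
       (use Sm bS in \<open>auto simp: power_abs intro!: power_mono AE_I2\<close>)
  have iv: "integrable M (\<lambda>\<omega>. X v \<omega> ^ k)" for k
    by (rule integrable_const_bound[of _ "b v ^ k"])
       (use rv bv in \<open>auto simp: power_abs intro!: power_mono AE_I2\<close>)
  have ind_pow: "indep_var borel (\<lambda>\<omega>. X v \<omega> ^ j) borel (\<lambda>\<omega>. ?S \<omega> ^ k)" for j k
    using indep_var_compose[OF ind, of "\<lambda>x. x ^ j" borel "\<lambda>x. x ^ k" borel] by (simp add: comp_def)
  have E: "expectation (\<lambda>\<omega>. X v \<omega> ^ j * ?S \<omega> ^ k) = expectation (\<lambda>\<omega>. X v \<omega> ^ j) * expectation (\<lambda>\<omega>. ?S \<omega> ^ k)" for j k
    by (rule indep_var_lebesgue_integral[OF ind_pow iv iS])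
  have i: "integrable M (\<lambda>\<omega>. X v \<omega> ^ j * ?S \<omega> ^ k)" for j k
    by (rule indep_var_integrable[OF ind_pow iv iS])
  have Ev: "expectation (\<lambda>\<omega>. X v \<omega> ^ 1) = 0" using insert.prems by simp
  have iu: "integrable M (X u)" if "u \<in> U" for u
    by (rule integrable_const_bound[of _ "b u"]) (use insert.prems rv that in auto)
  have ES: "expectation (\<lambda>\<omega>. ?S \<omega> ^ 1) = 0"
    using insert.prems iu by simp
  have Evk: "expectation (\<lambda>\<omega>. X v \<omega> ^ k) \<le> b v ^ k" for k
  proof -
    have "expectation (\<lambda>\<omega>. X v \<omega> ^ k) \<le> expectation (\<lambda>\<omega>. b v ^ k)"
    proof (rule integral_mono[OF iv])
      show "X v \<omega> ^ k \<le> b v ^ k" for \<omega>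
        using power_mono[OF bv[of \<omega>] abs_ge_zero, of k] by (simp flip: power_abs)
    qed simp
    then show ?thesis by (simp add: prob_space)
  qed
  let ?p = "\<lambda>j k \<omega>. X v \<omega> ^ j * ?S \<omega> ^ k"
  have sum: "(\<Sum>u\<in>insert v U. X u \<omega>) = X v \<omega> + ?S \<omega>" "(\<Sum>u\<in>insert v U. (b u)\<^sup>2) = (b v)\<^sup>2 + ?B" for \<omega>
    using insert.hyps by auto
  have "(\<lambda>\<omega>. (X v \<omega> + ?S \<omega>)\<^sup>2) = (\<lambda>\<omega>. ?p 2 0 \<omega> + 2 * ?p 1 1 \<omega> + ?p 0 2 \<omega>)"
    by (simp add: fun_eq_iff power2_sum)
  then have "mean_sq (\<lambda>\<omega>. X v \<omega> + ?S \<omega>) = expectation (?p 2 0) + 2 * expectation (?p 1 1) + expectation (?p 0 2)"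
    by (simp only: Bochner_Integration.integral_add Bochner_Integration.integrable_add integrable_mult_right i integral_mult_right_zero)
  also have "\<dots> \<le> (b v)\<^sup>2 + ?B"
    unfolding E Ev ES using IH(1) Evk[of 2] by (simp add: prob_space)
  finally have 2: "mean_sq (\<lambda>\<omega>. X v \<omega> + ?S \<omega>) \<le> (b v)\<^sup>2 + ?B" .
  have "(x + y) ^ 4 = x ^ 4 + 4 * (x ^ 3 * y) + 6 * (x ^ 2 * y ^ 2) + 4 * (x * y ^ 3) + y ^ 4" for x y :: real
    by algebra
  then have "(\<lambda>\<omega>. (X v \<omega> + ?S \<omega>) ^ 4) = (\<lambda>\<omega>. ?p 4 0 \<omega> + 4 * ?p 3 1 \<omega> + 6 * ?p 2 2 \<omega> + 4 * ?p 1 3 \<omega> + ?p 0 4 \<omega>)"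
    by (simp only: power_0 power_one_right mult_1_right mult_1_left)
  then have "expectation (\<lambda>\<omega>. (X v \<omega> + ?S \<omega>) ^ 4) = expectation (?p 4 0) + 4 * expectation (?p 3 1)
      + 6 * expectation (?p 2 2) + 4 * expectation (?p 1 3) + expectation (?p 0 4)"
    by (simp only: Bochner_Integration.integral_add Bochner_Integration.integrable_add integrable_mult_right i integral_mult_right_zero)
  also have "\<dots> = expectation (\<lambda>\<omega>. X v \<omega> ^ 4) + 6 * (mean_sq (X v) * mean_sq ?S) + expectation (\<lambda>\<omega>. ?S \<omega> ^ 4)"
    unfolding E Ev ES by (simp add: prob_space)
  also have "\<dots> \<le> b v ^ 4 + 6 * ((b v)\<^sup>2 * ?B) + 3 * ?B\<^sup>2"
    using IH Evk by (intro add_mono mult_left_mono mult_mono) (auto intro: sum_nonneg)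
  also have "\<dots> \<le> 3 * ((b v)\<^sup>2 + ?B)\<^sup>2"
    by (simp add: power2_sum power_mult[symmetric] algebra_simps)
  finally show ?case using 2 unfolding sum by simp
qed

text \<open>Replacing a variable by a mean-square approximation costs little in the characteristic
  function: the exponential is 1-Lipschitz, and the first absolute moment is at most the root of the
  second moment.\<close>

lemma iexp_diff_le:
  assumes "X \<in> borel_measurable M" "Y \<in> borel_measurable M"
    and int: "sq_integrable (\<lambda>\<omega>. X \<omega> - Y \<omega>)" and le: "mean_sq (\<lambda>\<omega>. X \<omega> - Y \<omega>) \<le> b"
  shows "cmod (cf X x - cf Y x) \<le> \<bar>x\<bar> * sqrt b"
proof -
  have m: "(\<lambda>\<omega>. x * X \<omega>) \<in> borel_measurable M" "(\<lambda>\<omega>. x * Y \<omega>) \<in> borel_measurable M" using assms by auto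
  have i: "integrable M (\<lambda>\<omega>. iexp (x * X \<omega>))" "integrable M (\<lambda>\<omega>. iexp (x * Y \<omega>))"
    by (rule integrable_iexp[OF measurable_compose[OF m(1) borel_measurable_of_real]], simp,
        rule integrable_iexp[OF measurable_compose[OF m(2) borel_measurable_of_real]], simp)
  have D: "(\<lambda>\<omega>. X \<omega> - Y \<omega>) \<in> borel_measurable M" using assms by simp
  have "cmod (cf X x - cf Y x) = cmod (\<integral>\<omega>. iexp (x * X \<omega>) - iexp (x * Y \<omega>) \<partial>M)"
    using i by simp
  also have "\<dots> \<le> expectation (\<lambda>\<omega>. cmod (iexp (x * X \<omega>) - iexp (x * Y \<omega>)))"
    by (rule integral_norm_bound)
  also have "\<dots> \<le> expectation (\<lambda>\<omega>. \<bar>x\<bar> * \<bar>X \<omega> - Y \<omega>\<bar>)"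
  proof (rule integral_mono)
    show "integrable M (\<lambda>\<omega>. cmod (iexp (x * X \<omega>) - iexp (x * Y \<omega>)))" using i by simp
    show "integrable M (\<lambda>\<omega>. \<bar>x\<bar> * \<bar>X \<omega> - Y \<omega>\<bar>)" using integrable_of_square[OF D int] by simp
    fix \<omega>
    have "iexp (x * X \<omega>) - iexp (x * Y \<omega>) = iexp (x * Y \<omega>) * (iexp (x * (X \<omega> - Y \<omega>)) - 1)"
      by (simp add: right_diff_distrib exp_add[symmetric] algebra_simps)
    then have "cmod (iexp (x * X \<omega>) - iexp (x * Y \<omega>)) = cmod (iexp (x * (X \<omega> - Y \<omega>)) - 1)"
      by (simp only: norm_mult norm_exp_i_times mult_1_left)
    also have "\<dots> \<le> \<bar>x * (X \<omega> - Y \<omega>)\<bar>"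
      using iexp_approx1[of "x * (X \<omega> - Y \<omega>)" 0] by simp
    finally show "cmod (iexp (x * X \<omega>) - iexp (x * Y \<omega>)) \<le> \<bar>x\<bar> * \<bar>X \<omega> - Y \<omega>\<bar>" by (simp add: abs_mult)
  qed
  also have "\<dots> = \<bar>x\<bar> * expectation (\<lambda>\<omega>. \<bar>X \<omega> - Y \<omega>\<bar>)" by simp
  also have "\<dots> \<le> \<bar>x\<bar> * sqrt b"
    using abs_expectation_le_root_square[OF D int] le by (intro mult_left_mono order_trans[OF _ real_sqrt_le_mono[OF le]]) auto
  finally show ?thesis .
qed

text \<open>Both sides are compared with 1 - x^2 w / 2: the characteristic function by the
  third-order Taylor remainder, the exponential by 1 - y <= exp (-y) <= 1 - y + y^2 for y >=
  0.\<close>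

lemma iexp_gaussian_approx:
  assumes X: "X \<in> borel_measurable M" and i4: "integrable M (\<lambda>\<omega>. X \<omega> ^ 4)" "expectation (\<lambda>\<omega>. X \<omega> ^ 4) \<le> C"
    and i2: "sq_integrable X" and E: "expectation X = 0" "mean_sq X = w"
  shows "cmod (cf X x - exp (- (x\<^sup>2 * w / 2) :: real)) \<le> \<bar>x\<bar> ^ 3 * (1 + C) + (x\<^sup>2 * w / 2)\<^sup>2"
proof -
  have i1: "integrable M X" by (rule integrable_of_square[OF X i2])
  have char: "cf X x = char (distr M borel X) x"
    unfolding char_def using X by (subst integral_distr) auto
  have 1: "cmod (cf X x - (1 - x\<^sup>2 * w / 2)) \<le> (x\<^sup>2 / 6) * expectation (\<lambda>\<omega>. min (6 * (X \<omega>)\<^sup>2) (\<bar>x\<bar> * \<bar>X \<omega>\<bar> ^ 3))"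
    unfolding char using char_approx3'[OF X i1 i2 E(1) _ refl, of w x] E by simp
  have "(x\<^sup>2 / 6) * expectation (\<lambda>\<omega>. min (6 * (X \<omega>)\<^sup>2) (\<bar>x\<bar> * \<bar>X \<omega>\<bar> ^ 3)) \<le> (x\<^sup>2 / 6) * expectation (\<lambda>\<omega>. \<bar>x\<bar> * (1 + X \<omega> ^ 4))"
  proof (intro mult_left_mono integral_mono)
    show "integrable M (\<lambda>\<omega>. min (6 * (X \<omega>)\<^sup>2) (\<bar>x\<bar> * \<bar>X \<omega>\<bar> ^ 3))"
      by (rule Bochner_Integration.integrable_bound[of M "\<lambda>\<omega>. 6 * (X \<omega>)\<^sup>2"]) (use X i2 in auto)
    show "integrable M (\<lambda>\<omega>. \<bar>x\<bar> * (1 + X \<omega> ^ 4))" using i4 by simp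
    fix \<omega>
    \<comment> \<open>This trades the third moment in the remainder for the fourth, which is the one
      under control.\<close>
    have "\<bar>y\<bar> ^ 3 \<le> 1 + y ^ 4" for y :: real
    proof (cases "\<bar>y\<bar> \<le> 1")
      case True
      then have "\<bar>y\<bar> ^ 3 \<le> 1" by (intro power_le_one) auto
      then show ?thesis by (smt (verit) zero_le_even_power' power2_less_0 even_numeral zero_le_even_power)
    next
      case False
      then have "\<bar>y\<bar> ^ 3 \<le> \<bar>y\<bar> ^ 4" by (intro power_increasing) auto
      then show ?thesis by simp
    qed
    then show "min (6 * (X \<omega>)\<^sup>2) (\<bar>x\<bar> * \<bar>X \<omega>\<bar> ^ 3) \<le> \<bar>x\<bar> * (1 + X \<omega> ^ 4)"
      by (intro min.coboundedI2 mult_left_mono) auto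
  qed auto
  also have "expectation (\<lambda>\<omega>. \<bar>x\<bar> * (1 + X \<omega> ^ 4)) = \<bar>x\<bar> * (1 + expectation (\<lambda>\<omega>. X \<omega> ^ 4))"
    using i4 by (simp add: prob_space)
  also have "(x\<^sup>2 / 6) * (\<bar>x\<bar> * (1 + expectation (\<lambda>\<omega>. X \<omega> ^ 4))) \<le> (x\<^sup>2 / 6) * (\<bar>x\<bar> * (1 + C))"
    using i4 by (intro mult_left_mono) auto
  also have "\<dots> = \<bar>x\<bar> ^ 3 * (1 + C) / 6"
    by (simp add: power3_eq_cube power2_eq_square)
  also have "\<dots> \<le> \<bar>x\<bar> ^ 3 * (1 + C)"
  proof -
    have "0 \<le> expectation (\<lambda>\<omega>. X \<omega> ^ 4)" by (rule Bochner_Integration.integral_nonneg) simp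
    then have "0 \<le> \<bar>x\<bar> ^ 3 * (1 + C)" using i4(2) by (intro mult_nonneg_nonneg) (simp, linarith)
    then show ?thesis by (simp add: mult.commute)
  qed
  finally have 2: "cmod (cf X x - (1 - x\<^sup>2 * w / 2)) \<le> \<bar>x\<bar> ^ 3 * (1 + C)" using 1 by linarith
  define y where "y = x\<^sup>2 * w / 2"
  have w0: "0 \<le> w" using E(2)[symmetric] by simp
  then have y0: "0 \<le> y" by (simp add: y_def)
  have 3: "cmod (complex_of_real (1 - y) - complex_of_real (exp (- y))) \<le> y\<^sup>2"
  proof -
    have lo: "1 - y \<le> exp (- y)" using exp_ge_add_one_self[of "- y"] by simp
    have up: "exp (- y) \<le> 1 - y + y\<^sup>2"
    proof (cases "y \<le> 1")
      case True
      have "1 + y \<le> exp y" by (rule exp_ge_add_one_self)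
      then have "exp (- y) \<le> 1 / (1 + y)" using y0 by (simp add: exp_minus field_simps)
      also have "\<dots> \<le> 1 - y + y\<^sup>2"
      proof -
        have "1 \<le> (1 - y + y\<^sup>2) * (1 + y)" using y0 by (simp add: power2_eq_square algebra_simps)
        then show ?thesis using y0 by (simp add: divide_le_eq)
      qed
      finally show ?thesis .
    next
      case False
      then have "y \<le> y\<^sup>2" by (simp add: power2_eq_square)
      moreover have "exp (- y) \<le> 1" using y0 by simp
      ultimately show ?thesis by linarith
    qed
    show ?thesis using lo up by (simp only: of_real_diff[symmetric] norm_of_real)
  qed
  have "cmod (cf X x - exp (- y)) \<le>
     cmod (cf X x - complex_of_real (1 - y)) + cmod (complex_of_real (1 - y) - complex_of_real (exp (- y)))"
    using norm_triangle_ineq[of "cf X x - complex_of_real (1 - y)" "complex_of_real (1 - y) - complex_of_real (exp (- y))"] by simp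
  also have "\<dots> \<le> \<bar>x\<bar> ^ 3 * (1 + C) + y\<^sup>2"
    using 2 3 by (intro add_mono) (simp_all add: y_def)
  finally show ?thesis by (simp add: y_def)
qed

end

section \<open>Fourth moments of lag sums with bounded innovations\<close>

context panel_mixing
begin

text \<open>The time sum for one row and one fixed pair of lags, with the random coefficients taken
  out; they do not depend on time. Only after fixing the lags are the summands independent.\<close>

definition lag_inner :: "(real \<Rightarrow> real) \<Rightarrow> int set \<Rightarrow> (int \<Rightarrow> real) \<Rightarrow> int \<Rightarrow> nat \<times> nat \<Rightarrow> 'a \<Rightarrow> real" where
  "lag_inner F U c i kl \<omega> = (\<Sum>u\<in>U. c u * \<zeta> F F (i, u - int (fst kl)) (i + s, u + t - int (snd kl)) \<omega>)"

lemma \<zeta>_expectation: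
  assumes "centred F" "centred G" "p \<noteq> q"
  shows "integrable M (\<zeta> F G p q)" "expectation (\<zeta> F G p q) = 0"
proof -
  have ind: "indep_var borel (f\<epsilon> F p) borel (f\<epsilon> G q)"
    by (rule indep_var_Gen[of "{Inl p}" "{Inl q}"])
       (use assms in \<open>auto intro!: f\<epsilon>_Gen\<close>)
  show "integrable M (\<zeta> F G p q)" "expectation (\<zeta> F G p q) = 0"
    using indep_var_lebesgue_integral[OF ind] indep_var_integrable[OF ind] assms
    by (simp_all add: \<zeta>_def[abs_def] f\<epsilon>_integrable f\<epsilon>_expectation)
qed

lemma lag_inner_fourth_moment:
  assumes F: "centred F" "\<And>x. \<bar>F x\<bar> \<le> K" and U: "finite U"
  shows "integrable M (\<lambda>\<omega>. lag_inner F U c i kl \<omega> ^ 4)"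
    and "expectation (\<lambda>\<omega>. lag_inner F U c i kl \<omega> ^ 4) \<le> 3 * (K ^ 4 * energy U c)\<^sup>2"
proof -
  let ?p = "\<lambda>u. (i, u - int (fst kl))" and ?q = "\<lambda>u. (i + s, u + t - int (snd kl))"
  let ?X = "\<lambda>u \<omega>. c u * \<zeta> F F (?p u) (?q u) \<omega>"
  have pq: "?p u \<noteq> ?q u" for u using s_nonzero by simp
  have b: "\<bar>?X u \<omega>\<bar> \<le> \<bar>c u\<bar> * K\<^sup>2" for u \<omega>
  proof -
    have "\<bar>F x\<bar> * \<bar>F y\<bar> \<le> K * K" for x y
      using F(2)[of x] F(2)[of y] by (intro mult_mono) auto
    then show ?thesis by (auto simp: \<zeta>_def f\<epsilon>_def abs_mult power2_eq_square intro!: mult_left_mono)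
  qed
  have ind: "indep_vars (\<lambda>_. borel) ?X U"
  proof (rule indep_vars_generated_by[OF indep_V])
    \<comment> \<open>The lags are fixed and the rows \<open>i\<close> and \<open>i + s\<close>
      differ, so different times use different innovations in both rows.\<close>
    show "disjoint_family_on (\<lambda>u. {Inl (?p u), Inl (?q u)}) U"
      using s_nonzero by (auto simp: disjoint_family_on_def)
    show "?X u \<in> borel_measurable (Gen {Inl (?p u), Inl (?q u)})" for u
      using F by (intro borel_measurable_times borel_measurable_const \<zeta>_Gen) auto
  qed
  have z: "expectation (?X u) = 0" for u
    using \<zeta>_expectation(2)[OF F(1) F(1) pq] by simp
  from indep_sum_moments[OF U ind z b]
  have "expectation (\<lambda>\<omega>. lag_inner F U c i kl \<omega> ^ 4) \<le> 3 * (\<Sum>u\<in>U. (\<bar>c u\<bar> * K\<^sup>2)\<^sup>2)\<^sup>2"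
    by (simp add: lag_inner_def)
  also have "(\<Sum>u\<in>U. (\<bar>c u\<bar> * K\<^sup>2)\<^sup>2) = K ^ 4 * energy U c"
    by (simp add: power_mult_distrib sum_distrib_left power_mult[symmetric] mult.commute)
  finally show "expectation (\<lambda>\<omega>. lag_inner F U c i kl \<omega> ^ 4) \<le> 3 * (K ^ 4 * energy U c)\<^sup>2" .
  have bs: "\<bar>lag_inner F U c i kl \<omega>\<bar> \<le> (\<Sum>u\<in>U. \<bar>c u\<bar> * K\<^sup>2)" for \<omega>
    unfolding lag_inner_def by (rule order_trans[OF sum_abs sum_mono[OF b]])
  have "lag_inner F U c i kl \<in> borel_measurable M"
    unfolding lag_inner_def using F by (intro borel_measurable_sum borel_measurable_times borel_measurable_const \<zeta>_measurable)
  then show "integrable M (\<lambda>\<omega>. lag_inner F U c i kl \<omega> ^ 4)"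
    by (intro integrable_const_bound[of _ "(\<Sum>u\<in>U. \<bar>c u\<bar> * K\<^sup>2) ^ 4"])
       (use power_mono[OF bs abs_ge_zero, where n = 4] in \<open>auto intro!: AE_I2\<close>)
qed

text \<open>The coefficients lie in [0, 1) and are dropped pointwise, then
  \<open>sum_power4_le\<close> is applied over rows and lags. This is crude in \<open>J\<close> and
  \<open>P\<close>, but both stay fixed in the limit, and time enters only through the
  energy.\<close>

lemma lag_sum_fourth_moment:
  assumes F: "centred F" "\<And>x. \<bar>F x\<bar> \<le> K" and U: "finite U" and fin: "finite J" "finite P"
  shows "integrable M (\<lambda>\<omega>. lag_sum F F J P U c \<omega> ^ 4)"
    and "expectation (\<lambda>\<omega>. lag_sum F F J P U c \<omega> ^ 4) \<le> real (card J * card P) ^ 4 * (3 * (K ^ 4 * energy U c)\<^sup>2)"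
proof -
  let ?q = "\<lambda>x. lag_inner F U c (fst x) (snd x)"
  let ?R = "\<lambda>\<omega>. real (card (J \<times> P)) ^ 3 * (\<Sum>x\<in>J \<times> P. ?q x \<omega> ^ 4)"
  have iR: "integrable M ?R"
    using lag_inner_fourth_moment(1)[OF F U] by (intro integrable_mult_right Bochner_Integration.integrable_sum)
  have le: "AE \<omega> in M. lag_sum F F J P U c \<omega> ^ 4 \<le> ?R \<omega>"
    using AE_a_range
  proof eventually_elim
    case (elim \<omega>)
    have a1: "0 \<le> a i \<omega> ^ n \<and> a i \<omega> ^ n \<le> 1" for i n
      using elim[rule_format, of i] by (auto intro: power_le_one)
    have "lag_sum F F J P U c \<omega> = (\<Sum>x\<in>J \<times> P. a (fst x) \<omega> ^ fst (snd x) * a (fst x + s) \<omega> ^ snd (snd x) * ?q x \<omega>)"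
      unfolding lag_sum_def lag_term_def lag_inner_def by (simp add: sum.cartesian_product' sum_distrib_left mult_ac)
    also have "\<bar>\<dots>\<bar> \<le> (\<Sum>x\<in>J \<times> P. \<bar>?q x \<omega>\<bar>)"
    proof (rule order_trans[OF sum_abs sum_mono])
      fix x
      have "\<bar>a (fst x) \<omega> ^ fst (snd x) * a (fst x + s) \<omega> ^ snd (snd x)\<bar> \<le> 1"
        using a1 by (simp add: abs_mult mult_le_one)
      then show "\<bar>a (fst x) \<omega> ^ fst (snd x) * a (fst x + s) \<omega> ^ snd (snd x) * ?q x \<omega>\<bar> \<le> \<bar>?q x \<omega>\<bar>"
        unfolding abs_mult[of _ "?q x \<omega>"] by (intro mult_left_le_one_le) auto
    qed
    finally have "\<bar>lag_sum F F J P U c \<omega>\<bar> ^ 4 \<le> (\<Sum>x\<in>J \<times> P. \<bar>?q x \<omega>\<bar>) ^ 4"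
      by (intro power_mono) auto
    also have "\<dots> \<le> real (card (J \<times> P)) ^ 3 * (\<Sum>x\<in>J \<times> P. \<bar>?q x \<omega>\<bar> ^ 4)"
      by (rule sum_power4_le)
    finally show ?case by simp
  qed
  have m: "lag_sum F F J P U c \<in> borel_measurable M" by (rule lag_sum_measurable[OF F(1) F(1)])
  show i4: "integrable M (\<lambda>\<omega>. lag_sum F F J P U c \<omega> ^ 4)"
  proof (rule Bochner_Integration.integrable_bound[OF iR])
    show "AE \<omega> in M. norm (lag_sum F F J P U c \<omega> ^ 4) \<le> norm (?R \<omega>)"
      using le by eventually_elim simp
  qed (use m in simp)
  have "expectation (\<lambda>\<omega>. lag_sum F F J P U c \<omega> ^ 4) \<le> expectation ?R"
    by (rule integral_mono_AE[OF i4 iR le])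
  also have "\<dots> = real (card (J \<times> P)) ^ 3 * (\<Sum>x\<in>J \<times> P. expectation (\<lambda>\<omega>. ?q x \<omega> ^ 4))"
    using lag_inner_fourth_moment(1)[OF F U] by simp
  also have "\<dots> \<le> real (card (J \<times> P)) ^ 3 * (\<Sum>x\<in>J \<times> P. 3 * (K ^ 4 * energy U c)\<^sup>2)"
    by (intro mult_left_mono sum_mono lag_inner_fourth_moment(2)[OF F U]) auto
  also have "\<dots> = real (card J * card P) ^ 4 * (3 * (K ^ 4 * energy U c)\<^sup>2)"
    by (simp add: card_cartesian_product power4_eq_xxxx power3_eq_cube)
  finally show "expectation (\<lambda>\<omega>. lag_sum F F J P U c \<omega> ^ 4) \<le> real (card J * card P) ^ 4 * (3 * (K ^ 4 * energy U c)\<^sup>2)" .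
qed

lemma lag_sum_expectation:
  assumes F: "centred F"
  shows "expectation (lag_sum F F J P U c) = 0"
proof -
  have E: "integrable M (lag_term F F i kl u) \<and> expectation (lag_term F F i kl u) = 0" for i kl u
  proof -
    let ?\<alpha> = "\<lambda>\<omega>. a i \<omega> ^ fst kl * a (i + s) \<omega> ^ snd kl"
    let ?z = "\<zeta> F F (i, u - int (fst kl)) (i + s, u + t - int (snd kl))"
    have ind: "indep_var borel ?\<alpha> borel ?z"
    proof (rule indep_var_Gen[of "range Inr" "range Inl"])
      show "?\<alpha> \<in> borel_measurable (Gen (range Inr))"
        by (intro borel_measurable_times borel_measurable_power a_Gen) auto
      show "?z \<in> borel_measurable (Gen (range Inl))"
        using F by (intro \<zeta>_Gen) auto
    qed auto
    have "indep_var borel (\<lambda>\<omega>. a i \<omega> ^ fst kl) borel (\<lambda>\<omega>. a (i + s) \<omega> ^ snd kl)"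
      using s_nonzero by (intro indep_var_a) auto
    from indep_var_integrable[OF this integrable_a_power integrable_a_power]
    have \<alpha>: "integrable M ?\<alpha>" .
    have "(i, u - int (fst kl)) \<noteq> (i + s, u + t - int (snd kl))" using s_nonzero by simp
    from indep_var_lebesgue_integral[OF ind \<alpha> \<zeta>_expectation(1)[OF F F this]]
      indep_var_integrable[OF ind \<alpha> \<zeta>_expectation(1)[OF F F this]] \<zeta>_expectation(2)[OF F F this]
    show ?thesis by (simp add: lag_term_def[abs_def])
  qed
  then show ?thesis
    unfolding lag_sum_def by (simp add: Bochner_Integration.integral_sum integrable_sum)
qed

end

lemma abs_exp_diff_le:
  fixes x y :: real
  assumes "0 \<le> x" "0 \<le> y"
  shows "\<bar>exp (- x) - exp (- y)\<bar> \<le> \<bar>x - y\<bar>"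
proof -
  have le: "exp (- x) - exp (- y) \<le> y - x" if "0 \<le> x" "x \<le> y" for x y :: real
  proof -
    have "exp (- x) - exp (- y) = exp (- x) * (1 - exp (- (y - x)))" by (simp add: right_diff_distrib exp_add[symmetric])
    also have "\<dots> \<le> 1 * (y - x)"
    proof (rule mult_mono)
      show "1 - exp (- (y - x)) \<le> y - x" using exp_ge_add_one_self[of "- (y - x)"] by linarith
    qed (use that in auto)
    finally show ?thesis by simp
  qed
  show ?thesis
    using le[of x y] le[of y x] assms by (cases "x \<le> y") (auto simp: abs_if)
qed

section \<open>Blocks of rows\<close>

text \<open>Block \<open>b\<close> consists of \<open>L\<close> consecutive rows without the last \<open>\<bar>s\<bar>\<close>, so that different
  blocks involve disjoint sets of variables.\<close>

context panel_mixing
begin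

definition block :: "nat \<Rightarrow> nat \<Rightarrow> int set" where
  "block L b = {int b * int L + 1 .. int b * int L + int L - \<bar>s\<bar>}"

definition row_of :: "(int \<times> int) + int \<Rightarrow> int" where
  "row_of j = (case j of Inl (i, u) \<Rightarrow> i | Inr i \<Rightarrow> i)"

text \<open>The rows \<open>i\<close> and \<open>i + s\<close> for \<open>i\<close> in a block fill
  a window of exactly \<open>L\<close> rows. For negative \<open>s\<close> it begins below the
  block, and subtracting \<open>1 + min 0 s\<close> aligns it with the multiples of
  \<open>L\<close>.\<close>

definition block_vars :: "nat \<Rightarrow> nat \<Rightarrow> ((int \<times> int) + int) set" where
  "block_vars L b = {j. (row_of j - 1 - min 0 s) div int L = int b}"

lemma block_rows:
  assumes "L > 0" "i \<in> block L b"
  shows "(i - 1 - min 0 s) div int L = int b" "(i + s - 1 - min 0 s) div int L = int b"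
proof -
  have div: "(x :: int) div int L = int b" if "int b * int L \<le> x" "x < int b * int L + int L" for x
    by (rule int_div_pos_eq[of _ _ _ "x - int b * int L"]) (use that in \<open>auto simp: mult.commute\<close>)
  show "(i - 1 - min 0 s) div int L = int b" "(i + s - 1 - min 0 s) div int L = int b"
    using assms by (intro div; auto simp: block_def min_def abs_if split: if_splits)+
qed

lemma disjoint_block_vars: "disjoint_family_on (block_vars L) A"
  by (auto simp: disjoint_family_on_def block_vars_def)

lemma lag_sum_block_Gen:
  assumes F: "centred F" and L: "L > 0"
  shows "lag_sum F F (block L b) P U c \<in> borel_measurable (Gen (block_vars L b))"
  unfolding lag_sum_def lag_term_def
proof (intro borel_measurable_sum borel_measurable_times borel_measurable_const borel_measurable_power a_Gen \<zeta>_Gen F)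
  fix i assume i: "i \<in> block L b"
  show "Inr i \<in> block_vars L b" "Inr (i + s) \<in> block_vars L b"
    "Inl (i, u) \<in> block_vars L b" "Inl (i + s, u) \<in> block_vars L b" for u
    using block_rows[OF L i] by (auto simp: block_vars_def row_of_def algebra_simps)
qed

lemma finite_block: "finite (block L b)"
  by (simp add: block_def)

lemma card_block: "nat \<bar>s\<bar> \<le> L \<Longrightarrow> card (block L b) = L - nat \<bar>s\<bar>"
  by (simp add: block_def nat_diff_distrib)

lemma disjoint_blocks: "b \<noteq> b' \<Longrightarrow> L > 0 \<Longrightarrow> block L b \<inter> block L b' = {}"
  using block_rows(1)[of L] by (metis disjoint_iff of_nat_eq_iff)

lemma block_subset: "b < N div L \<Longrightarrow> block L b \<subseteq> {1..int N}"
proof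
  fix i assume b: "b < N div L" and i: "i \<in> block L b"
  have "(b + 1) * L \<le> (N div L) * L" using b by (intro mult_right_mono) auto
  also have "\<dots> \<le> N" by simp
  finally have "int ((b + 1) * L) \<le> int N" by (simp only: of_nat_le_iff)
  moreover have "int ((b + 1) * L) = int b * int L + int L" by (simp add: distrib_right)
  moreover have "0 \<le> int b * int L" by simp
  moreover have "int b * int L + 1 \<le> i" "i \<le> int b * int L + int L - \<bar>s\<bar>"
    using i by (simp_all add: block_def)
  ultimately show "i \<in> {1..int N}" unfolding atLeastAtMost_iff by linarith
qed

lemma lag_sum_blocks:
  assumes "L > 0"
  shows "(\<Sum>b<k. lag_sum F F (block L b) P U c \<omega>) = lag_sum F F (\<Union>b<k. block L b) P U c \<omega>"
  unfolding lag_sum_def using assms disjoint_blocks finite_block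
  by (subst sum.UNION_disjoint) auto

lemma card_blocks:
  assumes "L > 0" "nat \<bar>s\<bar> \<le> L"
  shows "card (\<Union>b<k. block L b) = k * (L - nat \<bar>s\<bar>)"
  using assms disjoint_blocks finite_block
  by (subst card_UN_disjoint) (auto simp: card_block)

lemma lag_sum_remove:
  assumes "finite I" "J \<subseteq> I"
  shows "lag_sum F F I P U c \<omega> - lag_sum F F J P U c \<omega> = lag_sum F F (I - J) P U c \<omega>"
  unfolding lag_sum_def using assms by (simp add: sum_diff)

section \<open>The central limit theorem for sums over rows\<close>

text \<open>The blocks are independent with common variance \<open>w\<close>, and all factors have
  modulus at most 1, so the distance of the products is at most the sum of the distances of the
  factors. The bound uses \<open>D\<close> in place of the energy to be free of n.\<close>

lemma blocks_char:
  fixes c :: "int \<Rightarrow> real" and x :: real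
  assumes F: "centred F" "\<And>x. \<bar>F x\<bar> \<le> K" and U: "finite U" and supp: "\<And>u. u \<notin> U \<Longrightarrow> c u = 0"
    and P: "finite P" and L: "L > nat \<bar>s\<bar>" and D: "energy U c \<le> D"
    and w: "w = real (L - nat \<bar>s\<bar>) * (second_moment F * second_moment F * lag_form P (autocorr U c))"
  shows "cmod (cf (lag_sum F F (\<Union>b<k. block L b) P U c) x - complex_of_real (exp (- (real k * (x\<^sup>2 * w / 2)))))
    \<le> real k * (\<bar>x\<bar> ^ 3 * (1 + real (L * card P) ^ 4 * (3 * (K ^ 4 * D)\<^sup>2)) + (x\<^sup>2 * w / 2)\<^sup>2)"
proof -
  let ?W = "\<lambda>b. lag_sum F F (block L b) P U c"
  let ?C = "real (L * card P) ^ 4 * (3 * (K ^ 4 * D)\<^sup>2)"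
  have L0: "L > 0" using L by simp
  have Wm: "?W b \<in> borel_measurable M" for b by (rule lag_sum_measurable[OF F(1) F(1)])
  have i2: "sq_integrable (?W b)" for b
    by (rule lag_sum_second_moment(1)[OF F(1) F(1) U supp])
  have E2: "mean_sq (?W b) = w" for b
  proof -
    have "mean_sq (?W b) = card (block L b) * (second_moment F * second_moment F) * lag_form P (autocorr U c)"
      by (rule lag_sum_second_moment(2)[OF F(1) F(1) U supp])
    then show ?thesis using L by (simp add: w card_block)
  qed
  have w0: "0 \<le> w" unfolding E2[of 0, symmetric] by simp
  have E4: "expectation (\<lambda>\<omega>. ?W b \<omega> ^ 4) \<le> ?C" for b
  proof -
    have "expectation (\<lambda>\<omega>. ?W b \<omega> ^ 4) \<le> real (card (block L b) * card P) ^ 4 * (3 * (K ^ 4 * energy U c)\<^sup>2)"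
      by (rule lag_sum_fourth_moment(2)[OF F U finite_block P])
    also have "\<dots> \<le> ?C"
    proof (intro mult_mono power_mono)
      show "real (card (block L b) * card P) \<le> real (L * card P)"
        using L by (auto simp: card_block intro!: mult_right_mono)
    qed (use D F(2)[of 0] in \<open>auto intro!: mult_nonneg_nonneg sum_nonneg mult_left_mono\<close>)
    finally show ?thesis .
  qed
  have close: "cmod (cf (?W b) x - complex_of_real (exp (- (x\<^sup>2 * w / 2)))) \<le> \<bar>x\<bar> ^ 3 * (1 + ?C) + (x\<^sup>2 * w / 2)\<^sup>2" for b
    by (rule iexp_gaussian_approx[OF Wm lag_sum_fourth_moment(1)[OF F U finite_block P] E4 i2 lag_sum_expectation[OF F(1)] E2])
  have ind: "indep_vars (\<lambda>_. borel) (\<lambda>b \<omega>. x * ?W b \<omega>) {..<k}"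
    by (rule indep_vars_generated_by[OF indep_V disjoint_block_vars[of L]])
       (intro borel_measurable_times borel_measurable_const lag_sum_block_Gen[OF F(1) L0])
  have "x * lag_sum F F (\<Union>b<k. block L b) P U c \<omega> = (\<Sum>b<k. x * ?W b \<omega>)" for \<omega>
    by (simp only: lag_sum_blocks[OF L0, symmetric] sum_distrib_left)
  then have prod: "cf (lag_sum F F (\<Union>b<k. block L b) P U c) x = (\<Prod>b<k. \<integral>\<omega>. iexp (x * ?W b \<omega>) \<partial>M)"
    by (simp only: iexp_sum_indep[OF prob_space_axioms ind])
  have exp_prod: "complex_of_real (exp (- (real k * (x\<^sup>2 * w / 2)))) = (\<Prod>b<k. complex_of_real (exp (- (x\<^sup>2 * w / 2))))"
    by (simp add: exp_of_nat_mult[symmetric] flip: of_real_power)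
  have "cmod ((\<Prod>b<k. \<integral>\<omega>. iexp (x * ?W b \<omega>) \<partial>M) - (\<Prod>b<k. complex_of_real (exp (- (x\<^sup>2 * w / 2)))))
    \<le> (\<Sum>b<k. cmod (cf (?W b) x - complex_of_real (exp (- (x\<^sup>2 * w / 2)))))"
  proof (rule norm_prod_diff)
    fix b
    have "cmod (cf (?W b) x) \<le> (\<integral>\<omega>. cmod (iexp (x * ?W b \<omega>)) \<partial>M)"
      by (rule integral_norm_bound)
    then show "cmod (cf (?W b) x) \<le> 1" by (simp only: norm_exp_i_times) (simp add: prob_space)
    show "cmod (complex_of_real (exp (- (x\<^sup>2 * w / 2)))) \<le> 1"
      unfolding norm_of_real using w0 by simp
  qed
  also have "\<dots> \<le> (\<Sum>b<k. \<bar>x\<bar> ^ 3 * (1 + ?C) + (x\<^sup>2 * w / 2)\<^sup>2)"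
    by (rule sum_mono) (rule close)
  finally show ?thesis unfolding prod exp_prod by simp
qed

lemma full_sum_second_moment:
  fixes c :: "int \<Rightarrow> real"
  assumes "finite U" "\<And>u. u \<notin> U \<Longrightarrow> c u = 0"
  shows "sq_integrable (full_sum I U c)"
    and "mean_sq (full_sum I U c) \<le> card I * energy U c * EA"
proof -
  \<comment> \<open>The cut-off 0 leaves no lags, so the approximation bound becomes a bound for the
    full sum.\<close>
  have 0: "id_sum I (lags 0) U c \<omega> = 0" "lag_mass (lags 0) = 0" for \<omega>
    by (simp_all add: lag_sum_def lags_def lag_form_def)
  show "sq_integrable (full_sum I U c)"
    using full_sum_approx(1)[of U c I 0] assms unfolding 0 by simp
  show "mean_sq (full_sum I U c) \<le> card I * energy U c * EA"
    using full_sum_approx(2)[of U c I 0] assms unfolding 0 by simp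
qed

text \<open>The autocorrelations at all fixed lags have the same limit, because a bounded shift in
  time is negligible. The form therefore factors in the limit.\<close>

lemma lag_form_tendsto:
  assumes "\<And>d. ((\<lambda>n. h n d) \<longlongrightarrow> q) F" "finite P"
  shows "((\<lambda>n. lag_form P (h n)) \<longlongrightarrow> q * lag_mass P) F"
proof -
  have "((\<lambda>n. lag_form P (h n)) \<longlongrightarrow> lag_form P (\<lambda>_. q)) F"
    unfolding lag_form_def split_beta by (intro tendsto_intros assms)
  also have "lag_form P (\<lambda>_. q) = q * lag_mass P"
    unfolding lag_form_def split_beta sum_distrib_left by (simp add: mult_ac)
  finally show ?thesis .
qed

text \<open>The four steps are the passage to truncated lag sums, the removal of rows outside the
  blocks, the Gaussian approximation of the blocks, and the change of variance to \<open>Q\<close>.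
  Here \<open>v\<close> is the variance per row of the truncated sum and \<open>g\<close> bounds the
  fraction of removed rows. No term depends on n except through \<open>v\<close>.\<close>

lemma row_sum_char_error:
  fixes c :: "int \<Rightarrow> real" and N :: nat
  assumes U: "finite U" and supp: "\<And>u. u \<notin> U \<Longrightarrow> c u = 0" and D: "energy U c \<le> D"
    and L: "L > nat \<bar>s\<bar>" and N: "N > 0"
    and approx: "sq_integrable (approx_error R m {1..int N} U c)"
      "mean_sq (approx_error R m {1..int N} U c)
        \<le> card {1..int N} * energy U c * e"
    and e: "0 \<le> e"
    and v: "v = second_moment (trunc R) * second_moment (trunc R) * lag_form (lags m) (autocorr U c)"
    and g: "g = real L / real N + real_of_int \<bar>s\<bar> / real L"
    and C: "C = real (L * card (lags m)) ^ 4 * (3 * ((2 * real R) ^ 4 * D)\<^sup>2)"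
    and Q: "0 \<le> Q"
  shows "cmod (cf (full_sum {1..int N} U c) (real N powr (-1/2)) - complex_of_real (exp (- (Q / 2))))
    \<le> sqrt (D * e) + sqrt (D * EA * g) + ((1 + C) * real N powr (-1/2) + (real L * (D * EA))\<^sup>2 / real N)
      + (D * EA * g + \<bar>v - Q\<bar>) / 2"
proof -
  let ?F = "trunc R" and ?P = "lags m" and ?x = "real N powr (-1/2)"
  let ?I = "{1..int N}"
  let ?k = "N div L"
  let ?J = "\<Union>b<?k. block L b"
  let ?h = "real (L - nat \<bar>s\<bar>)"
  note cF = centred_trunc[of R]
  have x: "?x > 0" "?x ^ 2 = 1 / real N" using N by (auto simp: power2_eq_square powr_add[symmetric] powr_minus_divide)
  have c20: "0 \<le> energy U c" by (simp add: sum_nonneg)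
  have D0: "0 \<le> D" using D c20 by linarith
  have L0: "L > 0" "nat \<bar>s\<bar> \<le> L" using L by auto
  have cardI: "card ?I = N" by simp
  have JI: "?J \<subseteq> ?I" using block_subset by fastforce
  have cardJ: "card ?J = ?k * (L - nat \<bar>s\<bar>)" by (rule card_blocks[OF L0])
  \<comment> \<open>The removed rows are the \<open>N mod L\<close> rows after the last full block
    and \<open>\<bar>s\<bar>\<close> rows for each of the at most N / L blocks.\<close>
  have rest: "0 \<le> real N - real ?k * ?h" "(real N - real ?k * ?h) / real N \<le> g"
  proof -
    have Nk: "real N = real ?k * real L + real (N mod L)"
      by (metis div_mult_mod_eq of_nat_add of_nat_mult)
    have "real N - real ?k * ?h = real (N mod L) + real ?k * real_of_int \<bar>s\<bar>"
      using L0 unfolding Nk by (simp add: of_nat_diff algebra_simps)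
    moreover have "real (N mod L) \<le> real L" using L0 by simp
    moreover have "real ?k * real_of_int \<bar>s\<bar> \<le> real N / real L * real_of_int \<bar>s\<bar>"
      using of_nat_div_le_of_nat[of N L, where 'a = real] by (intro mult_right_mono) auto
    ultimately have *: "0 \<le> real N - real ?k * ?h" "real N - real ?k * ?h \<le> real L + real N / real L * real_of_int \<bar>s\<bar>"
      by auto
    have "(real N - real ?k * ?h) / real N \<le> (real L + real N / real L * real_of_int \<bar>s\<bar>) / real N"
      using *(2) N by (intro divide_right_mono) auto
    also have "\<dots> = g" using N by (simp add: g add_divide_distrib)
    finally show "0 \<le> real N - real ?k * ?h" "(real N - real ?k * ?h) / real N \<le> g" using * by auto
  qed
  have sm: "0 \<le> second_moment ?F * second_moment ?F" "second_moment ?F * second_moment ?F \<le> 1"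
    using second_moment_nonneg[of ?F] second_moment_trunc_le[of R] by (auto intro: mult_le_one)
  have G: "0 \<le> lag_mass ?P" "lag_mass ?P \<le> EA" by (rule lag_form_nonneg, rule lag_form_le_EA)
  have DEA: "0 \<le> D * EA" using D0 EA_nonneg by simp

  have 1: "cmod (cf (full_sum ?I U c) ?x - cf (lag_sum ?F ?F ?I ?P U c) ?x) \<le> sqrt (D * e)"
  proof -
    have "cmod (cf (full_sum ?I U c) ?x - cf (lag_sum ?F ?F ?I ?P U c) ?x)
      \<le> \<bar>?x\<bar> * sqrt (real N * (D * e))"
    proof (rule iexp_diff_le[OF full_sum_measurable lag_sum_measurable[OF cF cF] approx(1)])
      have "card ?I * energy U c * e \<le> real N * (D * e)"
        unfolding cardI using D e by (simp add: mult.assoc mult_left_mono mult_right_mono)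
      then show "mean_sq (\<lambda>\<omega>. full_sum ?I U c \<omega> - lag_sum ?F ?F ?I ?P U c \<omega>) \<le> real N * (D * e)"
        using approx(2) by linarith
    qed
    also have "\<dots> = sqrt (?x ^ 2 * (real N * (D * e)))" by (simp add: real_sqrt_mult)
    also have "?x ^ 2 * (real N * (D * e)) = D * e" unfolding x(2) using N by simp
    finally show ?thesis .
  qed
  have 2: "cmod (cf (lag_sum ?F ?F ?I ?P U c) ?x - cf (lag_sum ?F ?F ?J ?P U c) ?x) \<le> sqrt (D * EA * g)"
  proof -
    let ?r = "real N - real ?k * ?h"
    have diff: "lag_sum ?F ?F ?I ?P U c \<omega> - lag_sum ?F ?F ?J ?P U c \<omega> = lag_sum ?F ?F (?I - ?J) ?P U c \<omega>" for \<omega>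
      by (rule lag_sum_remove[OF _ JI]) simp
    have int: "sq_integrable (lag_sum ?F ?F (?I - ?J) ?P U c)"
      by (rule lag_sum_second_moment(1)[OF cF cF U supp])
    have card_rest: "real (card (?I - ?J)) = ?r"
    proof -
      have "card (?I - ?J) = card ?I - card ?J" using JI by (intro card_Diff_subset finite_subset[OF JI]) auto
      moreover have "card ?J \<le> card ?I" using JI by (intro card_mono) auto
      ultimately show ?thesis unfolding cardI cardJ by (simp add: of_nat_diff)
    qed
    have "mean_sq (lag_sum ?F ?F (?I - ?J) ?P U c)
       \<le> card (?I - ?J) * (second_moment ?F * second_moment ?F) * (energy U c * lag_mass ?P)"
      by (rule lag_sum_second_moment_le[OF cF cF U supp])
    also have "\<dots> \<le> (?r * 1) * (D * EA)"
      unfolding card_rest using rest(1) sm G D c20 D0 EA_nonneg second_moment_nonneg by (intro mult_mono mult_nonneg_nonneg) auto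
    finally have b: "mean_sq (lag_sum ?F ?F (?I - ?J) ?P U c) \<le> ?r * (D * EA)" by simp
    have "cmod (cf (lag_sum ?F ?F ?I ?P U c) ?x - cf (lag_sum ?F ?F ?J ?P U c) ?x)
      \<le> \<bar>?x\<bar> * sqrt (?r * (D * EA))"
      by (rule iexp_diff_le) (unfold diff, rule lag_sum_measurable[OF cF cF], rule lag_sum_measurable[OF cF cF], rule int, rule b)
    also have "\<dots> = sqrt (?x ^ 2 * (?r * (D * EA)))" by (simp add: real_sqrt_mult)
    also have "\<dots> \<le> sqrt (D * EA * g)"
    proof (rule real_sqrt_le_mono)
      have "?x ^ 2 * (?r * (D * EA)) = ?r / real N * (D * EA)" unfolding x(2) by simp
      also have "\<dots> \<le> g * (D * EA)" using rest(2) DEA by (rule mult_right_mono)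
      finally show "?x ^ 2 * (?r * (D * EA)) \<le> D * EA * g" by (simp add: mult.commute)
    qed
    finally show ?thesis .
  qed
  define w where "w = ?h * v"
  have v_bound: "0 \<le> v" "v \<le> D * EA"
  proof -
    \<comment> \<open>The autocorrelations may be negative, so the sign of \<open>v\<close> is read
      off from its meaning as the second moment of a single row.\<close>
    have single: "mean_sq (lag_sum ?F ?F {0} ?P U c) = card {0::int} * (second_moment ?F * second_moment ?F) * lag_form ?P (autocorr U c)"
      by (rule lag_sum_second_moment(2)[OF cF cF U supp])
    also have "\<dots> = v" by (simp add: v)
    finally have "v = mean_sq (lag_sum ?F ?F {0} ?P U c)" by simp
    then show "0 \<le> v" by simp
    have "\<bar>autocorr U c d\<bar> \<le> D" for d
      by (rule order_trans[OF abs_autocorr_le[OF U supp] D])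
    from lag_form_bound[of "autocorr U c", OF this, of ?P] have "lag_form ?P (autocorr U c) \<le> D * lag_mass ?P" by linarith
    also have "\<dots> \<le> D * EA" using G D0 by (intro mult_left_mono) auto
    finally have le: "lag_form ?P (autocorr U c) \<le> D * EA" .
    have "v \<le> second_moment ?F * second_moment ?F * (D * EA)" unfolding v using le sm(1) by (rule mult_left_mono)
    also have "\<dots> \<le> 1 * (D * EA)" using sm(2) DEA by (rule mult_right_mono)
    finally show "v \<le> D * EA" by simp
  qed
  have w_bound: "0 \<le> w" "w \<le> real L * (D * EA)"
    unfolding w_def using v_bound by (auto intro!: mult_mono)
  have 3: "cmod (cf (lag_sum ?F ?F ?J ?P U c) ?x - complex_of_real (exp (- (real ?k * (?x\<^sup>2 * w / 2)))))
     \<le> (1 + C) * ?x + (real L * (D * EA))\<^sup>2 / real N"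
  proof -
    have "cmod (cf (lag_sum ?F ?F ?J ?P U c) ?x - complex_of_real (exp (- (real ?k * (?x\<^sup>2 * w / 2)))))
      \<le> real ?k * (\<bar>?x\<bar> ^ 3 * (1 + C) + (?x\<^sup>2 * w / 2)\<^sup>2)"
      unfolding C
    proof (rule blocks_char[where F = ?F])
      show "\<bar>trunc R y\<bar> \<le> 2 * real R" for y using abs_trunc_le[of R y] by simp
    qed (use cF U supp finite_lags L D in \<open>auto simp: w_def v\<close>)
    also have "\<dots> \<le> real N * (\<bar>?x\<bar> ^ 3 * (1 + C) + (?x\<^sup>2 * w / 2)\<^sup>2)"
    proof (rule mult_right_mono)
      have "0 \<le> C" unfolding C by simp
      then show "0 \<le> \<bar>?x\<bar> ^ 3 * (1 + C) + (?x\<^sup>2 * w / 2)\<^sup>2" by (intro add_nonneg_nonneg mult_nonneg_nonneg) auto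
    qed simp
    also have "\<dots> = (1 + C) * ?x + w\<^sup>2 / 4 / real N"
    proof -
      have "real N * \<bar>?x\<bar> ^ 3 = ?x"
      proof -
        have "\<bar>?x\<bar> ^ 3 = ?x ^ 2 * ?x" by (simp add: power3_eq_cube power2_eq_square)
        then show ?thesis unfolding x(2) using N by simp
      qed
      moreover have "real N * (?x\<^sup>2 * w / 2)\<^sup>2 = w\<^sup>2 / 4 / real N"
        unfolding x(2) using N by (simp add: power2_eq_square)
      ultimately show ?thesis by (simp add: distrib_left mult.assoc[symmetric], simp add: algebra_simps)
    qed
    also have "\<dots> \<le> (1 + C) * ?x + (real L * (D * EA))\<^sup>2 / real N"
    proof -
      have "w\<^sup>2 \<le> (real L * (D * EA))\<^sup>2" using w_bound by (intro power_mono)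
      then have "w\<^sup>2 / 4 \<le> (real L * (D * EA))\<^sup>2" using zero_le_power2[of w] by linarith
      then show ?thesis using N by (intro add_left_mono divide_right_mono) auto
    qed
    finally show ?thesis .
  qed
  have 4: "cmod (complex_of_real (exp (- (real ?k * (?x\<^sup>2 * w / 2)))) - complex_of_real (exp (- (Q / 2)))) \<le> (D * EA * g + \<bar>v - Q\<bar>) / 2"
  proof -
    let ?y = "real ?k * (?x\<^sup>2 * w / 2)"
    have y: "?y = (real ?k * ?h / real N * v) / 2" unfolding x(2) w_def by simp
    have "cmod (complex_of_real (exp (- ?y)) - complex_of_real (exp (- (Q / 2)))) = \<bar>exp (- ?y) - exp (- (Q / 2))\<bar>"
      by (simp only: of_real_diff[symmetric] norm_of_real real_norm_def)
    also have "\<dots> \<le> \<bar>?y - Q / 2\<bar>" using w_bound Q by (intro abs_exp_diff_le) auto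
    also have "\<dots> = \<bar>real ?k * ?h / real N * v - Q\<bar> / 2" 
    proof -
      have "\<bar>z / 2 - Q / 2\<bar> = \<bar>z - Q\<bar> / 2" for z :: real
        by (simp only: diff_divide_distrib[symmetric] abs_divide abs_numeral)
      then show ?thesis unfolding y .
    qed
    also have "\<dots> \<le> (D * EA * g + \<bar>v - Q\<bar>) / 2"
    proof -
      let ?r = "(real N - real ?k * ?h) / real N"
      have "real ?k * ?h / real N = 1 - ?r" using N by (simp add: diff_divide_distrib)
      then have "real ?k * ?h / real N * v - Q = (v - Q) - v * ?r" by (simp only:) (simp add: algebra_simps)
      moreover have "0 \<le> v * ?r" using v_bound rest by simp
      moreover have "v * ?r \<le> D * EA * g" using v_bound rest DEA by (intro mult_mono) auto
      moreover have "\<bar>y\<bar> \<le> b + \<bar>z\<bar>" if "y = z - u" "0 \<le> u" "u \<le> b" for y z u b :: real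
        using that by linarith
      ultimately have "\<bar>real ?k * ?h / real N * v - Q\<bar> \<le> D * EA * g + \<bar>v - Q\<bar>" by blast
      then show ?thesis by simp
    qed
    finally show ?thesis .
  qed
  have tri: "cmod (z1 - z5) \<le> b1 + b2 + b3 + b4"
    if "cmod (z1 - z2) \<le> b1" "cmod (z2 - z3) \<le> b2" "cmod (z3 - z4) \<le> b3" "cmod (z4 - z5) \<le> b4" for z1 z2 z3 z4 z5 b1 b2 b3 b4
  proof -
    have "cmod (z1 - z5) \<le> cmod (z1 - z2) + cmod (z2 - z3) + cmod (z3 - z4) + cmod (z4 - z5)"
      using norm_triangle_ineq[of "z1 - z2" "z2 - z5"] norm_triangle_ineq[of "z2 - z3" "z3 - z5"] norm_triangle_ineq[of "z3 - z4" "z4 - z5"]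
      by simp
    then show ?thesis using that by linarith
  qed
  show ?thesis by (rule tri[OF 1 2 3 4])
qed

end

section \<open>Counting shifted time points, and the laws of marginals\<close>

abbreviation overlap :: "int \<Rightarrow> real \<Rightarrow> real \<Rightarrow> int set" where
  "overlap d x y \<equiv> {1..\<lfloor>x\<rfloor>} \<inter> {1 - d..\<lfloor>y\<rfloor> - d}"

lemma overlap_count:
  fixes x y :: real and d :: int
  assumes "0 \<le> x" "0 \<le> y"
  shows "\<bar>real (card (overlap d x y)) - min x y\<bar> \<le> 2 * \<bar>d\<bar> + 2"
proof -
  have eq: "overlap d x y = {max 1 (1 - d)..min \<lfloor>x\<rfloor> (\<lfloor>y\<rfloor> - d)}" by auto
  \<comment> \<open>The length of the interval, negative if the shift makes it empty. Raising it to
    0 then only moves it closer to the nonnegative \<open>min x y\<close>.\<close>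
  define z where "z = min \<lfloor>x\<rfloor> (\<lfloor>y\<rfloor> - d) + 1 - max 1 (1 - d)"
  have card: "real (card (overlap d x y)) = real_of_int (max 0 z)"
    unfolding eq z_def by (simp add: max_def)
  have fl: "real_of_int \<lfloor>x\<rfloor> \<le> x" "x < real_of_int \<lfloor>x\<rfloor> + 1" "real_of_int \<lfloor>y\<rfloor> \<le> y" "y < real_of_int \<lfloor>y\<rfloor> + 1" by linarith+
  have "\<bar>z - min \<lfloor>x\<rfloor> \<lfloor>y\<rfloor>\<bar> \<le> 2 * \<bar>d\<bar>" unfolding z_def by (simp add: min_def max_def)
  then have "\<bar>real_of_int z - real_of_int (min \<lfloor>x\<rfloor> \<lfloor>y\<rfloor>)\<bar> \<le> real_of_int (2 * \<bar>d\<bar>)"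
    by (metis of_int_abs of_int_diff of_int_le_iff)
  moreover have "real_of_int (min \<lfloor>x\<rfloor> \<lfloor>y\<rfloor>) \<le> min x y" "min x y < real_of_int (min \<lfloor>x\<rfloor> \<lfloor>y\<rfloor>) + 1"
  proof -
    have "real_of_int (min \<lfloor>x\<rfloor> \<lfloor>y\<rfloor>) = min (real_of_int \<lfloor>x\<rfloor>) (real_of_int \<lfloor>y\<rfloor>)"
      by (simp add: min_def)
    then show "real_of_int (min \<lfloor>x\<rfloor> \<lfloor>y\<rfloor>) \<le> min x y" "min x y < real_of_int (min \<lfloor>x\<rfloor> \<lfloor>y\<rfloor>) + 1"
      using fl by linarith+
  qed
  ultimately have *: "\<bar>real_of_int z - min x y\<bar> \<le> real_of_int (2 * \<bar>d\<bar>) + 1" by linarith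
  have "0 \<le> min x y" using assms by simp
  with * have "\<bar>real_of_int (max 0 z) - min x y\<bar> \<le> real_of_int (2 * \<bar>d\<bar>) + 1"
  proof (cases "0 \<le> z")
    case False
    then have "real_of_int z \<le> 0" "max 0 z = 0" by simp_all
    with * \<open>0 \<le> min x y\<close> show ?thesis by (simp add: abs_le_iff)
  qed (simp add: max_def)
  then show ?thesis unfolding card by simp
qed

lemma fdd_law_char:
  assumes "\<And>\<tau>. \<tau> \<in> T \<Longrightarrow> Z \<tau> \<in> borel_measurable K"
  shows "(\<integral>x. iexp (dot T \<theta> x) \<partial>fdd_law K Z T) = (\<integral>\<omega>. iexp (\<Sum>\<tau>\<in>T. \<theta> \<tau> * Z \<tau> \<omega>) \<partial>K)"
proof -
  have Zm: "(\<lambda>\<omega>. \<lambda>\<tau>\<in>T. Z \<tau> \<omega>) \<in> measurable K (borel_on T)"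
    by (rule measurable_restrict) (rule assms)
  have sm: "(\<lambda>x. dot T \<theta> x) \<in> borel_measurable (borel_on T)"
    by (intro borel_measurable_sum borel_measurable_times borel_measurable_const measurable_component_singleton)
  have "(\<lambda>x. iexp (dot T \<theta> x)) \<in> borel_measurable (borel_on T)"
    using sm by measurable
  then have "(\<integral>x. iexp (dot T \<theta> x) \<partial>fdd_law K Z T) = (\<integral>\<omega>. iexp (\<Sum>\<tau>\<in>T. \<theta> \<tau> * (\<lambda>\<tau>\<in>T. Z \<tau> \<omega>) \<tau>) \<partial>K)"
    unfolding fdd_law_def by (rule integral_distr[OF Zm])
  also have "\<dots> = (\<integral>\<omega>. iexp (\<Sum>\<tau>\<in>T. \<theta> \<tau> * Z \<tau> \<omega>) \<partial>K)"
    by (intro Bochner_Integration.integral_cong refl arg_cong[where f = iexp] sum.cong) simp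
  finally show ?thesis .
qed

lemma fdd_law_prob_space:
  assumes "prob_space K" "\<And>\<tau>. \<tau> \<in> T \<Longrightarrow> Z \<tau> \<in> borel_measurable K"
  shows "prob_space (fdd_law K Z T)"
  unfolding fdd_law_def
  by (rule prob_space.prob_space_distr[OF assms(1)]) (rule measurable_restrict, rule assms(2))

context panel_mixing
begin

text \<open>The hypothesis \<open>q\<close> demands one limit for all lags d; at d = 0 it concerns
  the energy. The limiting variance is then q times the limit of the masses.\<close>

lemma row_sum_char_limit:
  fixes U :: "nat \<Rightarrow> int set" and c :: "nat \<Rightarrow> int \<Rightarrow> real"
  assumes U: "\<And>n. finite (U n)" and supp: "\<And>n u. u \<notin> U n \<Longrightarrow> c n u = 0"
    and q: "\<And>d. (\<lambda>n. autocorr (U n) (c n) d) \<longlonglongrightarrow> q"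
  shows "((\<lambda>(N, n). \<integral>\<omega>. iexp (real N powr (-1/2) * full_sum {1..int N} (U n) (c n) \<omega>) \<partial>M) \<longlongrightarrow>
    complex_of_real (exp (- (q * EA / 2)))) (sequentially \<times>\<^sub>F sequentially)"
proof (rule tendstoI)
  fix e :: real assume e: "e > 0"
  have sq: "(\<lambda>n. \<Sum>u\<in>U n. (c n u)\<^sup>2) \<longlonglongrightarrow> q"
    using q[of 0] by (simp add: autocorr_def power2_eq_square)
  have q0: "0 \<le> q" by (rule LIMSEQ_le_const[OF sq]) (auto intro!: sum_nonneg)
  \<comment> \<open>The energy tends to \<open>q\<close>, so \<open>D\<close> eventually bounds it
    and can replace it in every estimate.\<close>
  define D where "D = q + 1"
  have D: "D > 0" "q \<le> D" using q0 by (auto simp: D_def)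
  \<comment> \<open>The errors at the end add up to 4 e1 + 3 e1 / 2, which is below 7 e1.\<close>
  define e1 where "e1 = e / 7"
  have e1: "e1 > 0" "7 * e1 = e" using e by (auto simp: e1_def)
  \<comment> \<open>The same quantity \<open>K * g\<close> occurs under a square root and linearly,
    which calls for the smaller of both bounds.\<close>
  define \<eta> where "\<eta> = min (e1\<^sup>2) e1"
  have \<eta>: "\<eta> > 0" "\<eta> \<le> e1\<^sup>2" "\<eta> \<le> e1" using e1 by (auto simp: \<eta>_def)
  define \<delta> where "\<delta> = \<eta> / D"
  have \<delta>: "\<delta> > 0" "D * \<delta> = \<eta>" using \<eta> D by (auto simp: \<delta>_def)
  obtain m R where mR: "\<bar>second_moment (trunc R) * second_moment (trunc R) * lag_mass (lags m) - EA\<bar> \<le> \<delta>"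
    "uniformly_close R m \<delta>"
    by (rule exists_bounded_approximation[OF \<delta>(1)])
  let ?V = "second_moment (trunc R) * second_moment (trunc R)" and ?G = "lag_mass (lags m)"
  define v where "v n = ?V * lag_form (lags m) (autocorr (U n) (c n))" for n
  have "v \<longlonglongrightarrow> ?V * (q * ?G)"
    unfolding v_def by (intro tendsto_intros lag_form_tendsto q finite_lags)
  from tendstoD[OF this e1(1)]
  have ev_v: "\<forall>\<^sub>F n in sequentially. \<bar>v n - q * EA\<bar> \<le> 2 * e1"
  proof eventually_elim
    case (elim n)
    have "\<bar>?V * (q * ?G) - q * EA\<bar> = \<bar>q * (?V * ?G - EA)\<bar>" by (simp add: algebra_simps)
    also have "\<dots> \<le> D * \<delta>" unfolding abs_mult using mR(1) q0 D by (intro mult_mono) auto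
    also have "\<dots> \<le> e1" using \<delta> \<eta> by simp
    finally show ?case using elim unfolding dist_real_def by linarith
  qed
  have ev_D: "\<forall>\<^sub>F n in sequentially. (energy (U n) (c n)) \<le> D"
    using order_tendstoD(2)[OF sq, of D] by (auto simp: D_def elim!: eventually_mono)
  define K where "K = D * EA"
  have K0: "0 \<le> K" using D EA_nonneg by (simp add: K_def)
  \<comment> \<open>The gaps take up the fraction \<open>\<bar>s\<bar> / L\<close> of the rows
    however large N is, so only a large \<open>L\<close> makes them negligible. The incomplete last
    block is left to the limit in N.\<close>
  obtain L0 :: nat where L0: "2 * (K * \<bar>s\<bar>) / \<eta> < L0" using reals_Archimedean2 by blast
  define L where "L = L0 + nat \<bar>s\<bar> + 1"
  have L: "L > nat \<bar>s\<bar>" "L > 0" by (auto simp: L_def)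
  have Ls: "K * (\<bar>s\<bar> / L) \<le> \<eta> / 2"
  proof -
    have "2 * (K * \<bar>s\<bar>) / \<eta> \<le> L" using L0 by (simp add: L_def)
    then have "2 * (K * \<bar>s\<bar>) \<le> \<eta> * L" using \<eta>(1) by (simp add: divide_le_eq mult.commute)
    then show ?thesis using L by (simp add: field_simps)
  qed
  define C where "C = real (L * card (lags m)) ^ 4 * (3 * ((2 * real R) ^ 4 * D)\<^sup>2)"
  have "(\<lambda>N. K * (real L / real N)) \<longlonglongrightarrow> K * 0"
    by (intro tendsto_intros lim_const_over_n)
  then have "(\<lambda>N. K * (real L / real N)) \<longlonglongrightarrow> 0" by simp
  then have ev1: "\<forall>\<^sub>F N in sequentially. K * (real L / real N) < \<eta> / 2"
    by (rule order_tendstoD) (use \<eta> in simp)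
  have "(\<lambda>N. (1 + C) * real N powr (-1/2)) \<longlonglongrightarrow> (1 + C) * 0"
    by (intro tendsto_intros tendsto_neg_powr filterlim_real_sequentially) simp
  then have "(\<lambda>N. (1 + C) * real N powr (-1/2)) \<longlonglongrightarrow> 0" by simp
  then have ev2: "\<forall>\<^sub>F N in sequentially. (1 + C) * real N powr (-1/2) < e1"
    by (rule order_tendstoD) (use e1 in simp)
  have "(\<lambda>N. (real L * K)\<^sup>2 / real N) \<longlonglongrightarrow> 0" by (rule lim_const_over_n)
  then have ev3: "\<forall>\<^sub>F N in sequentially. (real L * K)\<^sup>2 / real N < e1"
    by (rule order_tendstoD) (use e1 in simp)
  let ?P = "\<lambda>N. N > 0 \<and> K * (real L / real N) < \<eta> / 2 \<and> (1 + C) * real N powr (-1/2) < e1 \<and> (real L * K)\<^sup>2 / real N < e1"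
  let ?Q = "\<lambda>n. \<bar>v n - q * EA\<bar> \<le> 2 * e1 \<and> energy (U n) (c n) \<le> D"
  have "\<forall>\<^sub>F N in sequentially. ?P N"
    using eventually_gt_at_top[of 0] ev1 ev2 ev3 by eventually_elim auto
  moreover have "\<forall>\<^sub>F n in sequentially. ?Q n"
    using ev_v ev_D by eventually_elim auto
  ultimately have "\<forall>\<^sub>F x in sequentially \<times>\<^sub>F sequentially.
     ?P (fst x) \<and> ?Q (snd x)"
    by (rule eventually_prodI)
  then show "\<forall>\<^sub>F x in sequentially \<times>\<^sub>F sequentially.
      dist (case x of (N, n) \<Rightarrow> \<integral>\<omega>. iexp (real N powr (-1/2) * full_sum {1..int N} (U n) (c n) \<omega>) \<partial>M)
        (complex_of_real (exp (- (q * EA / 2)))) < e"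
  proof eventually_elim
    case (elim x)
    obtain N n where x: "x = (N, n)" by (cases x)
    have N: "N > 0" "K * (real L / real N) < \<eta> / 2" "(1 + C) * real N powr (-1/2) < e1" "(real L * K)\<^sup>2 / real N < e1"
      and n: "\<bar>v n - q * EA\<bar> \<le> 2 * e1" "energy (U n) (c n) \<le> D"
      using elim by (auto simp: x)
    define g where "g = real L / real N + real_of_int \<bar>s\<bar> / real L"
    have "K * g = K * (real L / real N) + K * (\<bar>s\<bar> / L)" by (simp add: g_def distrib_left)
    then have Kg: "K * g \<le> \<eta>" using N(2) Ls by linarith
    have approx: "sq_integrable (approx_error R m {1..int N} (U n) (c n))"
      "mean_sq (approx_error R m {1..int N} (U n) (c n))
        \<le> card {1..int N} * energy (U n) (c n) * \<delta>"
      using mR(2)[unfolded uniformly_close_def, rule_format, of "U n" "c n" "{1..int N}"] U supp by simp_all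
    have "cmod (cf (full_sum {1..int N} (U n) (c n)) (real N powr (-1/2)) - complex_of_real (exp (- (q * EA / 2))))
      \<le> sqrt (D * \<delta>) + sqrt (D * EA * g) + ((1 + C) * real N powr (-1/2) + (real L * (D * EA))\<^sup>2 / real N)
        + (D * EA * g + \<bar>v n - q * EA\<bar>) / 2"
      by (rule row_sum_char_error[OF U supp n(2) L(1) N(1) approx _ v_def g_def C_def])
         (use \<delta> q0 EA_nonneg in auto)
    also have "\<dots> \<le> e1 + e1 + (e1 + e1) + (e1 + 2 * e1) / 2"
    proof (intro add_mono divide_right_mono)
      show "sqrt (D * \<delta>) \<le> e1" using \<delta> \<eta> e1 by (intro real_le_lsqrt) auto
      show "sqrt (D * EA * g) \<le> e1" using Kg \<eta> e1 K0 by (intro real_le_lsqrt) (auto simp: K_def)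
    qed (use N n Kg \<eta> in \<open>auto simp: K_def\<close>)
    also have "\<dots> < 7 * e1" using e1(1) by (simp add: field_simps)
    also have "7 * e1 = e" by (rule e1(2))
    finally show ?case by (simp add: x dist_norm)
  qed
qed

section \<open>Finite-dimensional distributions\<close>

definition time_weight :: "real set \<Rightarrow> (real \<Rightarrow> real) \<Rightarrow> nat \<Rightarrow> int \<Rightarrow> real" where
  "time_weight T \<theta> n u = real n powr (-1/2) * (\<Sum>\<tau>\<in>T. \<theta> \<tau> * of_bool (u \<in> {1..\<lfloor>real n * \<tau>\<rfloor>}))"

definition time_support :: "real set \<Rightarrow> nat \<Rightarrow> int set" where
  "time_support T n = (\<Union>\<tau>\<in>T. {1..\<lfloor>real n * \<tau>\<rfloor>})"

lemma finite_time_support: "finite T \<Longrightarrow> finite (time_support T n)"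
  by (simp add: time_support_def)

lemma time_weight_outside: "u \<notin> time_support T n \<Longrightarrow> time_weight T \<theta> n u = 0"
  unfolding time_weight_def time_support_def by (simp, intro disjI2 sum.neutral) auto

lemma full_sum_time_weight:
  assumes "finite T"
  shows "full_sum {1..int N} (time_support T n) (time_weight T \<theta> n) \<omega>
    = real n powr (-1/2) * (\<Sum>\<tau>\<in>T. \<theta> \<tau> * panel_S \<epsilon> a t s N n \<tau> \<omega>)"
proof -
  let ?Y = "\<lambda>i u. panel_X \<epsilon> a i u \<omega> * panel_X \<epsilon> a (i + s) (u + t) \<omega>"
  have inner: "(\<Sum>u\<in>time_support T n. time_weight T \<theta> n u * ?Y i u)
    = real n powr (-1/2) * (\<Sum>\<tau>\<in>T. \<theta> \<tau> * (\<Sum>u\<in>{1..\<lfloor>real n * \<tau>\<rfloor>}. ?Y i u))" for i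
  proof -
    have "(\<Sum>u\<in>time_support T n. time_weight T \<theta> n u * ?Y i u)
      = real n powr (-1/2) * (\<Sum>u\<in>time_support T n. \<Sum>\<tau>\<in>T. \<theta> \<tau> * (of_bool (u \<in> {1..\<lfloor>real n * \<tau>\<rfloor>}) * ?Y i u))"
      by (simp only: time_weight_def sum_distrib_left sum_distrib_right mult.assoc)
    also have "\<dots> = real n powr (-1/2) * (\<Sum>\<tau>\<in>T. \<theta> \<tau> * (\<Sum>u\<in>time_support T n. of_bool (u \<in> {1..\<lfloor>real n * \<tau>\<rfloor>}) * ?Y i u))"
      by (subst sum.swap) (simp only: sum_distrib_left)
    also have "\<dots> = real n powr (-1/2) * (\<Sum>\<tau>\<in>T. \<theta> \<tau> * (\<Sum>u\<in>{1..\<lfloor>real n * \<tau>\<rfloor>}. ?Y i u))"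
    proof -
      have "(\<Sum>u\<in>time_support T n. of_bool (u \<in> {1..\<lfloor>real n * \<tau>\<rfloor>}) * ?Y i u) = (\<Sum>u\<in>{1..\<lfloor>real n * \<tau>\<rfloor>}. ?Y i u)"
        if "\<tau> \<in> T" for \<tau>
        by (rule sum.mono_neutral_cong_right) (use that assms in \<open>auto simp: time_support_def\<close>)
      then show ?thesis by (simp only: cong: sum.cong)
    qed
    finally show ?thesis .
  qed
  show ?thesis
    unfolding full_sum_def inner panel_S_def sum_distrib_left by (subst sum.swap) (rule refl)
qed

lemma autocorr_time_weight:
  assumes "finite T"
  shows "autocorr (time_support T n) (time_weight T \<theta> n) d
    = (\<Sum>\<tau>\<in>T. \<Sum>\<tau>'\<in>T. \<theta> \<tau> * \<theta> \<tau>' * (real (card (overlap d (real n * \<tau>) (real n * \<tau>'))) / real n))"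
proof -
  let ?b = "\<lambda>\<tau> u. of_bool (u \<in> {1..\<lfloor>real n * \<tau>\<rfloor>}) :: real"
  \<comment> \<open>For n = 0 both sides are 0, since 0 to any power under \<open>powr\<close> and
    division by 0 are 0.\<close>
  have pw: "real n powr (-1/2) * real n powr (-1/2) = 1 / real n"
    by (cases "n = 0") (simp_all add: powr_add[symmetric] powr_minus_divide)
  have cnt: "(\<Sum>u\<in>time_support T n. ?b \<tau> u * ?b \<tau>' (u + d)) = real (card (overlap d (real n * \<tau>) (real n * \<tau>')))"
    if "\<tau> \<in> T" for \<tau> \<tau>'
  proof -
    have "(\<Sum>u\<in>time_support T n. ?b \<tau> u * ?b \<tau>' (u + d)) = (\<Sum>u\<in>overlap d (real n * \<tau>) (real n * \<tau>'). 1)"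
      by (rule sum.mono_neutral_cong_right)
         (use that assms in \<open>auto simp: time_support_def\<close>)
    then show ?thesis by simp
  qed
  have "autocorr (time_support T n) (time_weight T \<theta> n) d
    = (\<Sum>u\<in>time_support T n. (real n powr (-1/2) * real n powr (-1/2)) * ((\<Sum>\<tau>\<in>T. \<theta> \<tau> * ?b \<tau> u) * (\<Sum>\<tau>'\<in>T. \<theta> \<tau>' * ?b \<tau>' (u + d))))"
    unfolding autocorr_def time_weight_def by (intro sum.cong refl) (simp only: mult_ac)
  also have "\<dots> = (\<Sum>u\<in>time_support T n. \<Sum>\<tau>\<in>T. \<Sum>\<tau>'\<in>T. (\<theta> \<tau> * \<theta> \<tau>' / real n) * (?b \<tau> u * ?b \<tau>' (u + d)))"
    unfolding pw sum_product by (simp add: sum_distrib_left mult_ac)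
  also have "\<dots> = (\<Sum>\<tau>\<in>T. \<Sum>\<tau>'\<in>T. (\<theta> \<tau> * \<theta> \<tau>' / real n) * (\<Sum>u\<in>time_support T n. ?b \<tau> u * ?b \<tau>' (u + d)))"
    by (subst sum.swap, intro sum.cong refl, subst sum.swap) (simp only: sum_distrib_left)
  also have "\<dots> = (\<Sum>\<tau>\<in>T. \<Sum>\<tau>'\<in>T. (\<theta> \<tau> * \<theta> \<tau>' / real n) * real (card (overlap d (real n * \<tau>) (real n * \<tau>'))))"
    by (intro sum.cong refl) (simp only: cnt)
  finally show ?thesis by simp
qed

text \<open>A shift by d changes the number of common time points by a bounded amount, which
  disappears after division by n. This is why the limit does not depend on d.\<close>

lemma autocorr_time_weight_tendsto:
  assumes T: "finite T" "T \<subseteq> {0..}"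
  shows "(\<lambda>n. autocorr (time_support T n) (time_weight T \<theta> n) d) \<longlonglongrightarrow> (\<Sum>\<tau>\<in>T. \<Sum>\<tau>'\<in>T. \<theta> \<tau> * \<theta> \<tau>' * min \<tau> \<tau>')"
  unfolding autocorr_time_weight[OF T(1)]
proof (intro tendsto_sum tendsto_mult tendsto_const)
  fix \<tau> \<tau>' assume \<tau>: "\<tau> \<in> T" "\<tau>' \<in> T"
  let ?c = "\<lambda>n. real (card (overlap d (real n * \<tau>) (real n * \<tau>')))"
  have "(\<lambda>n. ?c n / real n - min \<tau> \<tau>') \<longlonglongrightarrow> 0"
  proof (rule Lim_null_comparison)
    show "\<forall>\<^sub>F n in sequentially. norm (?c n / real n - min \<tau> \<tau>') \<le> (2 * \<bar>d\<bar> + 2) / real n"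
      using eventually_gt_at_top[of 0]
    proof eventually_elim
      case (elim n)
      have "?c n / real n - min \<tau> \<tau>' = (?c n - min (real n * \<tau>) (real n * \<tau>')) / real n"
        using elim by (simp add: diff_divide_distrib min_divide_distrib_right)
      moreover have "\<bar>?c n - min (real n * \<tau>) (real n * \<tau>')\<bar> \<le> 2 * \<bar>d\<bar> + 2"
        using \<tau> T(2) by (intro overlap_count) auto
      ultimately show ?case by (simp add: divide_right_mono)
    qed
    show "(\<lambda>n. (2 * \<bar>d\<bar> + 2) / real n) \<longlonglongrightarrow> 0" by (rule lim_const_over_n)
  qed
  then show "(\<lambda>n. ?c n / real n) \<longlonglongrightarrow> min \<tau> \<tau>'" by (simp add: LIM_zero_iff)
qed

section \<open>The normalised process: second moments, tightness and convergence\<close>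

abbreviation scaled_S :: "nat \<times> nat \<Rightarrow> real \<Rightarrow> 'a \<Rightarrow> real" where
  "scaled_S \<equiv> \<lambda>(N, n) \<tau> \<omega>. real n powr (-1/2) * real N powr (-1/2) * panel_S \<epsilon> a t s N n \<tau> \<omega>"

lemma panel_S_measurable: "panel_S \<epsilon> a t s N n \<tau> \<in> borel_measurable M"
  unfolding panel_S_def using panel_X_measurable by measurable

lemma scaled_S_measurable: "scaled_S j \<tau> \<in> borel_measurable M"
  using panel_S_measurable by (cases j) simp

lemma scaled_S_full_sum:
  assumes "finite T"
  shows "(\<Sum>\<tau>\<in>T. \<theta> \<tau> * scaled_S (N, n) \<tau> \<omega>)
    = real N powr (-1/2) * full_sum {1..int N} (time_support T n) (time_weight T \<theta> n) \<omega>"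
  unfolding full_sum_time_weight[OF assms] by (simp add: sum_distrib_left mult_ac)

text \<open>The energy of a single time point is the number of summands divided by n, hence at most
  \<open>\<tau>\<close>. The bound holds for all pairs (N, n), zero included, so tightness will be
  uniform.\<close>

lemma scaled_S_second_moment:
  assumes "0 \<le> \<tau>"
  shows "sq_integrable (scaled_S j \<tau>)" "mean_sq (scaled_S j \<tau>) \<le> \<tau> * EA"
proof -
  obtain N n where j: "j = (N, n)" by (cases j)
  let ?U = "time_support {\<tau>} n" and ?c = "time_weight {\<tau>} (\<lambda>_. 1) n"
  let ?F = "full_sum {1..int N} ?U ?c"
  have U: "finite ?U" by (rule finite_time_support) simp
  have F: "sq_integrable ?F"
    "mean_sq ?F \<le> card {1..int N} * energy ?U ?c * EA"
    by (rule full_sum_second_moment[OF U time_weight_outside], assumption)+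
  have "scaled_S j \<tau> \<omega> = real N powr (-1/2) * ?F \<omega>" for \<omega>
    using scaled_S_full_sum[of "{\<tau>}" "\<lambda>_. 1" N n \<omega>] by (simp add: j)
  then have eq: "(scaled_S j \<tau> \<omega>)\<^sup>2 = (real N powr (-1/2))\<^sup>2 * (?F \<omega>)\<^sup>2" for \<omega>
    by (simp only: power_mult_distrib)
  show "sq_integrable (scaled_S j \<tau>)" unfolding eq using F(1) by simp
  have c2: "energy ?U ?c \<le> \<tau>"
  proof -
    have "energy ?U ?c = autocorr ?U ?c 0" by (simp add: autocorr_def power2_eq_square)
    also have "\<dots> = real (card {1..\<lfloor>real n * \<tau>\<rfloor>}) / real n" by (simp add: autocorr_time_weight)
    also have "\<dots> \<le> real n * \<tau> / real n"
      using assms by (intro divide_right_mono) (auto simp: of_nat_nat)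
    also have "\<dots> \<le> \<tau>" using assms by simp
    finally show ?thesis .
  qed
  have N: "(real N powr (-1/2))\<^sup>2 * real N \<le> 1"
    by (cases "N = 0") (simp_all add: power2_eq_square powr_add[symmetric] powr_minus_divide)
  have "mean_sq (scaled_S j \<tau>) = (real N powr (-1/2))\<^sup>2 * mean_sq ?F"
    unfolding eq by simp
  also have "\<dots> \<le> (real N powr (-1/2))\<^sup>2 * (real N * energy ?U ?c * EA)"
    using F(2) by (intro mult_left_mono) simp_all
  also have "\<dots> = ((real N powr (-1/2))\<^sup>2 * real N) * (energy ?U ?c * EA)" by (simp only: mult_ac)
  also have "\<dots> \<le> 1 * (\<tau> * EA)"
    using N c2 EA_nonneg assms by (intro mult_mono mult_right_mono) (auto intro!: mult_nonneg_nonneg sum_nonneg)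
  finally show "mean_sq (scaled_S j \<tau>) \<le> \<tau> * EA" by simp
qed

lemma scaled_S_tight:
  assumes T: "finite T" "T \<subseteq> {0..}" and e: "e > 0"
  shows "\<exists>r. \<forall>j. measure (fdd_law M (scaled_S j) T) (space (fdd_law M (scaled_S j) T) - cube T r) \<le> e"
proof -
  define S where "S = (\<Sum>\<tau>\<in>T. \<tau> * EA)"
  have S0: "0 \<le> S" unfolding S_def using T EA_nonneg by (intro sum_nonneg) auto
  \<comment> \<open>Chebyshev's inequality and a union bound over \<open>T\<close> give at most S /
    r^2 outside the cube. The added 1 keeps \<open>r\<close> positive when S = 0.\<close>
  define r where "r = sqrt (S / e) + 1"
  have r: "r > 0" "S / r\<^sup>2 \<le> e"
  proof -
    show "r > 0" using S0 e by (simp add: r_def add_nonneg_pos)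
    have "S / e = (sqrt (S / e))\<^sup>2" using S0 e by simp
    also have "\<dots> \<le> r\<^sup>2" using S0 e by (intro power_mono) (auto simp: r_def)
    finally show "S / r\<^sup>2 \<le> e" using e \<open>r > 0\<close> by (simp add: divide_le_eq mult.commute)
  qed
  have "measure (fdd_law M (scaled_S j) T) (space (fdd_law M (scaled_S j) T) - cube T r) \<le> e" for j
  proof -
    let ?Z = "scaled_S j"
    let ?A = "\<lambda>\<tau>. {\<omega> \<in> space M. r < \<bar>?Z \<tau> \<omega>\<bar>}"
    have Zm: "(\<lambda>\<omega>. \<lambda>\<tau>\<in>T. ?Z \<tau> \<omega>) \<in> measurable M (borel_on T)"
      by (rule measurable_restrict) (rule scaled_S_measurable)
    have box: "cube T r \<in> sets (borel_on T)"
      by (rule sets_PiM_I_finite[OF T(1)]) simp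
    have Am: "?A \<tau> \<in> sets M" for \<tau>
      using scaled_S_measurable[of j \<tau>] by measurable
    let ?Out = "(\<lambda>\<omega>. \<lambda>\<tau>\<in>T. ?Z \<tau> \<omega>) -` (space (borel_on T) - cube T r) \<inter> space M"
    have "measure (fdd_law M ?Z T) (space (fdd_law M ?Z T) - cube T r)
      = prob (?Out)"
      unfolding fdd_law_def using Zm box by (subst measure_distr) auto
    also have "\<dots> \<le> prob (\<Union>\<tau>\<in>T. ?A \<tau>)"
    proof (rule finite_measure_mono)
      show "?Out \<subseteq> (\<Union>\<tau>\<in>T. ?A \<tau>)"
      proof
        fix \<omega> assume \<omega>: "\<omega> \<in> ?Out"
        then have "\<not> (\<forall>\<tau>\<in>T. ?Z \<tau> \<omega> \<in> {-r..r})" by auto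
        then obtain \<tau> where "\<tau> \<in> T" "?Z \<tau> \<omega> \<notin> {-r..r}" by blast
        then have "r < \<bar>?Z \<tau> \<omega>\<bar>" by (simp add: not_le) linarith
        then show "\<omega> \<in> (\<Union>\<tau>\<in>T. ?A \<tau>)" using \<omega> \<open>\<tau> \<in> T\<close> by blast
      qed
    qed (use Am T in auto)
    also have "\<dots> \<le> (\<Sum>\<tau>\<in>T. prob (?A \<tau>))"
      using Am T by (intro finite_measure_subadditive_finite) auto
    also have "\<dots> \<le> (\<Sum>\<tau>\<in>T. \<tau> * EA / r\<^sup>2)"
    proof (rule sum_mono)
      fix \<tau> assume "\<tau> \<in> T"
      then have \<tau>: "0 \<le> \<tau>" using T by auto
      have "prob (?A \<tau>) = expectation (indicator (?A \<tau>))" using Am by simp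
      also have "\<dots> \<le> expectation (\<lambda>\<omega>. (?Z \<tau> \<omega>)\<^sup>2 / r\<^sup>2)"
      proof (rule integral_mono)
        show "integrable M (indicator (?A \<tau>) :: _ \<Rightarrow> real)" using Am by (intro integrable_real_indicator) (auto simp: emeasure_eq_measure)
        show "integrable M (\<lambda>\<omega>. (?Z \<tau> \<omega>)\<^sup>2 / r\<^sup>2)" using scaled_S_second_moment(1)[OF \<tau>] by simp
        fix \<omega>
        have "1 \<le> z\<^sup>2 / r\<^sup>2" if "r < \<bar>z\<bar>" for z
        proof -
          have "r\<^sup>2 \<le> \<bar>z\<bar>\<^sup>2" using that r by (intro power_mono) auto
          then show ?thesis using r by simp
        qed
        then show "indicator (?A \<tau>) \<omega> \<le> (?Z \<tau> \<omega>)\<^sup>2 / r\<^sup>2" by (auto simp: indicator_def)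
      qed
      also have "\<dots> = mean_sq (?Z \<tau>) / r\<^sup>2" by simp
      also have "\<dots> \<le> \<tau> * EA / r\<^sup>2"
        using scaled_S_second_moment(2)[OF \<tau>] by (intro divide_right_mono) auto
      finally show "prob (?A \<tau>) \<le> \<tau> * EA / r\<^sup>2" .
    qed
    also have "\<dots> = S / r\<^sup>2" by (simp add: S_def sum_divide_distrib)
    finally show ?thesis using r by linarith
  qed
  then show ?thesis by blast
qed

lemma fdd_conv_scaled_S:
  assumes B: "standard_brownian_motion M' B"
  shows "fdd_conv (sequentially \<times>\<^sub>F sequentially) M scaled_S M' (\<lambda>\<tau> \<omega>. sqrt EA * B \<tau> \<omega>)"
  unfolding fdd_conv_def
proof (intro allI impI)
  fix T :: "real set" assume "finite T \<and> T \<subseteq> {0..}"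
  then have T: "finite T" "T \<subseteq> {0..}" by auto
  have M': "prob_space M'" and Bm: "B \<tau> \<in> borel_measurable M'" if "0 \<le> \<tau>" for \<tau>
    using B that by (auto simp: standard_brownian_motion_def)
  have M': "prob_space M'" using B by (simp add: standard_brownian_motion_def)
  have Ym: "(\<lambda>\<omega>. sqrt EA * B \<tau> \<omega>) \<in> borel_measurable M'" if "\<tau> \<in> T" for \<tau>
    using Bm[of \<tau>] that T by auto
  let ?Y = "\<lambda>\<tau> \<omega>. sqrt EA * B \<tau> \<omega>"
  show "weak_conv_in (powertop_real T) (sequentially \<times>\<^sub>F sequentially) (\<lambda>j. fdd_law M (scaled_S j) T) (fdd_law M' ?Y T)"
  proof (rule weak_conv_in_powertop_real[OF T(1)])
    show "prob_space (fdd_law M (scaled_S j) T)" for j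
      by (rule fdd_law_prob_space[OF prob_space_axioms scaled_S_measurable])
    show "prob_space (fdd_law M' ?Y T)"
      by (rule fdd_law_prob_space[OF M' Ym])
    show "sets (fdd_law M (scaled_S j) T) = sets (borel_on T)" for j by (simp add: fdd_law_def)
    show "sets (fdd_law M' ?Y T) = sets (borel_on T)" by (simp add: fdd_law_def)
    show "\<exists>r. \<forall>\<^sub>F j in sequentially \<times>\<^sub>F sequentially.
       measure (fdd_law M (scaled_S j) T) (space (fdd_law M (scaled_S j) T) - cube T r) \<le> e" if "e > 0" for e
      using scaled_S_tight[OF T that] by (meson always_eventually)
    fix \<theta> :: "real \<Rightarrow> real"
    let ?q = "\<Sum>\<tau>\<in>T. \<Sum>\<tau>'\<in>T. \<theta> \<tau> * \<theta> \<tau>' * min \<tau> \<tau>'"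
    have "(\<integral>x. iexp (dot T \<theta> x) \<partial>fdd_law M (scaled_S (N, n)) T)
      = cf (full_sum {1..int N} (time_support T n) (time_weight T \<theta> n)) (real N powr (-1/2))" for N n
      unfolding fdd_law_char[OF scaled_S_measurable] scaled_S_full_sum[OF T(1)] ..
    then have eq: "(\<lambda>j. \<integral>x. iexp (dot T \<theta> x) \<partial>fdd_law M (scaled_S j) T)
      = (\<lambda>(N, n). \<integral>\<omega>. iexp (real N powr (-1/2) * full_sum {1..int N} (time_support T n) (time_weight T \<theta> n) \<omega>) \<partial>M)"
      by (intro ext) (auto split: prod.split)
    have "(\<integral>x. iexp (dot T \<theta> x) \<partial>fdd_law M' ?Y T)
      = (\<integral>\<omega>. iexp (\<Sum>\<tau>\<in>T. (\<theta> \<tau> * sqrt EA) * B \<tau> \<omega>) \<partial>M')"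
      by (simp only: fdd_law_char[where Z = ?Y, OF Ym] mult.assoc)
    also have "\<dots> = complex_of_real (exp (- ((\<Sum>\<tau>\<in>T. \<Sum>\<tau>'\<in>T. (\<theta> \<tau> * sqrt EA) * (\<theta> \<tau>' * sqrt EA) * min \<tau> \<tau>') / 2)))"
      by (rule brownian_char[OF B T])
    also have "(\<Sum>\<tau>\<in>T. \<Sum>\<tau>'\<in>T. (\<theta> \<tau> * sqrt EA) * (\<theta> \<tau>' * sqrt EA) * min \<tau> \<tau>') = ?q * EA"
      unfolding sum_distrib_right
    proof (intro sum.cong refl)
      fix \<tau> \<tau>'
      have "(\<theta> \<tau> * sqrt EA) * (\<theta> \<tau>' * sqrt EA) * min \<tau> \<tau>' = \<theta> \<tau> * \<theta> \<tau>' * min \<tau> \<tau>' * (sqrt EA * sqrt EA)"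
        by (simp only: mult_ac)
      then show "(\<theta> \<tau> * sqrt EA) * (\<theta> \<tau>' * sqrt EA) * min \<tau> \<tau>' = \<theta> \<tau> * \<theta> \<tau>' * min \<tau> \<tau>' * EA"
        using EA_nonneg by simp
    qed
    finally have lim: "(\<integral>x. iexp (dot T \<theta> x) \<partial>fdd_law M' ?Y T)
      = complex_of_real (exp (- (?q * EA / 2)))" .
    show "((\<lambda>j. \<integral>x. iexp (dot T \<theta> x) \<partial>fdd_law M (scaled_S j) T) \<longlongrightarrow>
        (\<integral>x. iexp (dot T \<theta> x) \<partial>fdd_law M' ?Y T)) (sequentially \<times>\<^sub>F sequentially)"
      unfolding eq lim
      by (rule row_sum_char_limit[OF finite_time_support[OF T(1)] time_weight_outside autocorr_time_weight_tendsto[OF T]])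
  qed
qed

end

text \<open>The product filter expresses that N and n tend to infinity in an arbitrary way.
  Integrability is part of the conclusion because the integral of a non-integrable function would be
  0 by convention, and the limit would lose its meaning.\<close>

theorem theorem3p2:
  fixes M :: "'w measure" and \<epsilon> :: "int \<Rightarrow> int \<Rightarrow> 'w \<Rightarrow> real" and a :: "int \<Rightarrow> 'w \<Rightarrow> real"
    and M' :: "'b measure" and B :: "real \<Rightarrow> 'b \<Rightarrow> real"
    and \<beta> p :: real and t s :: int
  assumes "panel_model M \<epsilon> a"
    and "mixing_density M (a 0) \<beta>" and "\<beta> > 3 / 2"
    and "p > 1" and "integrable M (\<lambda>\<omega>. \<bar>\<epsilon> 0 0 \<omega>\<bar> powr (2 * p))"
    and "s \<noteq> 0"
    and "standard_brownian_motion M' B"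
  shows "integrable M (\<lambda>\<omega>. A_coeff (a 1 \<omega>) (a 2 \<omega>)) \<and>
    fdd_conv (sequentially \<times>\<^sub>F sequentially)
      M (\<lambda>(N, n) \<tau> \<omega>. real n powr (-1/2) * real N powr (-1/2) * panel_S \<epsilon> a t s N n \<tau> \<omega>)
      M' (\<lambda>\<tau> \<omega>. sqrt (\<integral>\<omega>'. A_coeff (a 1 \<omega>') (a 2 \<omega>') \<partial>M) * B \<tau> \<omega>)"
proof -
  interpret panel_model M \<epsilon> a by fact
  interpret panel_mixing M \<epsilon> a s t \<beta>
    by unfold_locales fact+
  show ?thesis
    using integrable_A_coeff fdd_conv_scaled_S[OF assms(7)] unfolding EA_def by blast
qed

end
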